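(* Let $\lambda\ge0$. If $S_\lambda(\Omega)<\widetilde{S}(\Sigma_{\mathcal{D}})$, then $S_\lambda(\Omega)$ is attained.
   Context: Let $\frac12<s<1$, $N>2s$, $2_s^*=\frac{2N}{N-2s}$. $\Omega\subset\mathbb{R}^N$ is a smooth bounded domain; $\Sigma_{\mathcal{D}},\Sigma_{\mathcal{N}}$ are smooth $(N-1)$-dimensional submanifolds of $\partial\Omega$, $\Sigma_{\mathcal{D}}$ closed, $\mathcal{H}_{N-1}(\Sigma_{\mathcal{D}})>0$, $\Sigma_{\mathcal{D}}\cap\Sigma_{\mathcal{N}}=\emptyset$, $\Sigma_{\mathcal{D}}\cup\Sigma_{\mathcal{N}}=\partial\Omega$, $\Gamma=\Sigma_{\mathcal{D}}\cap\overline{\Sigma}_{\mathcal{N}}$ a smooth $(N-2)$-dimensional submanifold. $\mathcal{X}^s_{\Sigma_{\mathcal{D}}}(\mathcal{C}_\Omega)$ is the completion of $C_0^\infty((\Omega\cup\Sigma_{\mathcal{N}})\times[0,\infty))$ under $\|z\|^2=\kappa_s\int_{\Omega\times(0,\infty)}y^{1-2s}|\nabla z|^2dxdy$ ($\kappa_s>0$ a fixed normalization constant). For $w$ in this space with trace $u=w(\cdot,0)$ let $Q_\lambda(w)=\frac{\|w\|^2-\lambda\|u\|^2_{L^2(\Omega)}}{\|u\|^2_{L^{2_s^*}(\Omega)}}$ and $S_\lambda(\Omega)=\inf_{w\not\equiv0}Q_\lambda(w)$. Also $\widetilde{S}(\Sigma_{\mathcal{D}})=\inf_{w\not\equiv0}\|w\|^2/\|w(\cdot,0)\|^2_{L^{2_s^*}(\Omega)}$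 (infimum over the same space). *)

theory Defs
  imports "HOL-Analysis.Analysis"
begin

fun Ck_on :: "nat \<Rightarrow> 'a::euclidean_space set \<Rightarrow> ('a \<Rightarrow> real) \<Rightarrow> bool" where
  "Ck_on 0 U f = continuous_on U f"
| "Ck_on (Suc k) U f =
     (continuous_on U f \<and> (\<forall>x\<in>U. f differentiable (at x)) \<and>
      (\<forall>i\<in>Basis. Ck_on k U (\<lambda>x. frechet_derivative f (at x) i)))"

definition Cinf_on :: "'a::euclidean_space set \<Rightarrow> ('a \<Rightarrow> real) \<Rightarrow> bool" where
  "Cinf_on U f \<longleftrightarrow> (\<forall>k. Ck_on k U f)"

definition smooth_submanifold_codim :: "nat \<Rightarrow> 'a::euclidean_space set \<Rightarrow> bool" where
  "smooth_submanifold_codim m M \<longleftrightarrow>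
     (\<forall>p\<in>M. \<exists>U F. open U \<and> p \<in> U \<and> (\<forall>j<m. Cinf_on U (F j)) \<and>
        M \<inter> U = {x\<in>U. \<forall>j<m. F j x = 0} \<and>
        (\<forall>x\<in>M \<inter> U. \<forall>c::nat \<Rightarrow> real.
            (\<forall>v. (\<Sum>j<m. c j * frechet_derivative (F j) (at x) v) = 0) \<longrightarrow> (\<forall>j<m. c j = 0)))"

definition smooth_bounded_domain :: "'a::euclidean_space set \<Rightarrow> bool" where
  "smooth_bounded_domain \<Omega> \<longleftrightarrow> open \<Omega> \<and> bounded \<Omega> \<and> connected \<Omega> \<and> \<Omega> \<noteq> {} \<and>
     (\<forall>p\<in>frontier \<Omega>. \<exists>r>0. \<exists>\<rho>. Cinf_on (ball p r) \<rho> \<and>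
        (\<forall>x\<in>ball p r. x \<in> \<Omega> \<longleftrightarrow> \<rho> x < 0) \<and>
        (\<forall>x\<in>ball p r. x \<in> frontier \<Omega> \<longleftrightarrow> \<rho> x = 0) \<and>
        (\<forall>x\<in>ball p r. \<rho> x = 0 \<longrightarrow> frechet_derivative \<rho> (at x) \<noteq> (\<lambda>v. 0)))"

section \<open>Hausdorff measure (unnormalised; positivity does not depend on the constant)\<close>

definition hausdorff_pre :: "real \<Rightarrow> real \<Rightarrow> 'a::metric_space set \<Rightarrow> ennreal" where
  "hausdorff_pre d \<delta> A =
     (INF C \<in> {C :: nat \<Rightarrow> 'a set. A \<subseteq> (\<Union>i. C i) \<and> (\<forall>i. bounded (C i) \<and> diameter (C i) \<le> \<delta>)}.
        (\<Sum>i. ennreal (diameter (C i) powr d)))"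

definition hausdorff_measure :: "real \<Rightarrow> 'a::metric_space set \<Rightarrow> ennreal" where
  "hausdorff_measure d A = (SUP \<delta>\<in>{0<..}. hausdorff_pre d \<delta> A)"

definition grad2 :: "('a::euclidean_space \<times> real \<Rightarrow> real) \<Rightarrow> 'a \<times> real \<Rightarrow> real" where
  "grad2 z p = (\<Sum>i\<in>Basis. (frechet_derivative z (at p) i)\<^sup>2)"

text \<open>Test functions C_0^infinity((Omega union Sigma_N) x [0,infinity)): restrictions to
  closure(Omega) x [0,infinity) of smooth functions whose support there is compact and
  contained in (Omega union Sigma_N) x [0,infinity).\<close>
definition test_fun :: "'a::euclidean_space set \<Rightarrow> 'a set \<Rightarrow> ('a \<times> real \<Rightarrow> real) \<Rightarrow> bool" where
  "test_fun \<Omega> \<Sigma>N \<phi> \<longleftrightarrow> Cinf_on UNIV \<phi> \<and>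
     compact (closure {q \<in> closure \<Omega> \<times> {0..}. \<phi> q \<noteq> 0}) \<and>
     closure {q \<in> closure \<Omega> \<times> {0..}. \<phi> q \<noteq> 0} \<subseteq> (\<Omega> \<union> \<Sigma>N) \<times> {0..}"

definition ext_energy :: "real \<Rightarrow> real \<Rightarrow> 'a::euclidean_space set \<Rightarrow> ('a \<times> real \<Rightarrow> real) \<Rightarrow> real" where
  "ext_energy \<kappa> s \<Omega> z = \<kappa> * (LINT p : \<Omega> \<times> {0<..} | lborel. snd p powr (1 - 2 * s) * grad2 z p)"

definition Lp_norm :: "real \<Rightarrow> 'a::euclidean_space set \<Rightarrow> ('a \<Rightarrow> real) \<Rightarrow> real" where
  "Lp_norm q \<Omega> u = (LINT x : \<Omega> | lborel. \<bar>u x\<bar> powr q) powr (1 / q)"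

definition trace0 :: "('a \<times> real \<Rightarrow> real) \<Rightarrow> 'a \<Rightarrow> real" where
  "trace0 z = (\<lambda>x. z (x, 0))"

definition crit_exp :: "real \<Rightarrow> nat \<Rightarrow> real" where
  "crit_exp s N = 2 * real N / (real N - 2 * s)"

text \<open>Elements of the completion X^s_{Sigma_D}(C_Omega) are represented by Cauchy sequences
  of test functions (w.r.t. the extension norm); norms of an element are limits of the
  norms along a representing sequence.\<close>
definition X_cauchy :: "real \<Rightarrow> real \<Rightarrow> 'a::euclidean_space set \<Rightarrow> 'a set \<Rightarrow> (nat \<Rightarrow> 'a \<times> real \<Rightarrow> real) \<Rightarrow> bool" where
  "X_cauchy \<kappa> s \<Omega> \<Sigma>N F \<longleftrightarrow> (\<forall>n. test_fun \<Omega> \<Sigma>N (F n)) \<and>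
     (\<forall>\<epsilon>>0. \<exists>M. \<forall>m\<ge>M. \<forall>n\<ge>M. ext_energy \<kappa> s \<Omega> (\<lambda>p. F m p - F n p) < \<epsilon>)"

definition X_normsq :: "real \<Rightarrow> real \<Rightarrow> 'a::euclidean_space set \<Rightarrow> (nat \<Rightarrow> 'a \<times> real \<Rightarrow> real) \<Rightarrow> real" where
  "X_normsq \<kappa> s \<Omega> F = lim (\<lambda>n. ext_energy \<kappa> s \<Omega> (F n))"

definition trace_Lp :: "real \<Rightarrow> 'a::euclidean_space set \<Rightarrow> (nat \<Rightarrow> 'a \<times> real \<Rightarrow> real) \<Rightarrow> real" where
  "trace_Lp q \<Omega> F = lim (\<lambda>n. Lp_norm q \<Omega> (trace0 (F n)))"

text \<open>Admissible elements: those with nonzero trace (the quotient is only defined there).\<close>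
definition admissible :: "real \<Rightarrow> real \<Rightarrow> 'a::euclidean_space set \<Rightarrow> 'a set \<Rightarrow> (nat \<Rightarrow> 'a \<times> real \<Rightarrow> real) set" where
  "admissible \<kappa> s \<Omega> \<Sigma>N = {F. X_cauchy \<kappa> s \<Omega> \<Sigma>N F \<and> trace_Lp (crit_exp s DIM('a)) \<Omega> F \<noteq> 0}"

definition Q_lambda :: "real \<Rightarrow> real \<Rightarrow> real \<Rightarrow> 'a::euclidean_space set \<Rightarrow> (nat \<Rightarrow> 'a \<times> real \<Rightarrow> real) \<Rightarrow> real" where
  "Q_lambda \<kappa> s lam \<Omega> F =
     (X_normsq \<kappa> s \<Omega> F - lam * (trace_Lp 2 \<Omega> F)\<^sup>2) / (trace_Lp (crit_exp s DIM('a)) \<Omega> F)\<^sup>2"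

definition S_lambda :: "real \<Rightarrow> real \<Rightarrow> real \<Rightarrow> 'a::euclidean_space set \<Rightarrow> 'a set \<Rightarrow> real" where
  "S_lambda \<kappa> s lam \<Omega> \<Sigma>N = Inf (Q_lambda \<kappa> s lam \<Omega> ` admissible \<kappa> s \<Omega> \<Sigma>N)"

definition S_tilde :: "real \<Rightarrow> real \<Rightarrow> 'a::euclidean_space set \<Rightarrow> 'a set \<Rightarrow> real" where
  "S_tilde \<kappa> s \<Omega> \<Sigma>N = Inf ((\<lambda>F. X_normsq \<kappa> s \<Omega> F / (trace_Lp (crit_exp s DIM('a)) \<Omega> F)\<^sup>2)
                              ` admissible \<kappa> s \<Omega> \<Sigma>N)"

end

theory Submission
  imports Defs "HOL-Complex_Analysis.Great_Picard"
begin

text \<open>Moving up to height \<open>r\<close>, sideways, and down again bounds the squared \<open>L\<^sup>2\<close> norm of a translation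
  difference of the trace by Hardy's inequality and the energy of the slice at height \<open>r\<close>; here \<open>r\<close> is
  free. Along segments that leave \<open>\<Omega>\<close> through the Dirichlet part this gives a Poincare inequality near
  one point, which translations carry to all of \<open>\<Omega>\<close>. Averaging over translations in a cone and
  optimising its size pointwise gives the critical Sobolev inequality (the interior cone condition
  follows from the local defining functions), and averaging over small balls gives compactness in
  \<open>L\<^sup>2(\<Omega>)\<close>, with the Sobolev bound controlling a thin boundary layer.

  For a normalised minimising sequence \<open>\<psi>\<close> and its Cauchy sequence \<open>\<sigma>\<close> of convex combinations, let
  \<open>\<theta>\<close> be the limit of the critical mass of \<open>\<sigma>\<close>, the integral of the power \<open>q = 2N/(N - 2s)\<close> of the
  trace. The Brezis--Lieb splitting shows that \<open>\<psi> - \<sigma>\<close> carries critical mass \<open>1 - \<theta>\<close>, which costs at least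
  \<open>S~ (1 - \<theta>) powr (2 / q)\<close>, while \<open>\<sigma>\<close> costs at least \<open>S\<^sub>\<lambda> \<theta> powr (2 / q)\<close>. As these costs add up to
  at most \<open>S\<^sub>\<lambda> < S~\<close>, concavity forces \<open>\<theta> = 1\<close>, and \<open>\<sigma>\<close> is a minimiser.\<close>

section \<open>Integration along lines\<close>

text \<open>An element of the completion is only a Cauchy sequence of test functions, so there is no
  limit function to which weak convergence, Fatou's lemma or pointwise convergence could be applied.
  All estimates are therefore inequalities for single test functions with uniform constants, and
  limits are taken of real sequences only. Convex combinations can stand in for a weak limit because
  the energy is a quadratic form: near-minimality in a convex set forces the Cauchy property.

  Compactness is lost in the critical power alone. The trace is compact in L^2, so the term with
  \<open>lam\<close> does not see the part of the sequence that may concentrate; this is why that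
  part is charged with S~ and not with the smaller infimum.

  No fractional Sobolev space occurs because of the free height r: a translation is performed at a
  height of at least about its own length, and integrating over that height against r^(-1-2s)
  reproduces the weight y^(1-2s) of the energy. The Dirichlet condition enters these estimates
  pointwise, as test functions vanish above the Dirichlet part at every height.\<close>

lemma weighted_ftc_square:
  fixes g g' w :: "real \<Rightarrow> real"
  assumes ab: "a < b" and d: "\<And>t. (g has_real_derivative g' t) (at t)"
    and cont: "continuous_on UNIV g'" and w[measurable]: "w \<in> borel_measurable borel"
    and pos: "\<And>t. a < t \<Longrightarrow> t < b \<Longrightarrow> 0 < w t"
  shows "ennreal ((g b - g a)\<^sup>2) \<le> (\<integral>\<^sup>+t\<in>{a<..<b}. ennreal (1 / w t) \<partial>lborel)
           * (\<integral>\<^sup>+t\<in>{a<..<b}. ennreal (w t * (g' t)\<^sup>2) \<partial>lborel)"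
proof -
  have m[measurable]: "g' \<in> borel_measurable borel"
    using cont by (rule borel_measurable_continuous_onI)
  have hb: "has_bochner_integral lborel (\<lambda>x. indicator {a..b} x *\<^sub>R g' x) (g b - g a)"
    using ab d cont by (intro has_bochner_integral_FTC_Icc)
      (auto simp: has_real_derivative_iff_has_vector_derivative
         intro: has_vector_derivative_at_within continuous_on_subset)
  \<comment> \<open>Cauchy-Schwarz for the splitting of |g'| into \<open>sqrt (1 / w)\<close> and
    \<open>sqrt w * \<bar>g'\<bar>\<close>.\<close>
  let ?f = "\<lambda>t. ennreal (sqrt (1 / w t)) * indicator {a<..<b} t"
  let ?h = "\<lambda>t. ennreal (sqrt (w t) * \<bar>g' t\<bar>) * indicator {a<..<b} t"
  have "ennreal \<bar>g b - g a\<bar> \<le> (\<integral>\<^sup>+t. norm (indicator {a..b} t *\<^sub>R g' t) \<partial>lborel)"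
    using integral_norm_bound_ennreal[of lborel "\<lambda>x. indicator {a..b} x *\<^sub>R g' x"] hb
    by (simp add: has_bochner_integral_iff)
  \<comment> \<open>The weight is positive on the open interval only; the endpoints are null
    sets.\<close>
  also have "\<dots> = (\<integral>\<^sup>+t. ?f t * ?h t \<partial>lborel)"
  proof (intro nn_integral_cong_AE)
    have "AE t in lborel. t \<noteq> a" "AE t in lborel. t \<noteq> b" by (auto simp: AE_lborel_singleton)
    then show "AE t in lborel. ennreal (norm (indicator {a..b} t *\<^sub>R g' t)) = ?f t * ?h t"
    proof eventually_elim
      case (elim t)
      have "sqrt (1 / w t) * (sqrt (w t) * \<bar>g' t\<bar>) = \<bar>g' t\<bar>" if "a < t" "t < b"
        using pos[OF that] by (simp add: real_sqrt_divide)
      with elim pos[of t] show ?case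
        by (auto split: split_indicator simp: ennreal_mult[symmetric])
    qed
  qed
  finally have "(ennreal \<bar>g b - g a\<bar>)\<^sup>2 \<le> (\<integral>\<^sup>+t. ?f t * ?h t \<partial>lborel)\<^sup>2"
    by (rule power_mono) simp
  also have "\<dots> \<le> (\<integral>\<^sup>+t. ?f t ^ 2 \<partial>lborel) * (\<integral>\<^sup>+t. ?h t ^ 2 \<partial>lborel)"
    by (rule Cauchy_Schwarz_nn_integral) measurable
  also have "(\<integral>\<^sup>+t. ?f t ^ 2 \<partial>lborel) = (\<integral>\<^sup>+t\<in>{a<..<b}. ennreal (1 / w t) \<partial>lborel)"
    using pos by (intro nn_integral_cong) (auto split: split_indicator simp: ennreal_power less_imp_le)
  also have "(\<integral>\<^sup>+t. ?h t ^ 2 \<partial>lborel) = (\<integral>\<^sup>+t\<in>{a<..<b}. ennreal (w t * (g' t)\<^sup>2) \<partial>lborel)"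
    using pos by (intro nn_integral_cong) (auto split: split_indicator simp: ennreal_power power_mult_distrib less_imp_le)
  finally show ?thesis by (simp add: ennreal_power)
qed

section \<open>Gradients and increments along segments\<close>

lemma frechet_derivative_Basis_sum:
  fixes f :: "'b::euclidean_space \<Rightarrow> real"
  assumes "f differentiable at p"
  shows "frechet_derivative f (at p) v = (\<Sum>i\<in>Basis. (v \<bullet> i) * frechet_derivative f (at p) i)"
proof -
  interpret bounded_linear "frechet_derivative f (at p)"
    using assms by (simp add: frechet_derivative_works has_derivative_bounded_linear)
  have "frechet_derivative f (at p) v = frechet_derivative f (at p) (\<Sum>i\<in>Basis. (v \<bullet> i) *\<^sub>R i)"
    by (simp add: euclidean_representation)
  then show ?thesis by (simp add: sum scaleR)
qed

lemma grad2_bound: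
  fixes f :: "'a::euclidean_space \<times> real \<Rightarrow> real"
  assumes "f differentiable at p"
  shows "(frechet_derivative f (at p) v)\<^sup>2 \<le> grad2 f p * (norm v)\<^sup>2"
proof -
  have "(frechet_derivative f (at p) v)\<^sup>2 \<le>
      (\<Sum>i\<in>Basis. (v \<bullet> i)\<^sup>2) * (\<Sum>i\<in>Basis. (frechet_derivative f (at p) i)\<^sup>2)"
    unfolding frechet_derivative_Basis_sum[OF assms, of v] by (rule Cauchy_Schwarz_ineq_sum)
  also have "(\<Sum>i\<in>Basis. (v \<bullet> i)\<^sup>2) = (norm v)\<^sup>2"
    by (simp add: norm_eq_sqrt_inner euclidean_inner[of v v] power2_eq_square sum_nonneg)
  finally show ?thesis by (simp add: grad2_def mult.commute)
qed

text \<open>Differentiability is demanded on the whole space, as it is for test functions, so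
  derivatives at height 0 and on the boundary of \<Omega> are two-sided. Continuity of the partial
  derivatives makes \<open>grad2\<close> measurable.\<close>

definition C1 :: "('b::euclidean_space \<Rightarrow> real) \<Rightarrow> bool" where
  "C1 f \<longleftrightarrow> (\<forall>x. f differentiable at x) \<and>
      (\<forall>i\<in>Basis. continuous_on UNIV (\<lambda>x. frechet_derivative f (at x) i))"

lemma Cinf_on_imp_C1: "Cinf_on UNIV f \<Longrightarrow> C1 f"
  unfolding Cinf_on_def C1_def by (auto dest!: spec[of _ "Suc 0"])

lemma C1_continuous: "C1 f \<Longrightarrow> continuous_on UNIV f"
  unfolding C1_def by (meson continuous_at_imp_continuous_on differentiable_imp_continuous_within)

lemma C1_continuous_grad2: "C1 f \<Longrightarrow> continuous_on UNIV (grad2 f)"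
  unfolding C1_def grad2_def[abs_def] by (intro continuous_intros) auto

lemma C1_measurable[measurable_dest]: "C1 f \<Longrightarrow> f \<in> borel_measurable borel"
  by (rule borel_measurable_continuous_onI[OF C1_continuous])

lemma C1_measurable_grad2[measurable_dest]: "C1 f \<Longrightarrow> grad2 f \<in> borel_measurable borel"
  by (rule borel_measurable_continuous_onI[OF C1_continuous_grad2])

lemma grad2_nonneg: "0 \<le> grad2 f p"
  by (simp add: grad2_def sum_nonneg)

lemma has_derivative_along_line:
  assumes "(f has_derivative f') (at (x + t *\<^sub>R v))"
  shows "((\<lambda>t. f (x + t *\<^sub>R v)) has_real_derivative f' v) (at t)"
proof -
  have 1: "((\<lambda>t. x + t *\<^sub>R v) has_derivative (\<lambda>h. h *\<^sub>R v)) (at t)"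
    by (auto intro!: derivative_eq_intros)
  have "((\<lambda>t. f (x + t *\<^sub>R v)) has_derivative (\<lambda>h. f' (h *\<^sub>R v))) (at t)"
    using has_derivative_compose[OF 1 assms] by simp
  moreover have "f' (h *\<^sub>R v) = f' v * h" for h
    using assms by (simp add: has_derivative_def bounded_linear.linear linear_cmul)
  ultimately show ?thesis by (simp add: has_field_derivative_def)
qed

text \<open>One bound serves two weights: \<open>t powr (1 - s)\<close> on vertical segments and the
  constant 1 on horizontal ones.\<close>

lemma C1_line_bound:
  fixes f :: "'a::euclidean_space \<times> real \<Rightarrow> real"
  assumes f: "C1 f" and ab: "a < b" and w[measurable]: "w \<in> borel_measurable borel"
    and pos: "\<And>t. a < t \<Longrightarrow> t < b \<Longrightarrow> 0 < w t"
  shows "ennreal ((f (p + b *\<^sub>R v) - f (p + a *\<^sub>R v))\<^sup>2) \<le>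
    ennreal ((norm v)\<^sup>2) * (\<integral>\<^sup>+t\<in>{a<..<b}. ennreal (1 / w t) \<partial>lborel)
      * (\<integral>\<^sup>+t\<in>{a<..<b}. ennreal (w t * grad2 f (p + t *\<^sub>R v)) \<partial>lborel)"
proof -
  have df: "f differentiable at x" for x using f unfolding C1_def by blast
  define g' where "g' = (\<lambda>t. frechet_derivative f (at (p + t *\<^sub>R v)) v)"
  have [measurable]: "grad2 f \<in> borel_measurable borel" using f by measurable
  have "g' = (\<lambda>t. \<Sum>i\<in>Basis. (v \<bullet> i) * frechet_derivative f (at (p + t *\<^sub>R v)) i)"
    unfolding g'_def frechet_derivative_Basis_sum[OF df, of _ v] by simp
  moreover have "continuous_on UNIV (\<lambda>t. \<Sum>i\<in>Basis. (v \<bullet> i) * frechet_derivative f (at (p + t *\<^sub>R v)) i)"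
    using f unfolding C1_def
    by (intro continuous_intros continuous_on_compose2[where f = "\<lambda>t. p + t *\<^sub>R v" and t = UNIV]) auto
  ultimately have cont: "continuous_on UNIV g'" by simp
  have d: "((\<lambda>t. f (p + t *\<^sub>R v)) has_real_derivative g' t) (at t)" for t
    unfolding g'_def by (rule has_derivative_along_line) (use df frechet_derivative_works in blast)
  have "ennreal ((f (p + b *\<^sub>R v) - f (p + a *\<^sub>R v))\<^sup>2) \<le> (\<integral>\<^sup>+t\<in>{a<..<b}. ennreal (1 / w t) \<partial>lborel)
           * (\<integral>\<^sup>+t\<in>{a<..<b}. ennreal (w t * (g' t)\<^sup>2) \<partial>lborel)"
    by (rule weighted_ftc_square[OF ab d cont w pos])
  then have 1: "ennreal ((f (p + b *\<^sub>R v) - f (p + a *\<^sub>R v))\<^sup>2) \<le> (\<integral>\<^sup>+t\<in>{a<..<b}. ennreal (1 / w t) \<partial>lborel)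
           * (\<integral>\<^sup>+t\<in>{a<..<b}. ennreal (w t * (g' t)\<^sup>2) \<partial>lborel)" .
  have "(\<integral>\<^sup>+t\<in>{a<..<b}. ennreal (w t * (g' t)\<^sup>2) \<partial>lborel) \<le>
     (\<integral>\<^sup>+t. ennreal ((norm v)\<^sup>2) * (ennreal (w t * grad2 f (p + t *\<^sub>R v)) * indicator {a<..<b} t) \<partial>lborel)"
  proof (intro nn_integral_mono)
    fix t
    have "w t * (g' t)\<^sup>2 \<le> (norm v)\<^sup>2 * (w t * grad2 f (p + t *\<^sub>R v))" if "a < t" "t < b"
      using mult_left_mono[OF grad2_bound[OF df, of "p + t *\<^sub>R v" v], of "w t"] pos[OF that]
      by (simp add: g'_def mult_ac)
    then show "ennreal (w t * (g' t)\<^sup>2) * indicator {a<..<b} t \<le>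
        ennreal ((norm v)\<^sup>2) * (ennreal (w t * grad2 f (p + t *\<^sub>R v)) * indicator {a<..<b} t)"
      by (auto split: split_indicator simp: ennreal_mult'[symmetric] intro!: ennreal_leI)
  qed
  also have "\<dots> = ennreal ((norm v)\<^sup>2) * (\<integral>\<^sup>+t\<in>{a<..<b}. ennreal (w t * grad2 f (p + t *\<^sub>R v)) \<partial>lborel)"
    by (rule nn_integral_cmult) measurable
  finally have "(\<integral>\<^sup>+t\<in>{a<..<b}. ennreal (1 / w t) \<partial>lborel) * (\<integral>\<^sup>+t\<in>{a<..<b}. ennreal (w t * (g' t)\<^sup>2) \<partial>lborel) \<le>
     (\<integral>\<^sup>+t\<in>{a<..<b}. ennreal (1 / w t) \<partial>lborel) * (ennreal ((norm v)\<^sup>2) * (\<integral>\<^sup>+t\<in>{a<..<b}. ennreal (w t * grad2 f (p + t *\<^sub>R v)) \<partial>lborel))"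
    by (rule mult_left_mono) simp
  with 1 show ?thesis by (simp only: mult_ac)
qed

lemma nn_integral_powr_from_0:
  fixes a c :: real
  assumes "a > -1" "c > 0"
  shows "(\<integral>\<^sup>+t\<in>{0<..<c}. ennreal (t powr a) \<partial>lborel) = ennreal (c powr (a + 1) / (a + 1))"
proof -
  have "((\<lambda>x. if x \<in> {0..c} then x powr a else 0) has_integral (c powr (a+1) / (a+1))) UNIV"
    using has_integral_powr_from_0[of a c] assms has_integral_restrict_UNIV by fastforce
  moreover have "(\<lambda>x. if x \<in> {0..c} then x powr a else 0) = (\<lambda>x. x powr a * indicator {0..c} x)"
    by (auto split: split_indicator)
  ultimately have "((\<lambda>x. x powr a * indicator {0..c} x) has_integral (c powr (a+1) / (a+1))) UNIV"
    by simp
  then have "(\<integral>\<^sup>+x. ennreal (x powr a * indicator {0..c} x) \<partial>lborel) = ennreal (c powr (a+1) / (a+1))"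
    by (intro nn_integral_has_integral_lborel) auto
  moreover have "(\<integral>\<^sup>+t\<in>{0<..<c}. ennreal (t powr a) \<partial>lborel) = (\<integral>\<^sup>+x. ennreal (x powr a * indicator {0..c} x) \<partial>lborel)"
  proof (intro nn_integral_cong_AE)
    have "AE t in lborel. t \<noteq> (0::real)" "AE t in lborel. t \<noteq> c" by (auto simp: AE_lborel_singleton)
    then show "AE x in lborel. ennreal (x powr a) * indicator {0<..<c} x = ennreal (x powr a * indicator {0..c} x)"
      by eventually_elim (auto split: split_indicator)
  qed
  ultimately show ?thesis by simp
qed

lemma nn_integral_powr_at_top:
  fixes a c :: real
  assumes "a < -1" "c > 0"
  shows "(\<integral>\<^sup>+t\<in>{c<..}. ennreal (t powr a) \<partial>lborel) = ennreal (c powr (a + 1) / (- a - 1))"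
proof -
  have "(\<integral>\<^sup>+t. ennreal (t powr a) * indicator {c..} t \<partial>lborel) = ennreal (0 - c powr (a + 1) / (a + 1))"
  proof (rule nn_integral_FTC_atLeast)
    show "((\<lambda>x. x powr (a + 1) / (a + 1)) has_real_derivative x powr a) (at x)" if "c \<le> x" for x
      using DERIV_cdivide[OF has_real_derivative_powr[of x "a + 1"], of "a + 1"] that assms by simp
    have "((\<lambda>x. x powr (a + 1) / (a + 1)) \<longlongrightarrow> 0 / (a + 1)) at_top"
      using assms by (intro tendsto_divide tendsto_neg_powr tendsto_const filterlim_ident) auto
    then show "((\<lambda>x. x powr (a + 1) / (a + 1)) \<longlongrightarrow> 0) at_top" by simp
  qed auto
  moreover have "(\<integral>\<^sup>+t\<in>{c<..}. ennreal (t powr a) \<partial>lborel) = (\<integral>\<^sup>+t. ennreal (t powr a) * indicator {c..} t \<partial>lborel)"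
  proof (intro nn_integral_cong_AE)
    have "AE t in lborel. t \<noteq> c" by (auto simp: AE_lborel_singleton)
    then show "AE t in lborel. ennreal (t powr a) * indicator {c<..} t = ennreal (t powr a) * indicator {c..} t"
      by eventually_elim (auto split: split_indicator)
  qed
  moreover have "0 - c powr (a + 1) / (a + 1) = c powr (a + 1) / (- a - 1)"
    using assms by (auto simp: field_simps)
  ultimately show ?thesis by simp
qed

text \<open>The weight exponent is \<open>1 - s\<close> and not the \<open>1 - 2 * s\<close> of the
  energy, which leaves the factor \<open>r powr s\<close>. The other choice would leave
  \<open>r powr (2 * s)\<close>, and its integral against \<open>r powr (- 1 - 2 * s)\<close>
  diverges logarithmically.\<close>

lemma C1_vertical_bound:
  fixes f :: "'a::euclidean_space \<times> real \<Rightarrow> real"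
  assumes f: "C1 f" and s: "0 < s" and r: "0 < r"
  shows "ennreal ((f (x, r) - f (x, 0))\<^sup>2) \<le> ennreal (r powr s / s) *
     (\<integral>\<^sup>+y\<in>{0<..<r}. ennreal (y powr (1 - s) * grad2 f (x, y)) \<partial>lborel)"
proof -
  have "ennreal ((f ((x, 0) + r *\<^sub>R (0, 1)) - f ((x, 0) + 0 *\<^sub>R (0, 1)))\<^sup>2) \<le>
    ennreal ((norm ((0::'a), (1::real)))\<^sup>2) * (\<integral>\<^sup>+t\<in>{0<..<r}. ennreal (1 / t powr (1 - s)) \<partial>lborel)
      * (\<integral>\<^sup>+t\<in>{0<..<r}. ennreal (t powr (1 - s) * grad2 f ((x, 0) + t *\<^sub>R (0, 1))) \<partial>lborel)"
    by (rule C1_line_bound[OF f r]) auto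
  also have "(\<integral>\<^sup>+t\<in>{0<..<r}. ennreal (1 / t powr (1 - s)) \<partial>lborel) = (\<integral>\<^sup>+t\<in>{0<..<r}. ennreal (t powr (s - 1)) \<partial>lborel)"
    by (intro nn_integral_cong) (auto simp: powr_minus_divide[symmetric])
  also have "\<dots> = ennreal (r powr s / s)"
    using nn_integral_powr_from_0[of "s - 1" r] s r by simp
  finally show ?thesis by simp
qed

lemma C1_horizontal_bound:
  fixes f :: "'a::euclidean_space \<times> real \<Rightarrow> real"
  assumes f: "C1 f" and b: "0 < b"
  shows "ennreal ((f (x + b *\<^sub>R h, y) - f (x, y))\<^sup>2) \<le> ennreal ((norm h)\<^sup>2 * b) *
     (\<integral>\<^sup>+t\<in>{0<..<b}. ennreal (grad2 f (x + t *\<^sub>R h, y)) \<partial>lborel)"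
proof -
  have "ennreal ((f ((x, y) + b *\<^sub>R (h, 0)) - f ((x, y) + 0 *\<^sub>R (h, 0)))\<^sup>2) \<le>
    ennreal ((norm (h, 0::real))\<^sup>2) * (\<integral>\<^sup>+t\<in>{0<..<b}. ennreal (1 / 1) \<partial>lborel)
      * (\<integral>\<^sup>+t\<in>{0<..<b}. ennreal (1 * grad2 f ((x, y) + t *\<^sub>R (h, 0))) \<partial>lborel)"
    by (rule C1_line_bound[OF f b]) auto
  also have "(\<integral>\<^sup>+t\<in>{0<..<b}. ennreal (1 / 1) \<partial>lborel) = ennreal b"
    using b by simp
  finally show ?thesis using b by (simp add: ennreal_mult)
qed

section \<open>Translation estimates by the energy\<close>

abbreviation trace_sq :: "'a::euclidean_space set \<Rightarrow> ('a \<times> real \<Rightarrow> real) \<Rightarrow> ennreal" where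
  "trace_sq V f \<equiv> (\<integral>\<^sup>+x\<in>V. ennreal ((f (x, 0))\<^sup>2) \<partial>lborel)"

abbreviation trace_powr :: "real \<Rightarrow> 'a::euclidean_space set \<Rightarrow> ('a \<times> real \<Rightarrow> real) \<Rightarrow> ennreal" where
  "trace_powr q V f \<equiv> (\<integral>\<^sup>+x\<in>V. ennreal (\<bar>f (x, 0)\<bar> powr q) \<partial>lborel)"

text \<open>Iterated and \<open>ennreal\<close>-valued, so that Tonelli's theorem applies before
  integrability is known. For test functions it is finite and equals \<open>ext_energy\<close>
  divided by \<kappa>.\<close>

definition wenergy :: "real \<Rightarrow> 'a::euclidean_space set \<Rightarrow> ('a \<times> real \<Rightarrow> real) \<Rightarrow> ennreal" where
  "wenergy s \<Omega> f = (\<integral>\<^sup>+x\<in>\<Omega>. (\<integral>\<^sup>+y\<in>{0<..}. ennreal (y powr (1 - 2 * s) * grad2 f (x, y)) \<partial>lborel) \<partial>lborel)"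

definition incr2 :: "'a::euclidean_space set \<Rightarrow> ('a \<times> real \<Rightarrow> real) \<Rightarrow> real \<Rightarrow> ennreal" where
  "incr2 \<Omega> f r = (\<integral>\<^sup>+x\<in>\<Omega>. ennreal ((f (x, r) - f (x, 0))\<^sup>2) \<partial>lborel)"

definition slice2 :: "'a::euclidean_space set \<Rightarrow> ('a \<times> real \<Rightarrow> real) \<Rightarrow> real \<Rightarrow> ennreal" where
  "slice2 \<Omega> f r = (\<integral>\<^sup>+x\<in>\<Omega>. ennreal (grad2 f (x, r)) \<partial>lborel)"

lemma nn_integral_translate:
  fixes f :: "'a::euclidean_space \<Rightarrow> ennreal"
  assumes [measurable]: "f \<in> borel_measurable borel"
  shows "(\<integral>\<^sup>+x. f (x + h) \<partial>lborel) = (\<integral>\<^sup>+x. f x \<partial>lborel)"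
proof -
  have "(\<integral>\<^sup>+x. f x \<partial>lborel) = (\<integral>\<^sup>+x. f x \<partial>distr lborel borel ((+) h))"
    by (simp add: lborel_distr_plus)
  also have "\<dots> = (\<integral>\<^sup>+x. f (h + x) \<partial>lborel)"
    by (rule nn_integral_distr) auto
  finally show ?thesis by (simp add: add.commute)
qed

lemma slice2_integral:
  assumes f: "C1 f" and [measurable]: "\<Omega> \<in> sets borel"
  shows "(\<integral>\<^sup>+r\<in>{0<..}. ennreal (r powr (1 - 2 * s)) * slice2 \<Omega> f r \<partial>lborel) = wenergy s \<Omega> f"
proof -
  have [measurable]: "grad2 f \<in> borel_measurable borel" using f by measurable
  have "(\<integral>\<^sup>+r\<in>{0<..}. ennreal (r powr (1 - 2 * s)) * slice2 \<Omega> f r \<partial>lborel) =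
    (\<integral>\<^sup>+r. (\<integral>\<^sup>+x. ennreal (r powr (1 - 2 * s)) * ennreal (grad2 f (x, r)) * indicator \<Omega> x * indicator {0<..} r \<partial>lborel) \<partial>lborel)"
    unfolding slice2_def by (simp add: nn_integral_cmult[symmetric] nn_integral_multc[symmetric] mult_ac)
  also have "\<dots> = (\<integral>\<^sup>+x. (\<integral>\<^sup>+r. ennreal (r powr (1 - 2 * s)) * ennreal (grad2 f (x, r)) * indicator \<Omega> x * indicator {0<..} r \<partial>lborel) \<partial>lborel)"
    by (rule lborel_pair.Fubini') measurable
  also have "\<dots> = wenergy s \<Omega> f"
    unfolding wenergy_def
    by (intro nn_integral_cong, subst nn_integral_multc[symmetric])
      (auto simp: ennreal_mult grad2_nonneg mult_ac intro!: nn_integral_cong)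
  finally show ?thesis .
qed

text \<open>Tonelli on the region 0 < y < r: the integral of \<open>r powr (- 1 - s)\<close> over r
  > y is \<open>y powr (- s) / s\<close>, which turns \<open>y powr (1 - s)\<close> into the weight
  of the energy. One factor 1 / s comes from the vertical bound, the other from this tail.\<close>

lemma hardy:
  assumes f: "C1 f" and [measurable]: "\<Omega> \<in> sets borel" and s: "0 < s"
  shows "(\<integral>\<^sup>+r\<in>{0<..}. ennreal (r powr (- 1 - 2 * s)) * incr2 \<Omega> f r \<partial>lborel) \<le> ennreal (1 / s\<^sup>2) * wenergy s \<Omega> f"
proof -
  have [measurable]: "grad2 f \<in> borel_measurable borel" "f \<in> borel_measurable borel" using f by measurable
  define k where "k = (\<lambda>x y. ennreal (y powr (1 - s) * grad2 f (x, y)) * indicator {0<..} y)"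
  have [measurable]: "(\<lambda>(x, y). k x y) \<in> borel_measurable (borel \<Otimes>\<^sub>M borel)" unfolding k_def by measurable
  have pt: "(\<integral>\<^sup>+r\<in>{0<..}. ennreal (r powr (- 1 - 2 * s)) * ennreal ((f (x, r) - f (x, 0))\<^sup>2) \<partial>lborel)
     \<le> ennreal (1 / s\<^sup>2) * (\<integral>\<^sup>+y\<in>{0<..}. ennreal (y powr (1 - 2 * s) * grad2 f (x, y)) \<partial>lborel)" for x
  proof -
    have "(\<integral>\<^sup>+r\<in>{0<..}. ennreal (r powr (- 1 - 2 * s)) * ennreal ((f (x, r) - f (x, 0))\<^sup>2) \<partial>lborel) \<le>
      (\<integral>\<^sup>+r. (\<integral>\<^sup>+y. ennreal (r powr (- 1 - s) / s) * k x y * indicator {y<..} r \<partial>lborel) \<partial>lborel)"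
    proof (intro nn_integral_mono)
      fix r :: real
      show "ennreal (r powr (- 1 - 2 * s)) * ennreal ((f (x, r) - f (x, 0))\<^sup>2) * indicator {0<..} r
        \<le> (\<integral>\<^sup>+y. ennreal (r powr (- 1 - s) / s) * k x y * indicator {y<..} r \<partial>lborel)"
      proof (cases "0 < r")
        case True
        have "ennreal (r powr (- 1 - 2 * s)) * ennreal ((f (x, r) - f (x, 0))\<^sup>2) \<le>
          ennreal (r powr (- 1 - 2 * s)) * (ennreal (r powr s / s) *
           (\<integral>\<^sup>+y\<in>{0<..<r}. ennreal (y powr (1 - s) * grad2 f (x, y)) \<partial>lborel))"
          by (intro mult_left_mono C1_vertical_bound f s True) simp
        also have "\<dots> = ennreal (r powr (- 1 - s) / s) * (\<integral>\<^sup>+y\<in>{0<..<r}. ennreal (y powr (1 - s) * grad2 f (x, y)) \<partial>lborel)"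
        proof -
          have "r powr (- 1 - 2 * s) * (r powr s / s) = r powr (- 1 - 2 * s + s) / s"
            by (simp only: powr_add) simp
          also have "- 1 - 2 * s + s = - 1 - s" by simp
          finally show ?thesis using s by (simp add: mult.assoc[symmetric] ennreal_mult[symmetric])
        qed
        also have "\<dots> = (\<integral>\<^sup>+y. ennreal (r powr (- 1 - s) / s) * k x y * indicator {y<..} r \<partial>lborel)"
          unfolding k_def
          by (subst nn_integral_cmult[symmetric]) (auto intro!: nn_integral_cong split: split_indicator)
        finally show ?thesis using True by simp
      qed simp
    qed
    \<comment> \<open>The set {y<..} varies with y; written as the comparison of the two
      coordinates, its indicator is visibly jointly measurable.\<close>
    also have "\<dots> = (\<integral>\<^sup>+y. (\<integral>\<^sup>+r. ennreal (r powr (- 1 - s) / s) * k x y * indicator {y<..} r \<partial>lborel) \<partial>lborel)"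
    proof (rule lborel_pair.Fubini')
      have "(\<lambda>p. ennreal (snd p powr (- 1 - s) / s) * k x (fst p) * (if fst p < snd p then 1 else 0)) \<in> borel_measurable (lborel \<Otimes>\<^sub>M lborel)"
        by measurable
      also have "(\<lambda>p. ennreal (snd p powr (- 1 - s) / s) * k x (fst p) * (if fst p < snd p then 1 else 0)) =
        (\<lambda>(y, r). ennreal (r powr (- 1 - s) / s) * k x y * indicator {y<..} r)"
        by (auto simp: fun_eq_iff)
      finally show "(\<lambda>(y, r). ennreal (r powr (- 1 - s) / s) * k x y * indicator {y<..} r) \<in> borel_measurable (lborel \<Otimes>\<^sub>M lborel)" .
    qed
    also have "\<dots> = (\<integral>\<^sup>+y. ennreal (1 / s\<^sup>2) * (ennreal (y powr (1 - 2 * s) * grad2 f (x, y)) * indicator {0<..} y) \<partial>lborel)"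
    proof (intro nn_integral_cong)
      fix y :: real
      show "(\<integral>\<^sup>+r. ennreal (r powr (- 1 - s) / s) * k x y * indicator {y<..} r \<partial>lborel) =
        ennreal (1 / s\<^sup>2) * (ennreal (y powr (1 - 2 * s) * grad2 f (x, y)) * indicator {0<..} y)"
      proof (cases "0 < y")
        case True
        have "(\<integral>\<^sup>+r. ennreal (r powr (- 1 - s) / s) * k x y * indicator {y<..} r \<partial>lborel) =
           (\<integral>\<^sup>+r. (ennreal (1 / s) * k x y) * (ennreal (r powr (- 1 - s)) * indicator {y<..} r) \<partial>lborel)"
          using s by (intro nn_integral_cong) (auto simp: mult_ac ennreal_mult'[symmetric] split: split_indicator)
        also have "\<dots> = (ennreal (1 / s) * k x y) * (\<integral>\<^sup>+r\<in>{y<..}. ennreal (r powr (- 1 - s)) \<partial>lborel)"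
          by (rule nn_integral_cmult) measurable
        also have "(\<integral>\<^sup>+r\<in>{y<..}. ennreal (r powr (- 1 - s)) \<partial>lborel) = ennreal (y powr (- s) / s)"
          using nn_integral_powr_at_top[of "- 1 - s" y] s True by simp
        also have "(ennreal (1 / s) * k x y) * ennreal (y powr (- s) / s) = ennreal (1 / s * (y powr (1 - s) * grad2 f (x, y)) * (y powr (- s) / s))"
          using True s by (simp add: k_def ennreal_mult[symmetric] grad2_nonneg)
        also have "1 / s * (y powr (1 - s) * grad2 f (x, y)) * (y powr (- s) / s) = 1 / s\<^sup>2 * ((y powr (1 - s) * y powr (- s)) * grad2 f (x, y))"
          by (simp add: power2_eq_square)
        also have "y powr (1 - s) * y powr (- s) = y powr (1 - 2 * s)"
          by (simp add: powr_add[symmetric])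
        finally show ?thesis using True by (simp add: ennreal_mult[symmetric] grad2_nonneg)
      qed (simp add: k_def)
    qed
    also have "\<dots> = ennreal (1 / s\<^sup>2) * (\<integral>\<^sup>+y\<in>{0<..}. ennreal (y powr (1 - 2 * s) * grad2 f (x, y)) \<partial>lborel)"
      by (rule nn_integral_cmult) measurable
    finally show ?thesis .
  qed
  have "(\<integral>\<^sup>+r\<in>{0<..}. ennreal (r powr (- 1 - 2 * s)) * incr2 \<Omega> f r \<partial>lborel) =
    (\<integral>\<^sup>+r. (\<integral>\<^sup>+x. ennreal (r powr (- 1 - 2 * s)) * ennreal ((f (x, r) - f (x, 0))\<^sup>2) * indicator {0<..} r * indicator \<Omega> x \<partial>lborel) \<partial>lborel)"
    unfolding incr2_def by (simp add: nn_integral_cmult[symmetric] nn_integral_multc[symmetric] mult_ac)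
  also have "\<dots> = (\<integral>\<^sup>+x. (\<integral>\<^sup>+r. ennreal (r powr (- 1 - 2 * s)) * ennreal ((f (x, r) - f (x, 0))\<^sup>2) * indicator {0<..} r * indicator \<Omega> x \<partial>lborel) \<partial>lborel)"
    by (rule lborel_pair.Fubini') measurable
  also have "\<dots> = (\<integral>\<^sup>+x. (\<integral>\<^sup>+r\<in>{0<..}. ennreal (r powr (- 1 - 2 * s)) * ennreal ((f (x, r) - f (x, 0))\<^sup>2) \<partial>lborel) * indicator \<Omega> x \<partial>lborel)"
    by (simp add: nn_integral_multc[symmetric])
  also have "\<dots> \<le> (\<integral>\<^sup>+x. ennreal (1 / s\<^sup>2) * ((\<integral>\<^sup>+y\<in>{0<..}. ennreal (y powr (1 - 2 * s) * grad2 f (x, y)) \<partial>lborel) * indicator \<Omega> x) \<partial>lborel)"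
    using pt by (intro nn_integral_mono) (auto split: split_indicator)
  also have "\<dots> = ennreal (1 / s\<^sup>2) * wenergy s \<Omega> f"
    unfolding wenergy_def by (rule nn_integral_cmult) measurable
  finally show ?thesis .
qed

text \<open>For fixed t the integrand is a translate of the slice integrand, so translation
  invariance removes h altogether.\<close>

lemma segment_integral_le_slice2:
  assumes f: "C1 f" and [measurable]: "\<Omega> \<in> sets borel"
  shows "(\<integral>\<^sup>+x. (\<integral>\<^sup>+t\<in>{0<..<1}. ennreal (grad2 f (x + t *\<^sub>R h, r)) * indicator \<Omega> (x + t *\<^sub>R h) \<partial>lborel) \<partial>lborel) = slice2 \<Omega> f r"
proof -
  have [measurable]: "grad2 f \<in> borel_measurable borel" using f by measurable
  have "(\<integral>\<^sup>+x. (\<integral>\<^sup>+t\<in>{0<..<1}. ennreal (grad2 f (x + t *\<^sub>R h, r)) * indicator \<Omega> (x + t *\<^sub>R h) \<partial>lborel) \<partial>lborel) =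
    (\<integral>\<^sup>+t. (\<integral>\<^sup>+x. ennreal (grad2 f (x + t *\<^sub>R h, r)) * indicator \<Omega> (x + t *\<^sub>R h) * indicator {0<..<1::real} t \<partial>lborel) \<partial>lborel)"
    by (rule lborel_pair.Fubini'[symmetric]) measurable
  also have "\<dots> = (\<integral>\<^sup>+t. slice2 \<Omega> f r * indicator {0<..<1::real} t \<partial>lborel)"
  proof (intro nn_integral_cong)
    fix t :: real
    have "(\<integral>\<^sup>+x. ennreal (grad2 f (x + t *\<^sub>R h, r)) * indicator \<Omega> (x + t *\<^sub>R h) \<partial>lborel) = slice2 \<Omega> f r"
      unfolding slice2_def
      using nn_integral_translate[of "\<lambda>x. ennreal (grad2 f (x, r)) * indicator \<Omega> x" "t *\<^sub>R h"] by simp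
    then show "(\<integral>\<^sup>+x. ennreal (grad2 f (x + t *\<^sub>R h, r)) * indicator \<Omega> (x + t *\<^sub>R h) * indicator {0<..<1::real} t \<partial>lborel) = slice2 \<Omega> f r * indicator {0<..<1::real} t"
      by (subst nn_integral_multc) auto
  qed
  also have "\<dots> = slice2 \<Omega> f r" by (simp add: nn_integral_cmult)
  finally show ?thesis .
qed

text \<open>The right-hand side runs over all t in (0, 1) and keeps only the points inside \<Omega>.
  It therefore does not depend on \<tau>, which may be an exit time varying with x.\<close>

lemma segment_bound:
  assumes f: "C1 f" and \<tau>: "0 \<le> \<tau>" "\<tau> \<le> 1" and seg: "\<And>t. 0 < t \<Longrightarrow> t < \<tau> \<Longrightarrow> x + t *\<^sub>R h \<in> \<Omega>"
    and [measurable]: "\<Omega> \<in> sets borel"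
  shows "ennreal ((f (x + \<tau> *\<^sub>R h, r) - f (x, r))\<^sup>2) \<le> ennreal ((norm h)\<^sup>2) *
     (\<integral>\<^sup>+t\<in>{0<..<1}. ennreal (grad2 f (x + t *\<^sub>R h, r)) * indicator \<Omega> (x + t *\<^sub>R h) \<partial>lborel)"
proof (cases "\<tau> = 0")
  case False
  have "ennreal ((f (x + \<tau> *\<^sub>R h, r) - f (x, r))\<^sup>2) \<le> ennreal ((norm h)\<^sup>2 * \<tau>) *
     (\<integral>\<^sup>+t\<in>{0<..<\<tau>}. ennreal (grad2 f (x + t *\<^sub>R h, r)) \<partial>lborel)"
    using False \<tau> by (intro C1_horizontal_bound f) auto
  also have "\<dots> \<le> ennreal ((norm h)\<^sup>2) *
     (\<integral>\<^sup>+t\<in>{0<..<1}. ennreal (grad2 f (x + t *\<^sub>R h, r)) * indicator \<Omega> (x + t *\<^sub>R h) \<partial>lborel)"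
  proof (rule mult_mono, goal_cases)
    case 2 show ?case
    proof (rule nn_integral_mono)
    fix t
    show "ennreal (grad2 f (x + t *\<^sub>R h, r)) * indicator {0<..<\<tau>} t \<le>
        ennreal (grad2 f (x + t *\<^sub>R h, r)) * indicator \<Omega> (x + t *\<^sub>R h) * indicator {0<..<1} t"
      using seg[of t] \<tau> by (cases "0 < t \<and> t < \<tau>") auto
    qed
  qed (use \<tau> in \<open>auto simp: mult_left_le intro!: ennreal_leI\<close>)
  finally show ?thesis .
qed simp

lemma translation_slice_bound:
  assumes f: "C1 f" and [measurable]: "\<Omega> \<in> sets borel" "V \<in> sets borel" and V: "V \<subseteq> \<Omega>"
    and seg: "\<And>x t. x \<in> V \<Longrightarrow> 0 \<le> t \<Longrightarrow> t \<le> 1 \<Longrightarrow> x + t *\<^sub>R h \<in> \<Omega>"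
  shows "(\<integral>\<^sup>+x\<in>V. ennreal ((f (x + h, 0) - f (x, 0))\<^sup>2) \<partial>lborel) \<le>
     6 * incr2 \<Omega> f r + ennreal (3 * (norm h)\<^sup>2) * slice2 \<Omega> f r"
proof -
  have [measurable]: "grad2 f \<in> borel_measurable borel" "f \<in> borel_measurable borel" using f by measurable
  let ?a = "\<lambda>x. ennreal ((f (x, r) - f (x, 0))\<^sup>2) * indicator \<Omega> x"
  let ?S = "\<lambda>x. (\<integral>\<^sup>+t\<in>{0<..<1}. ennreal (grad2 f (x + t *\<^sub>R h, r)) * indicator \<Omega> (x + t *\<^sub>R h) \<partial>lborel)"
  have "(\<integral>\<^sup>+x\<in>V. ennreal ((f (x + h, 0) - f (x, 0))\<^sup>2) \<partial>lborel) \<le>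
    (\<integral>\<^sup>+x. 3 * ?a x + 3 * ?a (x + h) + ennreal (3 * (norm h)\<^sup>2) * ?S x \<partial>lborel)"
  proof (intro nn_integral_mono)
    fix x
    show "ennreal ((f (x + h, 0) - f (x, 0))\<^sup>2) * indicator V x \<le>
       3 * ?a x + 3 * ?a (x + h) + ennreal (3 * (norm h)\<^sup>2) * ?S x"
    proof (cases "x \<in> V")
      case True
      have in1: "x \<in> \<Omega>" "x + h \<in> \<Omega>" using V True seg[OF True, of 1] by auto
      define A B C where "A = f (x, r) - f (x, 0)" and "B = f (x + h, r) - f (x + h, 0)" and "C = f (x + h, r) - f (x, r)"
      have "(f (x + h, 0) - f (x, 0))\<^sup>2 = (A - B + C)\<^sup>2" unfolding A_def B_def C_def by simp
      \<comment> \<open>The difference of the two sides is the sum of the squares of A + B, A - C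
        and B + C.\<close>
      also have "\<dots> \<le> 3 * A\<^sup>2 + 3 * B\<^sup>2 + 3 * C\<^sup>2"
        using zero_le_power2[of "A + B"] zero_le_power2[of "A - C"] zero_le_power2[of "B + C"]
        by (simp add: power2_eq_square algebra_simps)
      finally have "ennreal ((f (x + h, 0) - f (x, 0))\<^sup>2) \<le> ennreal (3 * A\<^sup>2 + 3 * B\<^sup>2 + 3 * C\<^sup>2)"
        by (rule ennreal_leI)
      also have "\<dots> = 3 * ennreal (A\<^sup>2) + 3 * ennreal (B\<^sup>2) + 3 * ennreal (C\<^sup>2)"
        by (simp add: ennreal_plus ennreal_mult)
      also have "\<dots> \<le> 3 * ennreal (A\<^sup>2) + 3 * ennreal (B\<^sup>2) + 3 * (ennreal ((norm h)\<^sup>2) * ?S x)"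
        unfolding C_def using segment_bound[OF f, of 1 x h \<Omega> r] seg[OF True]
        by (intro add_left_mono mult_left_mono) auto
      finally show ?thesis using True in1
        by (simp add: A_def B_def ennreal_mult mult_ac)
    qed simp
  qed
  also have "\<dots> = 3 * (\<integral>\<^sup>+x. ?a x \<partial>lborel) + 3 * (\<integral>\<^sup>+x. ?a (x + h) \<partial>lborel) + ennreal (3 * (norm h)\<^sup>2) * (\<integral>\<^sup>+x. ?S x \<partial>lborel)"
    by (subst nn_integral_add; (measurable)?)+ (simp add: nn_integral_cmult)
  also have "(\<integral>\<^sup>+x. ?a (x + h) \<partial>lborel) = (\<integral>\<^sup>+x. ?a x \<partial>lborel)"
    by (rule nn_integral_translate) measurable
  also have "(\<integral>\<^sup>+x. ?S x \<partial>lborel) = slice2 \<Omega> f r"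
    by (rule segment_integral_le_slice2[OF f]) measurable
  finally show ?thesis
    unfolding incr2_def by (simp add: distrib_right[symmetric] mult.assoc[symmetric])
qed

text \<open>Used with translations that leave \<open>\<Omega>\<close> through the Dirichlet part, where \<open>f\<close> vanishes at
  every height.\<close>
lemma exit_slice_bound:
  assumes f: "C1 f" and [measurable]: "\<Omega> \<in> sets borel" "V \<in> sets borel" and V: "V \<subseteq> \<Omega>"
    and seg: "\<And>x. x \<in> V \<Longrightarrow> \<exists>\<tau>. 0 \<le> \<tau> \<and> \<tau> \<le> 1 \<and> f (x + \<tau> *\<^sub>R h, r) = 0 \<and>
        (\<forall>t. 0 < t \<and> t < \<tau> \<longrightarrow> x + t *\<^sub>R h \<in> \<Omega>)"
  shows "trace_sq V f \<le>
     6 * incr2 \<Omega> f r + ennreal (3 * (norm h)\<^sup>2) * slice2 \<Omega> f r"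
proof -
  have [measurable]: "grad2 f \<in> borel_measurable borel" "f \<in> borel_measurable borel" using f by measurable
  let ?a = "\<lambda>x. ennreal ((f (x, r) - f (x, 0))\<^sup>2) * indicator \<Omega> x"
  let ?S = "\<lambda>x. (\<integral>\<^sup>+t\<in>{0<..<1}. ennreal (grad2 f (x + t *\<^sub>R h, r)) * indicator \<Omega> (x + t *\<^sub>R h) \<partial>lborel)"
  have "trace_sq V f \<le>
    (\<integral>\<^sup>+x. 6 * ?a x + ennreal (3 * (norm h)\<^sup>2) * ?S x \<partial>lborel)"
  proof (intro nn_integral_mono)
    fix x
    show "ennreal ((f (x, 0))\<^sup>2) * indicator V x \<le> 6 * ?a x + ennreal (3 * (norm h)\<^sup>2) * ?S x"
    proof (cases "x \<in> V")
      case True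
      then obtain \<tau> where \<tau>: "0 \<le> \<tau>" "\<tau> \<le> 1" "f (x + \<tau> *\<^sub>R h, r) = 0"
        "\<And>t. 0 < t \<Longrightarrow> t < \<tau> \<Longrightarrow> x + t *\<^sub>R h \<in> \<Omega>" using seg by blast
      define A C where "A = f (x, r) - f (x, 0)" and "C = f (x + \<tau> *\<^sub>R h, r) - f (x, r)"
      have "(f (x, 0))\<^sup>2 = (A + C)\<^sup>2" unfolding A_def C_def using \<tau> by simp
      also have "\<dots> \<le> 6 * A\<^sup>2 + 3 * C\<^sup>2"
        using zero_le_power2[of "A - C"] zero_le_power2[of A] zero_le_power2[of C]
        unfolding power2_eq_square by (simp only: algebra_simps)
      finally have "ennreal ((f (x, 0))\<^sup>2) \<le> ennreal (6 * A\<^sup>2 + 3 * C\<^sup>2)"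
        by (rule ennreal_leI)
      also have "\<dots> = 6 * ennreal (A\<^sup>2) + 3 * ennreal (C\<^sup>2)"
        by (simp add: ennreal_plus ennreal_mult)
      also have "\<dots> \<le> 6 * ennreal (A\<^sup>2) + 3 * (ennreal ((norm h)\<^sup>2) * ?S x)"
        unfolding C_def by (intro add_left_mono mult_left_mono segment_bound[OF f \<tau>(1,2,4)]) auto
      finally show ?thesis using True V
        by (auto simp: A_def ennreal_mult mult_ac)
    qed simp
  qed
  also have "\<dots> = 6 * (\<integral>\<^sup>+x. ?a x \<partial>lborel) + ennreal (3 * (norm h)\<^sup>2) * (\<integral>\<^sup>+x. ?S x \<partial>lborel)"
    by (simp add: nn_integral_add nn_integral_cmult)
  also have "(\<integral>\<^sup>+x. ?S x \<partial>lborel) = slice2 \<Omega> f r"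
    by (rule segment_integral_le_slice2[OF f]) measurable
  finally show ?thesis unfolding incr2_def .
qed

lemma measurable_incr2[measurable]:
  assumes f: "C1 f" and [measurable]: "\<Omega> \<in> sets borel"
  shows "incr2 \<Omega> f \<in> borel_measurable borel"
proof -
  have [measurable]: "f \<in> borel_measurable borel" using f by measurable
  show ?thesis unfolding incr2_def[abs_def] by measurable
qed

lemma measurable_slice2[measurable]:
  assumes f: "C1 f" and [measurable]: "\<Omega> \<in> sets borel"
  shows "slice2 \<Omega> f \<in> borel_measurable borel"
proof -
  have [measurable]: "grad2 f \<in> borel_measurable borel" using f by measurable
  show ?thesis unfolding slice2_def[abs_def] by measurable
qed

text \<open>The height \<open>r\<close> is free in the slice bounds. Integrating over \<open>r > \<rho>\<close> against
  \<open>r powr (- 1 - 2 * s)\<close> turns the two terms into Hardy's inequality and the energy.\<close>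
lemma average_slice_bound:
  assumes f: "C1 f" and [measurable]: "\<Omega> \<in> sets borel" and s: "0 < s" and \<rho>: "0 < \<rho>" and h: "norm h \<le> \<rho>"
    and T: "\<And>r. 0 < r \<Longrightarrow> T \<le> 6 * incr2 \<Omega> f r + ennreal (3 * (norm h)\<^sup>2) * slice2 \<Omega> f r"
  shows "T \<le> ennreal ((12 / s + 6 * s) * \<rho> powr (2 * s)) * wenergy s \<Omega> f"
proof -
  have [measurable]: "incr2 \<Omega> f \<in> borel_measurable borel" "slice2 \<Omega> f \<in> borel_measurable borel" using f by measurable
  have "T * ennreal (\<rho> powr (- 2 * s) / (2 * s)) = T * (\<integral>\<^sup>+r\<in>{\<rho><..}. ennreal (r powr (- 1 - 2 * s)) \<partial>lborel)"
    using nn_integral_powr_at_top[of "- 1 - 2 * s" \<rho>] s \<rho> by simp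
  also have "\<dots> = (\<integral>\<^sup>+r. T * (ennreal (r powr (- 1 - 2 * s)) * indicator {\<rho><..} r) \<partial>lborel)"
    by (rule nn_integral_cmult[symmetric]) measurable
  also have "\<dots> \<le> (\<integral>\<^sup>+r. 6 * (ennreal (r powr (- 1 - 2 * s)) * incr2 \<Omega> f r * indicator {0<..} r) +
      3 * (ennreal (r powr (1 - 2 * s)) * slice2 \<Omega> f r * indicator {0<..} r) \<partial>lborel)"
  proof (intro nn_integral_mono)
    fix r
    show "T * (ennreal (r powr (- 1 - 2 * s)) * indicator {\<rho><..} r) \<le>
        6 * (ennreal (r powr (- 1 - 2 * s)) * incr2 \<Omega> f r * indicator {0<..} r) +
      3 * (ennreal (r powr (1 - 2 * s)) * slice2 \<Omega> f r * indicator {0<..} r)"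
    proof (cases "\<rho> < r")
      case True
      then have r: "0 < r" using \<rho> by simp
      \<comment> \<open>Above the height \<rho> the length of h is at most r; trading
        \<open>(norm h)\<^sup>2\<close> for \<open>r\<^sup>2\<close> turns the weight into that of
        the energy.\<close>
      have "(norm h)\<^sup>2 \<le> r\<^sup>2" using True h by (intro power_mono) auto
      then have "r powr (- 1 - 2 * s) * (3 * (norm h)\<^sup>2) \<le> r powr (- 1 - 2 * s) * (3 * r\<^sup>2)"
        by (intro mult_left_mono) auto
      also have "\<dots> = 3 * r powr (1 - 2 * s)"
        using r powr_add[of r "- 1 - 2 * s" 2] by (simp add: powr_numeral)
      finally have le: "ennreal (r powr (- 1 - 2 * s)) * ennreal (3 * (norm h)\<^sup>2) \<le> 3 * ennreal (r powr (1 - 2 * s))"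
        by (simp add: ennreal_mult'[symmetric] ennreal_mult''[symmetric] flip: ennreal_numeral)
      have "T * ennreal (r powr (- 1 - 2 * s)) \<le> (6 * incr2 \<Omega> f r + ennreal (3 * (norm h)\<^sup>2) * slice2 \<Omega> f r) * ennreal (r powr (- 1 - 2 * s))"
        by (intro mult_right_mono T r) simp
      also have "\<dots> = 6 * (ennreal (r powr (- 1 - 2 * s)) * incr2 \<Omega> f r) + (ennreal (r powr (- 1 - 2 * s)) * ennreal (3 * (norm h)\<^sup>2)) * slice2 \<Omega> f r"
        by (simp add: distrib_left mult_ac)
      also have "\<dots> \<le> 6 * (ennreal (r powr (- 1 - 2 * s)) * incr2 \<Omega> f r) + (3 * ennreal (r powr (1 - 2 * s))) * slice2 \<Omega> f r"
        by (intro add_left_mono mult_right_mono le) simp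
      finally show ?thesis using True r by (simp add: mult_ac)
    qed simp
  qed
  also have "\<dots> = 6 * (\<integral>\<^sup>+r\<in>{0<..}. ennreal (r powr (- 1 - 2 * s)) * incr2 \<Omega> f r \<partial>lborel) +
      3 * (\<integral>\<^sup>+r\<in>{0<..}. ennreal (r powr (1 - 2 * s)) * slice2 \<Omega> f r \<partial>lborel)"
    by (subst nn_integral_add; (measurable)?)+ (simp add: nn_integral_cmult)
  also have "\<dots> \<le> 6 * (ennreal (1 / s\<^sup>2) * wenergy s \<Omega> f) + 3 * wenergy s \<Omega> f"
    by (subst slice2_integral[OF f]) (auto intro!: add_right_mono mult_left_mono hardy f s)
  also have "\<dots> = ennreal (6 / s\<^sup>2 + 3) * wenergy s \<Omega> f"
  proof -
    have "(6::ennreal) * ennreal (1 / s\<^sup>2) = ennreal (6 / s\<^sup>2)"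
      using ennreal_mult'[of 6 "1 / s\<^sup>2"] by simp
    then show ?thesis by (simp add: distrib_right ennreal_plus mult.assoc[symmetric])
  qed
  \<comment> \<open>Multiplication by the reciprocal mass of the weight on r > \<rho> isolates T;
    the constant \<open>12 / s + 6 * s\<close> is
    \<open>(6 / s\<^sup>2 + 3) * (2 * s)\<close>.\<close>
  finally have "T * ennreal (\<rho> powr (- 2 * s) / (2 * s)) * ennreal (2 * s * \<rho> powr (2 * s)) \<le>
      ennreal (6 / s\<^sup>2 + 3) * wenergy s \<Omega> f * ennreal (2 * s * \<rho> powr (2 * s))"
    by (rule mult_right_mono) simp
  moreover have "T * ennreal (\<rho> powr (- 2 * s) / (2 * s)) * ennreal (2 * s * \<rho> powr (2 * s)) = T"
    using s \<rho> by (simp add: mult.assoc ennreal_mult'[symmetric] powr_add[symmetric])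
  moreover have "ennreal (6 / s\<^sup>2 + 3) * wenergy s \<Omega> f * ennreal (2 * s * \<rho> powr (2 * s)) =
     ennreal ((6 / s\<^sup>2 + 3) * (2 * s * \<rho> powr (2 * s))) * wenergy s \<Omega> f"
    using s by (simp add: ennreal_mult'' mult_ac)
  moreover have "(6 / s\<^sup>2 + 3) * (2 * s * \<rho> powr (2 * s)) = (12 / s + 6 * s) * \<rho> powr (2 * s)"
    using s by (simp add: field_simps power2_eq_square)
  ultimately show ?thesis by simp
qed

section \<open>A Poincare inequality\<close>

text \<open>Regularity of order s of the trace: squared L^2 increments decay like the displacement
  to the power 2s. The radius \<rho> only bounds the length of h, so h = 0 is allowed.\<close>

lemma translation_bound:
  assumes f: "C1 f" and [measurable]: "\<Omega> \<in> sets borel" "V \<in> sets borel" and V: "V \<subseteq> \<Omega>"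
    and seg: "\<And>x t. x \<in> V \<Longrightarrow> 0 \<le> t \<Longrightarrow> t \<le> 1 \<Longrightarrow> x + t *\<^sub>R h \<in> \<Omega>"
    and s: "0 < s" and \<rho>: "0 < \<rho>" "norm h \<le> \<rho>"
  shows "(\<integral>\<^sup>+x\<in>V. ennreal ((f (x + h, 0) - f (x, 0))\<^sup>2) \<partial>lborel) \<le>
     ennreal ((12 / s + 6 * s) * \<rho> powr (2 * s)) * wenergy s \<Omega> f"
  by (rule average_slice_bound[OF f _ s \<rho>]) (auto intro!: translation_slice_bound f V seg)

text \<open>The constant is uniform over the class T but may depend on V. As a property of sets it
  passes to subsets, to finite unions and along translations inside \<Omega>, so a bound on one
  small ball can spread.\<close>

definition energy_controlled :: "real \<Rightarrow> 'a::euclidean_space set \<Rightarrow> ('a \<times> real \<Rightarrow> real) set \<Rightarrow> 'a set \<Rightarrow> bool" where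
  "energy_controlled s \<Omega> T V \<longleftrightarrow>
     (\<exists>C\<ge>0. \<forall>f\<in>T. trace_sq V f \<le> ennreal C * wenergy s \<Omega> f)"

lemma energy_controlled_mono:
  assumes "energy_controlled s \<Omega> T V" "U \<subseteq> V"
  shows "energy_controlled s \<Omega> T U"
proof -
  have "trace_sq U f \<le> trace_sq V f" for f
    using assms(2) by (intro nn_integral_mono) (auto split: split_indicator)
  moreover obtain C where "C \<ge> 0" "\<And>f. f \<in> T \<Longrightarrow> trace_sq V f \<le> ennreal C * wenergy s \<Omega> f"
    using assms(1) unfolding energy_controlled_def by blast
  ultimately show ?thesis unfolding energy_controlled_def
    by (intro exI[of _ C] conjI ballI) (assumption, blast intro: order_trans)
qed

lemma energy_controlled_Un:
  assumes T: "\<And>f. f \<in> T \<Longrightarrow> C1 f" and [measurable]: "U \<in> sets borel" "V \<in> sets borel"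
    and "energy_controlled s \<Omega> T U" "energy_controlled s \<Omega> T V"
  shows "energy_controlled s \<Omega> T (U \<union> V)"
proof -
  obtain C where C: "C \<ge> 0" "\<And>f. f \<in> T \<Longrightarrow> trace_sq U f \<le> ennreal C * wenergy s \<Omega> f"
    using assms(4) unfolding energy_controlled_def by blast
  obtain D where D: "D \<ge> 0" "\<And>f. f \<in> T \<Longrightarrow> trace_sq V f \<le> ennreal D * wenergy s \<Omega> f"
    using assms(5) unfolding energy_controlled_def by blast
  show ?thesis unfolding energy_controlled_def
  proof (intro exI[of _ "C + D"] conjI ballI)
    fix f assume f: "f \<in> T"
    then have [measurable]: "f \<in> borel_measurable borel" using T by measurable
    have "trace_sq (U\<union>V) f \<le>
       (\<integral>\<^sup>+x. ennreal ((f (x, 0))\<^sup>2) * indicator U x + ennreal ((f (x, 0))\<^sup>2) * indicator V x \<partial>lborel)"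
      by (intro nn_integral_mono) (auto split: split_indicator)
    also have "\<dots> = trace_sq U f + trace_sq V f"
      by (rule nn_integral_add) measurable
    also have "\<dots> \<le> ennreal C * wenergy s \<Omega> f + ennreal D * wenergy s \<Omega> f"
      by (intro add_mono C D f)
    finally show "trace_sq (U\<union>V) f \<le> ennreal (C + D) * wenergy s \<Omega> f"
      using C D by (simp add: ennreal_plus distrib_right)
  qed (use C D in auto)
qed

lemma energy_controlled_UN:
  assumes T: "\<And>f. f \<in> T \<Longrightarrow> C1 f" and "finite I"
    and "\<And>i. i \<in> I \<Longrightarrow> V i \<in> sets borel" "\<And>i. i \<in> I \<Longrightarrow> energy_controlled s \<Omega> T (V i)"
  shows "energy_controlled s \<Omega> T (\<Union>i\<in>I. V i)"
  using assms(2-4)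
proof (induction I rule: finite_induct)
  case empty
  then show ?case unfolding energy_controlled_def by (auto intro!: exI[of _ 0])
next
  case (insert i I)
  have "energy_controlled s \<Omega> T (V i \<union> (\<Union>i\<in>I. V i))"
    using insert by (intro energy_controlled_Un T sets.finite_UN) simp_all
  then show ?case by simp
qed

lemma energy_controlled_translate:
  assumes T: "\<And>f. f \<in> T \<Longrightarrow> C1 f"
    and [measurable]: "\<Omega> \<in> sets borel" "V \<in> sets borel" "U \<in> sets borel" and V: "V \<subseteq> \<Omega>"
    and seg: "\<And>x t. x \<in> V \<Longrightarrow> 0 \<le> t \<Longrightarrow> t \<le> 1 \<Longrightarrow> x + t *\<^sub>R h \<in> \<Omega>"
    and U: "\<And>x. x \<in> V \<Longrightarrow> x + h \<in> U" "energy_controlled s \<Omega> T U"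
    and s: "0 < s"
  shows "energy_controlled s \<Omega> T V"
proof -
  obtain C where C: "C \<ge> 0" "\<And>f. f \<in> T \<Longrightarrow> trace_sq U f \<le> ennreal C * wenergy s \<Omega> f"
    using U(2) unfolding energy_controlled_def by blast
  \<comment> \<open>\<open>norm h + 1\<close> instead of \<open>norm h\<close>, because the radius
    in \<open>translation_bound\<close> has to be positive.\<close>
  define K where "K = (12 / s + 6 * s) * (norm h + 1) powr (2 * s)"
  have K: "K \<ge> 0" using s by (simp add: K_def)
  show ?thesis unfolding energy_controlled_def
  proof (intro exI[of _ "2 * K + 2 * C"] conjI ballI)
    fix f assume f: "f \<in> T"
    then have [measurable]: "f \<in> borel_measurable borel" using T by measurable
    let ?u = "\<lambda>x. ennreal ((f (x, 0))\<^sup>2) * indicator U x"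
    have "trace_sq V f \<le>
       (\<integral>\<^sup>+x. 2 * (ennreal ((f (x + h, 0) - f (x, 0))\<^sup>2) * indicator V x) + 2 * ?u (x + h) \<partial>lborel)"
    proof (intro nn_integral_mono)
      fix x
      show "ennreal ((f (x, 0))\<^sup>2) * indicator V x \<le> 2 * (ennreal ((f (x + h, 0) - f (x, 0))\<^sup>2) * indicator V x) + 2 * ?u (x + h)"
      proof (cases "x \<in> V")
        case True
        define a b where "a = f (x, 0)" and "b = f (x + h, 0)"
        have "a\<^sup>2 \<le> 2 * (b - a)\<^sup>2 + 2 * b\<^sup>2"
          using zero_le_power2[of "2 * b - a"] by (simp add: power2_eq_square algebra_simps)
        then have "ennreal (a\<^sup>2) \<le> ennreal (2 * (b - a)\<^sup>2 + 2 * b\<^sup>2)" by (rule ennreal_leI)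
        also have "\<dots> = 2 * ennreal ((b - a)\<^sup>2) + 2 * ennreal (b\<^sup>2)" by (simp add: ennreal_plus ennreal_mult)
        finally show ?thesis using True U(1)[OF True] by (simp add: a_def b_def)
      qed simp
    qed
    also have "\<dots> = 2 * (\<integral>\<^sup>+x\<in>V. ennreal ((f (x + h, 0) - f (x, 0))\<^sup>2) \<partial>lborel) + 2 * (\<integral>\<^sup>+x. ?u (x + h) \<partial>lborel)"
      by (simp add: nn_integral_add nn_integral_cmult)
    also have "(\<integral>\<^sup>+x. ?u (x + h) \<partial>lborel) = (\<integral>\<^sup>+x. ?u x \<partial>lborel)"
      by (rule nn_integral_translate) measurable
    also have "2 * (\<integral>\<^sup>+x\<in>V. ennreal ((f (x + h, 0) - f (x, 0))\<^sup>2) \<partial>lborel) + 2 * (\<integral>\<^sup>+x. ?u x \<partial>lborel) \<le>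
       2 * (ennreal K * wenergy s \<Omega> f) + 2 * (ennreal C * wenergy s \<Omega> f)"
      unfolding K_def using T f V seg s
      by (intro add_mono mult_left_mono translation_bound C) (auto intro: add_nonneg_pos)
    also have "\<dots> = ennreal (2 * K + 2 * C) * wenergy s \<Omega> f"
      using K C(1) by (simp add: ennreal_plus ennreal_mult distrib_right distrib_left mult_ac)
    finally show "trace_sq V f \<le> ennreal (2 * K + 2 * C) * wenergy s \<Omega> f" .
  qed (use K C in auto)
qed

section \<open>Spreading the Poincare inequality from one ball to the whole domain\<close>

lemma first_exit:
  fixes x h :: "'a::euclidean_space"
  assumes "open \<Omega>" "x \<in> \<Omega>" "x + h \<notin> \<Omega>"
  obtains \<tau> where "0 \<le> \<tau>" "\<tau> \<le> 1" "x + \<tau> *\<^sub>R h \<in> frontier \<Omega>" "\<And>t. 0 \<le> t \<Longrightarrow> t < \<tau> \<Longrightarrow> x + t *\<^sub>R h \<in> \<Omega>"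
proof -
  let ?K = "{0..1} \<inter> (\<lambda>t. x + t *\<^sub>R h) -` (- \<Omega>)"
  have "closed ((\<lambda>t. x + t *\<^sub>R h) -` (- \<Omega>))" using assms
    by (intro closed_vimage) (auto intro!: continuous_intros)
  then have "compact ?K" by (rule compact_Int_closed[OF compact_Icc])
  moreover have K1: "1 \<in> ?K" using assms by simp
  moreover from K1 have "?K \<noteq> {}" by blast
  ultimately obtain \<tau> where \<tau>: "\<tau> \<in> ?K" "\<And>t. t \<in> ?K \<Longrightarrow> \<tau> \<le> t"
    using compact_attains_inf[of ?K] by blast
  have in\<Omega>: "x + t *\<^sub>R h \<in> \<Omega>" if "0 \<le> t" "t < \<tau>" for t
    using \<tau>(2)[of t] \<tau>(1) that by auto
  have pos: "0 < \<tau>" using \<tau>(1) assms(2) by (cases "\<tau> = 0") auto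
  have "(\<lambda>t. x + t *\<^sub>R h) ` closure {0..<\<tau>} \<subseteq> closure \<Omega>"
    using in\<Omega> by (intro image_closure_subset) (auto intro!: continuous_intros closure_subset[THEN subsetD])
  then have "x + \<tau> *\<^sub>R h \<in> closure \<Omega>" using pos by (auto simp: image_subset_iff)
  then have "x + \<tau> *\<^sub>R h \<in> frontier \<Omega>" using \<tau>(1) assms(1) by (auto simp: frontier_def interior_open)
  then show thesis using that[of \<tau>] \<tau>(1) in\<Omega> by auto
qed

text \<open>As r runs over [0, 1] and z over a ball around e, the points x + r z sweep out a
  truncated cone with vertex x; the same e and \<theta> serve all x near p. At an interior point e
  may be 0, and the cone is a ball.\<close>

definition cone_condition :: "'a::euclidean_space set \<Rightarrow> bool" where
  "cone_condition \<Omega> \<longleftrightarrow> (\<forall>p\<in>closure \<Omega>. \<exists>e \<theta> \<rho>. 0 < \<theta> \<and> 0 < \<rho> \<and>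
     (\<forall>x\<in>\<Omega> \<inter> ball p \<rho>. \<forall>r. \<forall>z\<in>ball e \<theta>. 0 \<le> r \<and> r \<le> 1 \<longrightarrow> x + r *\<^sub>R z \<in> \<Omega>))"

text \<open>Connectedness carries the bound to a small ball around every point of \<Omega>. Near a
  boundary point the domain is pushed inwards by e to a place where the bound is already known, and
  compactness of the closure leaves finitely many pieces.\<close>

lemma energy_controlled_domain:
  assumes T: "\<And>f. f \<in> T \<Longrightarrow> C1 f" and s: "0 < s"
    and \<Omega>: "open \<Omega>" "bounded \<Omega>" "connected \<Omega>" and cone: "cone_condition \<Omega>"
    and z: "z \<in> \<Omega>" "0 < d" "energy_controlled s \<Omega> T (ball z d)"
  shows "energy_controlled s \<Omega> T \<Omega>"
proof -
  have [measurable]: "\<Omega> \<in> sets borel" using \<Omega> by simp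
  let ?P = "\<lambda>x. \<exists>d>0. energy_controlled s \<Omega> T (ball x d)"
  have inner: "?P x" if x: "x \<in> \<Omega>" for x
  proof (rule connected_induction_simple[OF \<Omega>(3) z(1) x, of ?P])
    show "?P z" using z by blast
    fix a assume a: "a \<in> \<Omega>"
    then obtain R where R: "0 < R" "ball a R \<subseteq> \<Omega>" using \<Omega>(1) openE by blast
    \<comment> \<open>Within a ball contained in \<Omega> every small ball can be translated onto
      every other: by convexity no segment leaves the large ball.\<close>
    show "\<exists>S. openin (top_of_set \<Omega>) S \<and> a \<in> S \<and> (\<forall>x\<in>S. \<forall>y\<in>S. ?P x \<longrightarrow> ?P y)"
    proof (intro exI[of _ "ball a R"] conjI ballI impI)
      show "openin (top_of_set \<Omega>) (ball a R)" using R \<Omega>(1) by (simp add: openin_open_eq)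
      fix x y assume x: "x \<in> ball a R" and y: "y \<in> ball a R" and "?P x"
      then obtain d where d: "0 < d" "energy_controlled s \<Omega> T (ball x d)" by blast
      obtain d1 where d1: "0 < d1" "ball x d1 \<subseteq> ball a R" using x by (meson open_ball openE)
      obtain d2 where d2: "0 < d2" "ball y d2 \<subseteq> ball a R" using y by (meson open_ball openE)
      define \<delta> where "\<delta> = min d (min d1 d2)"
      have \<delta>: "0 < \<delta>" "\<delta> \<le> d" "\<delta> \<le> d1" "\<delta> \<le> d2" using d d1 d2 by (auto simp: \<delta>_def)
      have sub: "ball x \<delta> \<subseteq> ball a R" "ball y \<delta> \<subseteq> ball a R"
        using \<delta> d1 d2 by (meson subset_ball order_trans)+
      have tr: "w + (x - y) \<in> ball x \<delta>" if "w \<in> ball y \<delta>" for w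
        using that by (simp add: dist_norm algebra_simps)
      have "energy_controlled s \<Omega> T (ball y \<delta>)"
      proof (rule energy_controlled_translate[OF T, where h = "x - y" and U = "ball x \<delta>"])
        show "ball y \<delta> \<subseteq> \<Omega>" using sub R by blast
        show "w + t *\<^sub>R (x - y) \<in> \<Omega>" if "w \<in> ball y \<delta>" "0 \<le> t" "t \<le> 1" for w t
        proof -
          have "w \<in> ball a R" "w + (x - y) \<in> ball a R" using sub tr[OF that(1)] that by auto
          then have "(1 - t) *\<^sub>R w + t *\<^sub>R (w + (x - y)) \<in> ball a R"
            using convex_ball[of a R] that unfolding convex_alt by blast
          then show ?thesis using R by (auto simp: algebra_simps)
        qed
        show "energy_controlled s \<Omega> T (ball x \<delta>)"
          using d \<delta> by (meson energy_controlled_mono subset_ball)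
      qed (use tr s in auto)
      then show "?P y" using \<delta> by blast
    qed (use R in auto)
  qed
  have "\<exists>\<rho>>0. energy_controlled s \<Omega> T (\<Omega> \<inter> ball p \<rho>)" if p: "p \<in> closure \<Omega>" for p
  proof -
    obtain e \<theta> \<rho> where c: "0 < \<theta>" "0 < \<rho>"
      "\<And>x r z. x \<in> \<Omega> \<Longrightarrow> x \<in> ball p \<rho> \<Longrightarrow> 0 \<le> r \<Longrightarrow> r \<le> 1 \<Longrightarrow> z \<in> ball e \<theta> \<Longrightarrow> x + r *\<^sub>R z \<in> \<Omega>"
      using cone p unfolding cone_condition_def by (metis IntI)
    obtain x where x: "x \<in> \<Omega>" "dist x p < min \<rho> \<theta>"
      using p c unfolding closure_approachable by (metis min_less_iff_conj)
    \<comment> \<open>The direction \<open>e + (p - x)\<close> is within \<theta> of e and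
      compensates the displacement of x, so the endpoint is \<open>p + e\<close> itself.\<close>
    have "x + 1 *\<^sub>R (e + (p - x)) \<in> \<Omega>"
      using x c by (intro c(3)) (auto simp: dist_norm norm_minus_commute)
    then have "p + e \<in> \<Omega>" by (simp add: algebra_simps)
    then obtain d where d: "0 < d" "energy_controlled s \<Omega> T (ball (p + e) d)" using inner by blast
    have "energy_controlled s \<Omega> T (\<Omega> \<inter> ball p (min \<rho> d))"
    proof (rule energy_controlled_translate[OF T, where h = e and U = "ball (p + e) d"])
      show "x + t *\<^sub>R e \<in> \<Omega>" if "x \<in> \<Omega> \<inter> ball p (min \<rho> d)" "0 \<le> t" "t \<le> 1" for x t
        using that c by auto
      show "x + e \<in> ball (p + e) d" if "x \<in> \<Omega> \<inter> ball p (min \<rho> d)" for x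
        using that by (auto simp: dist_norm)
    qed (use d s in auto)
    then show ?thesis using c d by (intro exI[of _ "min \<rho> d"]) auto
  qed
  then obtain \<rho> where \<rho>: "\<And>p. p \<in> closure \<Omega> \<Longrightarrow> 0 < \<rho> p \<and> energy_controlled s \<Omega> T (\<Omega> \<inter> ball p (\<rho> p))"
    by metis
  have "compact (closure \<Omega>)" using \<Omega> by (simp add: compact_closure)
  then obtain I where I: "I \<subseteq> closure \<Omega>" "finite I" "closure \<Omega> \<subseteq> (\<Union>p\<in>I. ball p (\<rho> p))"
    by (rule compactE_image[where C = "closure \<Omega>" and f = "\<lambda>p. ball p (\<rho> p)"]) (use \<rho> in \<open>auto intro: exI\<close>)
  have "energy_controlled s \<Omega> T (\<Union>p\<in>I. \<Omega> \<inter> ball p (\<rho> p))"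
    using I \<rho> by (intro energy_controlled_UN T) auto
  moreover have "\<Omega> \<subseteq> (\<Union>p\<in>I. \<Omega> \<inter> ball p (\<rho> p))"
    using I(3) closure_subset[of \<Omega>] by blast
  ultimately show ?thesis by (rule energy_controlled_mono)
qed

text \<open>Each segment from the ball around x to its translate around y stays in the ball around p
  and has to cross the frontier there, hence in S, where the functions vanish at every height; the
  same exit point serves all r.\<close>

lemma energy_controlled_seed:
  assumes T: "\<And>f. f \<in> T \<Longrightarrow> C1 f" "\<And>f b y. f \<in> T \<Longrightarrow> b \<in> S \<Longrightarrow> 0 \<le> y \<Longrightarrow> f (b, y) = 0"
    and s: "0 < s" and \<Omega>: "open \<Omega>"
    and R: "frontier \<Omega> \<inter> ball p R \<subseteq> S" and x: "x \<in> \<Omega>" "x \<in> ball p R" and y: "y \<notin> closure \<Omega>" "y \<in> ball p R"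
  obtains d where "0 < d" "energy_controlled s \<Omega> T (ball x d)"
proof -
  have [measurable]: "\<Omega> \<in> sets borel" using \<Omega> by simp
  obtain d1 where d1: "0 < d1" "ball x d1 \<subseteq> \<Omega> \<inter> ball p R"
    using openE[of "\<Omega> \<inter> ball p R" x] x \<Omega> by auto
  obtain d2 where d2: "0 < d2" "ball y d2 \<subseteq> ball p R - closure \<Omega>"
    using openE[of "ball p R - closure \<Omega>" y] y by auto
  define d h K where "d = min d1 d2" and "h = y - x" and "K = (12 / s + 6 * s) * (norm (y - x) + 1) powr (2 * s)"
  have d: "0 < d" "ball x d \<subseteq> \<Omega> \<inter> ball p R" "ball y d \<subseteq> ball p R - closure \<Omega>"
    using d1 d2 by (auto simp: d_def)
  have "energy_controlled s \<Omega> T (ball x d)" unfolding energy_controlled_def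
  proof (intro exI[of _ K] conjI ballI)
    fix f assume f: "f \<in> T"
    have ex: "\<exists>\<tau>. 0 \<le> \<tau> \<and> \<tau> \<le> 1 \<and> f (w + \<tau> *\<^sub>R h, r) = 0 \<and>
        (\<forall>t. 0 < t \<and> t < \<tau> \<longrightarrow> w + t *\<^sub>R h \<in> \<Omega>)" if w: "w \<in> ball x d" and r: "0 < r" for w r
    proof -
      have "w + h \<in> ball y d" using w by (simp add: h_def dist_norm algebra_simps)
      then have wh: "w + h \<notin> closure \<Omega>" "w + h \<in> ball p R" using d by auto
      have w': "w \<in> \<Omega>" "w \<in> ball p R" using w d by auto
      obtain \<tau> where \<tau>: "0 \<le> \<tau>" "\<tau> \<le> 1" "w + \<tau> *\<^sub>R h \<in> frontier \<Omega>" "\<And>t. 0 \<le> t \<Longrightarrow> t < \<tau> \<Longrightarrow> w + t *\<^sub>R h \<in> \<Omega>"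
        using first_exit[OF \<Omega> w'(1), of h] wh closure_subset by blast
      have "(1 - \<tau>) *\<^sub>R w + \<tau> *\<^sub>R (w + h) \<in> ball p R"
        using convex_ball[of p R] \<tau> w' wh unfolding convex_alt by blast
      then have "w + \<tau> *\<^sub>R h \<in> ball p R" by (simp add: algebra_simps)
      then have "w + \<tau> *\<^sub>R h \<in> S" using \<tau> R by auto
      then show ?thesis using \<tau> T(2)[OF f] r by (intro exI[of _ \<tau>]) auto
    qed
    show "trace_sq (ball x d) f \<le> ennreal K * wenergy s \<Omega> f"
      unfolding K_def
    proof (rule average_slice_bound[OF T(1)[OF f] _ s, where h = h])
      fix r :: real assume r: "0 < r"
      show "trace_sq (ball x d) f \<le> 6 * incr2 \<Omega> f r + ennreal (3 * (norm h)\<^sup>2) * slice2 \<Omega> f r"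
        by (rule exit_slice_bound[OF T(1)[OF f]]) (use d ex r in auto)
    qed (auto simp: h_def intro: add_nonneg_pos)
  qed (use s in \<open>auto simp: K_def\<close>)
  then show thesis using that d by blast
qed

section \<open>Exterior points and interior cones at a smooth boundary\<close>

lemma smooth_domain_exterior:
  assumes \<Omega>: "smooth_bounded_domain \<Omega>" and p: "p \<in> frontier \<Omega>" and R: "0 < R"
  obtains y where "y \<in> ball p R" "y \<notin> closure \<Omega>"
proof -
  obtain r \<rho> where r: "0 < r" "Cinf_on (ball p r) \<rho>"
    "\<And>x. x \<in> ball p r \<Longrightarrow> x \<in> \<Omega> \<longleftrightarrow> \<rho> x < 0"
    "\<And>x. x \<in> ball p r \<Longrightarrow> x \<in> frontier \<Omega> \<longleftrightarrow> \<rho> x = 0"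
    "\<And>x. x \<in> ball p r \<Longrightarrow> \<rho> x = 0 \<Longrightarrow> frechet_derivative \<rho> (at x) \<noteq> (\<lambda>v. 0)"
    using \<Omega> p unfolding smooth_bounded_domain_def by metis
  have diff: "\<rho> differentiable (at p)"
    using r(2) \<open>0 < r\<close> unfolding Cinf_on_def by (auto dest!: spec[of _ "Suc 0"])
  then have D: "(\<rho> has_derivative frechet_derivative \<rho> (at p)) (at p)" using frechet_derivative_works by blast
  have lin: "linear (frechet_derivative \<rho> (at p))" using D by (simp add: has_derivative_def bounded_linear.linear)
  have \<rho>p: "\<rho> p = 0" using r(4)[of p] r(1) p by simp
  obtain v where v: "frechet_derivative \<rho> (at p) v > 0"
  proof -
    obtain v where "frechet_derivative \<rho> (at p) v \<noteq> 0" using r(5)[of p] r(1) \<rho>p by auto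
    then show thesis using that[of v] that[of "- v"] linear_neg[OF lin, of v] by (cases "frechet_derivative \<rho> (at p) v > 0") auto
  qed
  \<comment> \<open>A short step along v makes \<rho> positive, which excludes membership in
    \<Omega> and in its frontier alike.\<close>
  have "((\<lambda>t. \<rho> (p + t *\<^sub>R v)) has_real_derivative frechet_derivative \<rho> (at p) v) (at 0)"
    by (rule has_derivative_along_line) (use D in simp)
  from DERIV_pos_inc_right[OF this v] obtain d where d: "0 < d" "\<And>h. 0 < h \<Longrightarrow> h < d \<Longrightarrow> 0 < \<rho> (p + h *\<^sub>R v)"
    using \<rho>p by auto
  define m where "m = min R r"
  have m: "0 < m" using R r by (simp add: m_def)
  have nv: "0 < norm v + 1" by (intro add_nonneg_pos) auto
  define h where "h = min (d / 2) (m / (norm v + 1))"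
  have "h \<le> d / 2" unfolding h_def by (rule min.cobounded1)
  then have h: "0 < h" "h < d" using d m nv by (auto simp: h_def)
  have "h * norm v \<le> m / (norm v + 1) * norm v" by (intro mult_right_mono) (auto simp: h_def)
  also have "\<dots> < m" using m nv by (simp add: field_simps)
  finally have "p + h *\<^sub>R v \<in> ball p m" using h by (simp add: dist_norm)
  then have in_ball: "p + h *\<^sub>R v \<in> ball p R" "p + h *\<^sub>R v \<in> ball p r" by (auto simp: m_def)
  have "0 < \<rho> (p + h *\<^sub>R v)" using d h by blast
  then have "p + h *\<^sub>R v \<notin> \<Omega>" "p + h *\<^sub>R v \<notin> frontier \<Omega>" using r(3,4) in_ball by auto
  then show thesis using in_ball that closure_Un_frontier[of \<Omega>] by blast
qed

text \<open>At a boundary point the derivative of \<rho> is negative in some direction v. Jointly in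
  base point and direction it stays negative near (p, v), so \<rho> cannot increase along any of
  these segments and remains negative.\<close>

lemma smooth_domain_cone:
  assumes \<Omega>: "smooth_bounded_domain \<Omega>"
  shows "cone_condition \<Omega>"
  unfolding cone_condition_def
proof
  fix p assume p: "p \<in> closure \<Omega>"
  have "open \<Omega>" using \<Omega> by (simp add: smooth_bounded_domain_def)
  show "\<exists>e \<theta> \<rho>. 0 < \<theta> \<and> 0 < \<rho> \<and>
     (\<forall>x\<in>\<Omega> \<inter> ball p \<rho>. \<forall>r. \<forall>z\<in>ball e \<theta>. 0 \<le> r \<and> r \<le> 1 \<longrightarrow> x + r *\<^sub>R z \<in> \<Omega>)"
  proof (cases "p \<in> \<Omega>")
    case True
    then obtain R where R: "0 < R" "ball p R \<subseteq> \<Omega>" using \<open>open \<Omega>\<close> openE by blast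
    have "x + r *\<^sub>R z \<in> \<Omega>" if "x \<in> ball p (R / 2)" "z \<in> ball 0 (R / 2)" "0 \<le> r" "r \<le> 1" for x r z
    proof -
      have "norm (r *\<^sub>R z) \<le> norm z" using that by (simp add: mult_left_le_one_le)
      moreover have "norm (x + r *\<^sub>R z - p) \<le> norm (x - p) + norm (r *\<^sub>R z)"
        by (metis add_diff_eq add.commute norm_triangle_ineq)
      ultimately have "norm (x + r *\<^sub>R z - p) < R" using that by (simp add: dist_norm norm_minus_commute)
      then show ?thesis using R by (auto simp: dist_norm norm_minus_commute)
    qed
    then show ?thesis using R by (intro exI[of _ 0] exI[of _ "R / 2"]) auto
  next
    case False
    then have pf: "p \<in> frontier \<Omega>" using p \<open>open \<Omega>\<close> by (simp add: frontier_def interior_open)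
    obtain r \<rho> where r: "0 < r" "Cinf_on (ball p r) \<rho>"
      "\<And>x. x \<in> ball p r \<Longrightarrow> x \<in> \<Omega> \<longleftrightarrow> \<rho> x < 0"
      "\<And>x. x \<in> ball p r \<Longrightarrow> x \<in> frontier \<Omega> \<longleftrightarrow> \<rho> x = 0"
      "\<And>x. x \<in> ball p r \<Longrightarrow> \<rho> x = 0 \<Longrightarrow> frechet_derivative \<rho> (at x) \<noteq> (\<lambda>v. 0)"
      using \<Omega> pf unfolding smooth_bounded_domain_def by metis
    have C: "Ck_on (Suc 0) (ball p r) \<rho>" using r(2) unfolding Cinf_on_def by blast
    have diff: "\<rho> differentiable (at x)" if "x \<in> ball p r" for x using C that by simp
    have D: "(\<rho> has_derivative frechet_derivative \<rho> (at x)) (at x)" if "x \<in> ball p r" for x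
      using diff[OF that] frechet_derivative_works by blast
    have lin: "linear (frechet_derivative \<rho> (at p))" using D[of p] r(1) by (simp add: has_derivative_def bounded_linear.linear)
    have \<rho>p: "\<rho> p = 0" using r(4)[of p] r(1) pf by simp
    obtain v where v: "frechet_derivative \<rho> (at p) v < 0"
    proof -
      obtain v where "frechet_derivative \<rho> (at p) v \<noteq> 0" using r(5)[of p] r(1) \<rho>p by auto
      then show thesis using that[of v] that[of "- v"] linear_neg[OF lin, of v] by (cases "frechet_derivative \<rho> (at p) v > 0") auto
    qed
    \<comment> \<open>Smoothness yields continuity of the derivative in x for basis directions only;
      expanding z in the basis gives joint continuity in (x, z).\<close>
    define F where "F = (\<lambda>(x, z). \<Sum>i\<in>Basis. (z \<bullet> i) * frechet_derivative \<rho> (at x) i)"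
    have F: "F (x, z) = frechet_derivative \<rho> (at x) z" if "x \<in> ball p r" for x z
      using frechet_derivative_Basis_sum[OF diff[OF that], of z] by (simp add: F_def)
    have cF: "continuous_on (ball p r \<times> UNIV) F" unfolding F_def case_prod_beta
    proof (intro continuous_intros)
      fix i :: 'a assume "i \<in> Basis"
      then have "continuous_on (ball p r) (\<lambda>x. frechet_derivative \<rho> (at x) i)" using C by simp
      then show "continuous_on (ball p r \<times> UNIV) (\<lambda>x. frechet_derivative \<rho> (at (fst x)) i)"
        by (rule continuous_on_compose2) (auto intro: continuous_intros)
    qed
    have "open ((ball p r \<times> UNIV) \<inter> F -` {..<0})"
      by (rule continuous_open_preimage[OF cF]) (auto intro: open_Times)
    moreover have "(p, v) \<in> (ball p r \<times> UNIV) \<inter> F -` {..<0}" using F[of p v] v r(1) by simp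
    ultimately obtain A B where AB: "open A" "open B" "(p, v) \<in> A \<times> B" "A \<times> B \<subseteq> (ball p r \<times> UNIV) \<inter> F -` {..<0}"
      by (rule open_prod_elim)
    obtain a where a: "0 < a" "ball p a \<subseteq> A" using AB openE[OF AB(1), of p] by blast
    obtain b where b: "0 < b" "ball v b \<subseteq> B" using AB openE[OF AB(2), of v] by blast
    have neg: "x \<in> ball p r \<and> frechet_derivative \<rho> (at x) z < 0" if "x \<in> ball p a" "z \<in> ball v b" for x z
    proof -
      have "(x, z) \<in> (ball p r \<times> UNIV) \<inter> F -` {..<0}" using AB(4) a b that by blast
      then show ?thesis using F[of x z] by auto
    qed
    \<comment> \<open>X exceeds the norm of every direction in \<open>ball v b\<close>. Scaling by c
      = a / (2 X) makes directions shorter than a / 2, so segments from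
      \<open>ball p (a / 2)\<close> stay in \<open>ball p a\<close>.\<close>
    define X where "X = norm v + b + 1"
    define c where "c = a / (2 * X)"
    have nv: "0 < X" using b unfolding X_def by (intro add_nonneg_pos) auto
    have c: "0 < c" using a nv by (simp add: c_def)
    have "x + t *\<^sub>R z \<in> \<Omega>" if x: "x \<in> \<Omega>" "x \<in> ball p (a / 2)" and z: "z \<in> ball (c *\<^sub>R v) (c * b)" and t: "0 \<le> t" "t \<le> 1" for x z t
    proof -
      define z' where "z' = (1 / c) *\<^sub>R z"
      have zc: "z = c *\<^sub>R z'" using c by (simp add: z'_def)
      have "dist (c *\<^sub>R v) (c *\<^sub>R z') = c * dist v z'" using c by (simp add: dist_norm scaleR_diff_right[symmetric])
      then have z': "z' \<in> ball v b" using z c zc by simp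
      have nz: "norm z' \<le> norm v + b"
        using z' norm_triangle_sub[of z' v] by (simp add: dist_norm norm_minus_commute)
      have "norm z = c * norm z'" using zc c by simp
      also have "\<dots> \<le> c * (norm v + b)" using nz c by simp
      also have "\<dots> < c * X" using c by (simp add: X_def)
      also have "\<dots> = a / 2" using nv by (simp add: c_def)
      finally have nz2: "norm z < a / 2" .
      have in_a: "x + u *\<^sub>R z \<in> ball p a" if "0 \<le> u" "u \<le> 1" for u
      proof -
        have "norm (u *\<^sub>R z) \<le> norm z" using that by (simp add: mult_left_le_one_le)
        moreover have "norm (x + u *\<^sub>R z - p) \<le> norm (x - p) + norm (u *\<^sub>R z)"
          by (metis add_diff_eq add.commute norm_triangle_ineq)
        ultimately show ?thesis using nz2 x by (simp add: dist_norm norm_minus_commute)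
      qed
      have "\<rho> (x + t *\<^sub>R z) \<le> \<rho> (x + 0 *\<^sub>R z)"
      proof (rule DERIV_nonpos_imp_nonincreasing[OF t(1)])
        fix u assume u: "0 \<le> u" "u \<le> t"
        have ia: "x + u *\<^sub>R z \<in> ball p a" using u t by (intro in_a) auto
        have "((\<lambda>u. \<rho> (x + u *\<^sub>R z)) has_real_derivative frechet_derivative \<rho> (at (x + u *\<^sub>R z)) z) (at u)"
          using neg[OF ia z'] by (intro has_derivative_along_line D) auto
        moreover have "frechet_derivative \<rho> (at (x + u *\<^sub>R z)) z \<le> 0"
        proof -
          have "linear (frechet_derivative \<rho> (at (x + u *\<^sub>R z)))"
            using D neg[OF ia z'] by (auto simp: has_derivative_def bounded_linear.linear)
          then have "frechet_derivative \<rho> (at (x + u *\<^sub>R z)) z = c * frechet_derivative \<rho> (at (x + u *\<^sub>R z)) z'"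
            unfolding zc by (simp add: linear_cmul)
          then show ?thesis using neg[OF ia z'] c by (simp add: mult_le_0_iff)
        qed
        ultimately show "\<exists>y. ((\<lambda>u. \<rho> (x + u *\<^sub>R z)) has_real_derivative y) (at u) \<and> y \<le> 0" by blast
      qed
      also have "\<dots> < 0" using r(3)[of x] neg[OF in_a[of 0] z'] x by simp
      finally show ?thesis using r(3)[of "x + t *\<^sub>R z"] neg[OF in_a[of t] z'] t by simp
    qed
    then show ?thesis using c b a by (intro exI[of _ "c *\<^sub>R v"] exI[of _ "c * b"] exI[of _ "a / 2"]) auto
  qed
qed

section \<open>The trace Sobolev inequality\<close>

lemma nn_integral_affine:
  fixes g :: "'a::euclidean_space \<Rightarrow> ennreal"
  assumes [measurable]: "g \<in> borel_measurable borel" and c: "0 < c"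
  shows "(\<integral>\<^sup>+z. g (x + c *\<^sub>R z) \<partial>lborel) = ennreal (c powr - real DIM('a)) * (\<integral>\<^sup>+y. g y \<partial>lborel)"
proof -
  have "(\<integral>\<^sup>+y. g y \<partial>lborel) = ennreal (c ^ DIM('a)) * (\<integral>\<^sup>+z. g (x + c *\<^sub>R z) \<partial>lborel)"
    using c by (subst lborel_affine[of c x])
      (simp_all add: nn_integral_density nn_integral_distr nn_integral_cmult)
  moreover have "ennreal (c powr - real DIM('a)) * ennreal (c ^ DIM('a)) = 1"
    using c by (simp add: ennreal_mult[symmetric] powr_minus powr_realpow)
  ultimately show ?thesis by (simp add: mult.assoc[symmetric])
qed

text \<open>With y = x + r z, and B away from the origin, this is up to constants the integral of
  the squared increment against |y - x|^(-N-2s) over a truncated cone, a local Gagliardo seminorm.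
  The pair (r, z) replaces polar coordinates, and r will double as the height in the slice
  bound.\<close>

definition cone_incr :: "real \<Rightarrow> 'a::euclidean_space set \<Rightarrow> ('a \<times> real \<Rightarrow> real) \<Rightarrow> 'a \<Rightarrow> ennreal" where
  "cone_incr s B f x = (\<integral>\<^sup>+r\<in>{0<..<1}. ennreal (r powr (- 1 - 2 * s)) *
      (\<integral>\<^sup>+z\<in>B. ennreal ((f (x + r *\<^sub>R z, 0) - f (x, 0))\<^sup>2) \<partial>lborel) \<partial>lborel)"

lemma measurable_cone_incr:
  assumes f: "C1 f" and [measurable]: "B \<in> sets borel"
  shows "cone_incr s B f \<in> borel_measurable borel"
proof -
  have [measurable]: "f \<in> borel_measurable borel" using f by measurable
  show ?thesis unfolding cone_incr_def[abs_def] by measurable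
qed

text \<open>The slice bound for the displacement r z is used at height r. As the length of r z is at
  most M r, integration over r produces Hardy's integral and the energy with the right
  weights.\<close>

lemma cone_incr_integral:
  assumes f: "C1 f" and [measurable]: "\<Omega> \<in> sets borel" "V \<in> sets borel" "B \<in> sets borel" and V: "V \<subseteq> \<Omega>"
    and cone: "\<And>x r z. x \<in> V \<Longrightarrow> 0 \<le> r \<Longrightarrow> r \<le> 1 \<Longrightarrow> z \<in> B \<Longrightarrow> x + r *\<^sub>R z \<in> \<Omega>"
    and B: "emeasure lborel B = ennreal \<beta>" "0 \<le> \<beta>" "\<And>z. z \<in> B \<Longrightarrow> norm z \<le> M" and s: "0 < s"
  shows "(\<integral>\<^sup>+x\<in>V. cone_incr s B f x \<partial>lborel) \<le> ennreal (\<beta> * (6 / s\<^sup>2 + 3 * M\<^sup>2)) * wenergy s \<Omega> f"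
proof -
  have [measurable]: "f \<in> borel_measurable borel" using f by measurable
  have [measurable]: "incr2 \<Omega> f \<in> borel_measurable borel" "slice2 \<Omega> f \<in> borel_measurable borel" using f by measurable
  let ?T = "\<lambda>r z. (\<integral>\<^sup>+x\<in>V. ennreal ((f (x + r *\<^sub>R z, 0) - f (x, 0))\<^sup>2) \<partial>lborel)"
  have "(\<integral>\<^sup>+x\<in>V. cone_incr s B f x \<partial>lborel) =
    (\<integral>\<^sup>+x. (\<integral>\<^sup>+r. ennreal (r powr (- 1 - 2 * s)) * (\<integral>\<^sup>+z\<in>B. ennreal ((f (x + r *\<^sub>R z, 0) - f (x, 0))\<^sup>2) \<partial>lborel) * indicator {0<..<1} r * indicator V x \<partial>lborel) \<partial>lborel)"
    unfolding cone_incr_def by (intro nn_integral_cong, subst nn_integral_multc[symmetric]) (auto simp: mult_ac)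
  also have "\<dots> = (\<integral>\<^sup>+r. (\<integral>\<^sup>+x. ennreal (r powr (- 1 - 2 * s)) * (\<integral>\<^sup>+z\<in>B. ennreal ((f (x + r *\<^sub>R z, 0) - f (x, 0))\<^sup>2) \<partial>lborel) * indicator {0<..<1} r * indicator V x \<partial>lborel) \<partial>lborel)"
    by (rule lborel_pair.Fubini') measurable
  also have "\<dots> = (\<integral>\<^sup>+r\<in>{0<..<1}. ennreal (r powr (- 1 - 2 * s)) * (\<integral>\<^sup>+z\<in>B. ?T r z \<partial>lborel) \<partial>lborel)"
  proof (intro nn_integral_cong)
    fix r :: real
    have "(\<integral>\<^sup>+z\<in>B. ?T r z \<partial>lborel) = (\<integral>\<^sup>+z. (\<integral>\<^sup>+x. ennreal ((f (x + r *\<^sub>R z, 0) - f (x, 0))\<^sup>2) * indicator V x * indicator B z \<partial>lborel) \<partial>lborel)"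
      by (intro nn_integral_cong, subst nn_integral_multc[symmetric]) auto
    also have "\<dots> = (\<integral>\<^sup>+x. (\<integral>\<^sup>+z. ennreal ((f (x + r *\<^sub>R z, 0) - f (x, 0))\<^sup>2) * indicator V x * indicator B z \<partial>lborel) \<partial>lborel)"
      by (rule lborel_pair.Fubini') measurable
    also have "\<dots> = (\<integral>\<^sup>+x. (\<integral>\<^sup>+z\<in>B. ennreal ((f (x + r *\<^sub>R z, 0) - f (x, 0))\<^sup>2) \<partial>lborel) * indicator V x \<partial>lborel)"
      by (intro nn_integral_cong, subst nn_integral_multc[symmetric]) (auto simp: mult_ac)
    finally have *: "(\<integral>\<^sup>+z\<in>B. ?T r z \<partial>lborel) = (\<integral>\<^sup>+x. (\<integral>\<^sup>+z\<in>B. ennreal ((f (x + r *\<^sub>R z, 0) - f (x, 0))\<^sup>2) \<partial>lborel) * indicator V x \<partial>lborel)" .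
    show "(\<integral>\<^sup>+x. ennreal (r powr (- 1 - 2 * s)) * (\<integral>\<^sup>+z\<in>B. ennreal ((f (x + r *\<^sub>R z, 0) - f (x, 0))\<^sup>2) \<partial>lborel) * indicator {0<..<1} r * indicator V x \<partial>lborel) =
      ennreal (r powr (- 1 - 2 * s)) * (\<integral>\<^sup>+z\<in>B. ?T r z \<partial>lborel) * indicator {0<..<1} r"
      unfolding * by (subst mult.commute, subst mult.assoc[symmetric], subst nn_integral_cmult[symmetric])
         (auto simp: mult_ac)
  qed
  also have "\<dots> \<le> (\<integral>\<^sup>+r. ennreal (6 * \<beta>) * (ennreal (r powr (- 1 - 2 * s)) * incr2 \<Omega> f r * indicator {0<..} r) +
      ennreal (3 * M\<^sup>2 * \<beta>) * (ennreal (r powr (1 - 2 * s)) * slice2 \<Omega> f r * indicator {0<..} r) \<partial>lborel)"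
  proof (intro nn_integral_mono)
    fix r :: real
    show "ennreal (r powr (- 1 - 2 * s)) * (\<integral>\<^sup>+z\<in>B. ?T r z \<partial>lborel) * indicator {0<..<1} r \<le>
      ennreal (6 * \<beta>) * (ennreal (r powr (- 1 - 2 * s)) * incr2 \<Omega> f r * indicator {0<..} r) +
      ennreal (3 * M\<^sup>2 * \<beta>) * (ennreal (r powr (1 - 2 * s)) * slice2 \<Omega> f r * indicator {0<..} r)"
    proof (cases "0 < r \<and> r < 1")
      case True
      have "(\<integral>\<^sup>+z\<in>B. ?T r z \<partial>lborel) \<le> (\<integral>\<^sup>+z. (6 * incr2 \<Omega> f r + ennreal (3 * (r * M)\<^sup>2) * slice2 \<Omega> f r) * indicator B z \<partial>lborel)"
      proof (intro nn_integral_mono)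
        fix z
        show "?T r z * indicator B z \<le> (6 * incr2 \<Omega> f r + ennreal (3 * (r * M)\<^sup>2) * slice2 \<Omega> f r) * indicator B z"
        proof (cases "z \<in> B")
          case z: True
          have "?T r z \<le> 6 * incr2 \<Omega> f r + ennreal (3 * (norm (r *\<^sub>R z))\<^sup>2) * slice2 \<Omega> f r"
          proof (rule translation_slice_bound[OF f _ _ V])
            show "x + t *\<^sub>R r *\<^sub>R z \<in> \<Omega>" if "x \<in> V" "0 \<le> t" "t \<le> 1" for x t
              using cone[OF that(1) _ _ z, of "t * r"] that True by (simp add: mult_le_one)
          qed auto
          also have "\<dots> \<le> 6 * incr2 \<Omega> f r + ennreal (3 * (r * M)\<^sup>2) * slice2 \<Omega> f r"
            using B(3)[OF z] True
            by (intro add_left_mono mult_right_mono ennreal_leI mult_left_mono power_mono) auto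
          finally show ?thesis using z by simp
        qed simp
      qed
      also have "\<dots> = (6 * incr2 \<Omega> f r + ennreal (3 * (r * M)\<^sup>2) * slice2 \<Omega> f r) * ennreal \<beta>"
        using B by (simp add: nn_integral_cmult_indicator)
      finally have "ennreal (r powr (- 1 - 2 * s)) * (\<integral>\<^sup>+z\<in>B. ?T r z \<partial>lborel) \<le>
         ennreal (r powr (- 1 - 2 * s)) * ((6 * incr2 \<Omega> f r + ennreal (3 * (r * M)\<^sup>2) * slice2 \<Omega> f r) * ennreal \<beta>)"
        by (rule mult_left_mono) simp
      also have "\<dots> = (6 * ennreal \<beta>) * (ennreal (r powr (- 1 - 2 * s)) * incr2 \<Omega> f r) +
          (ennreal (r powr (- 1 - 2 * s)) * (ennreal (3 * (r * M)\<^sup>2) * ennreal \<beta>)) * slice2 \<Omega> f r"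
        by (simp add: distrib_left mult_ac)
      also have "6 * ennreal \<beta> = ennreal (6 * \<beta>)" using B by (simp add: ennreal_mult)
      also have "ennreal (r powr (- 1 - 2 * s)) * (ennreal (3 * (r * M)\<^sup>2) * ennreal \<beta>) = ennreal (r powr (- 1 - 2 * s) * (3 * (r * M)\<^sup>2 * \<beta>))"
        using B by (simp add: ennreal_mult)
      also have "r powr (- 1 - 2 * s) * (3 * (r * M)\<^sup>2 * \<beta>) = 3 * M\<^sup>2 * \<beta> * r powr (1 - 2 * s)"
        using True powr_add[of r "- 1 - 2 * s" 2] by (simp add: powr_numeral power_mult_distrib)
      also have "ennreal (3 * M\<^sup>2 * \<beta> * r powr (1 - 2 * s)) = ennreal (3 * M\<^sup>2 * \<beta>) * ennreal (r powr (1 - 2 * s))"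
        using B by (simp add: ennreal_mult)
      finally show ?thesis using True by (simp add: mult_ac)
    qed auto
  qed
  also have "\<dots> = ennreal (6 * \<beta>) * (\<integral>\<^sup>+r\<in>{0<..}. ennreal (r powr (- 1 - 2 * s)) * incr2 \<Omega> f r \<partial>lborel) +
      ennreal (3 * M\<^sup>2 * \<beta>) * (\<integral>\<^sup>+r\<in>{0<..}. ennreal (r powr (1 - 2 * s)) * slice2 \<Omega> f r \<partial>lborel)"
    by (simp add: nn_integral_add nn_integral_cmult)
  also have "\<dots> \<le> ennreal (6 * \<beta>) * (ennreal (1 / s\<^sup>2) * wenergy s \<Omega> f) + ennreal (3 * M\<^sup>2 * \<beta>) * wenergy s \<Omega> f"
    by (subst slice2_integral[OF f]) (auto intro!: add_right_mono mult_left_mono hardy f s)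
  also have "\<dots> = ennreal (6 * \<beta> * (1 / s\<^sup>2) + 3 * M\<^sup>2 * \<beta>) * wenergy s \<Omega> f"
  proof -
    have "ennreal (6 * \<beta> * (1 / s\<^sup>2)) = ennreal (6 * \<beta>) * ennreal (1 / s\<^sup>2)"
      using B(2) by (intro ennreal_mult) auto
    moreover have "ennreal (6 * \<beta> * (1 / s\<^sup>2) + 3 * M\<^sup>2 * \<beta>) = ennreal (6 * \<beta> * (1 / s\<^sup>2)) + ennreal (3 * M\<^sup>2 * \<beta>)"
      using B(2) by (intro ennreal_plus) auto
    ultimately show ?thesis by (simp only: distrib_right mult.assoc)
  qed
  also have "6 * \<beta> * (1 / s\<^sup>2) + 3 * M\<^sup>2 * \<beta> = \<beta> * (6 / s\<^sup>2 + 3 * M\<^sup>2)"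
    by (simp add: algebra_simps)
  finally show ?thesis .
qed

text \<open>Either b or d is at least t / 2. In the second case only two powers of t are given up
  for d, since only squared increments are controlled by the energy.\<close>

lemma split_power_bound:
  fixes t d b p :: real
  assumes t: "0 < t" and p: "0 < p" and le: "t \<le> d + b" and nn: "0 \<le> d" "0 \<le> b"
  shows "t powr p \<le> 4 * t powr (p - 2) * d\<^sup>2 + 2 powr p * b powr p"
proof (cases "t \<le> 2 * b")
  case True
  have "t powr p \<le> (2 * b) powr p" using True t p by (intro powr_mono2) auto
  also have "\<dots> = 2 powr p * b powr p" using nn by (simp add: powr_mult)
  finally show ?thesis by (simp add: add_increasing)
next
  case False
  then have "t \<le> 2 * d" using le by simp
  then have "t\<^sup>2 \<le> (2 * d)\<^sup>2" using t by (intro power_mono) auto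
  then have "t powr (p - 2) * t\<^sup>2 \<le> t powr (p - 2) * (2 * d)\<^sup>2" by (intro mult_left_mono) auto
  moreover have "t powr (p - 2) * t\<^sup>2 = t powr p" using t powr_add[of t "p - 2" 2] by (simp add: powr_numeral)
  ultimately show ?thesis by (simp add: power_mult_distrib add_increasing2)
qed

text \<open>The average runs over scales in (r / 2, r) as well as over B, since
  \<open>cone_incr\<close> controls an integral over scales and no single scale. The exponent p is
  left free because both the critical exponent and 2 will be inserted.\<close>

lemma cone_pointwise:
  fixes f :: "'a::euclidean_space \<times> real \<Rightarrow> real"
  assumes f: "C1 f" and [measurable]: "\<Omega> \<in> sets borel" "B \<in> sets borel"
    and cone: "\<And>r z. 0 \<le> r \<Longrightarrow> r \<le> 1 \<Longrightarrow> z \<in> B \<Longrightarrow> x + r *\<^sub>R z \<in> \<Omega>"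
    and B: "emeasure lborel B = ennreal \<beta>" "0 \<le> \<beta>" and s: "0 < s" and p: "0 < p"
    and t: "t = \<bar>f (x, 0)\<bar>" "0 < t" and r: "0 < r" "r \<le> 1"
  shows "ennreal (t powr p * (\<beta> * (r / 2))) \<le> ennreal (4 * t powr (p - 2) * r powr (1 + 2 * s)) * cone_incr s B f x
     + ennreal (2 powr p * (r / 2) * (r / 2) powr - real DIM('a)) * trace_powr p \<Omega> f"
proof -
  have [measurable]: "f \<in> borel_measurable borel" using f by measurable
  let ?d = "\<lambda>\<rho> z. ennreal ((f (x + \<rho> *\<^sub>R z, 0) - f (x, 0))\<^sup>2)"
  let ?b = "\<lambda>\<rho> z. ennreal (\<bar>f (x + \<rho> *\<^sub>R z, 0)\<bar> powr p)"
  let ?M = "trace_powr p \<Omega> f"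
  have 1: "ennreal (t powr p * \<beta>) \<le> ennreal (4 * t powr (p - 2)) * (\<integral>\<^sup>+z\<in>B. ?d \<rho> z \<partial>lborel)
       + ennreal (2 powr p) * (\<integral>\<^sup>+z\<in>B. ?b \<rho> z \<partial>lborel)" for \<rho>
  proof -
    have "ennreal (t powr p * \<beta>) = (\<integral>\<^sup>+z. ennreal (t powr p) * indicator B z \<partial>lborel)"
      using B by (simp add: nn_integral_cmult_indicator ennreal_mult)
    also have "\<dots> \<le> (\<integral>\<^sup>+z. ennreal (4 * t powr (p - 2)) * (?d \<rho> z * indicator B z) + ennreal (2 powr p) * (?b \<rho> z * indicator B z) \<partial>lborel)"
    proof (intro nn_integral_mono)
      fix z
      have "t powr p \<le> 4 * t powr (p - 2) * \<bar>f (x + \<rho> *\<^sub>R z, 0) - f (x, 0)\<bar>\<^sup>2 + 2 powr p * \<bar>f (x + \<rho> *\<^sub>R z, 0)\<bar> powr p"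
        using t p by (intro split_power_bound) auto
      then have "ennreal (t powr p) \<le> ennreal (4 * t powr (p - 2)) * ?d \<rho> z + ennreal (2 powr p) * ?b \<rho> z"
        by (simp add: ennreal_mult[symmetric] ennreal_plus[symmetric] del: ennreal_plus)
      then show "ennreal (t powr p) * indicator B z \<le> ennreal (4 * t powr (p - 2)) * (?d \<rho> z * indicator B z) + ennreal (2 powr p) * (?b \<rho> z * indicator B z)"
        by (auto split: split_indicator)
    qed
    also have "\<dots> = ennreal (4 * t powr (p - 2)) * (\<integral>\<^sup>+z\<in>B. ?d \<rho> z \<partial>lborel) + ennreal (2 powr p) * (\<integral>\<^sup>+z\<in>B. ?b \<rho> z \<partial>lborel)"
      by (simp add: nn_integral_add nn_integral_cmult)
    finally show ?thesis .
  qed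
  \<comment> \<open>The substitution y = x + \<rho> z costs the factor \<rho>^(-N), and the cone
    keeps y inside \<Omega>.\<close>
  have 2: "(\<integral>\<^sup>+z\<in>B. ?b \<rho> z \<partial>lborel) \<le> ennreal ((r / 2) powr - real DIM('a)) * ?M" if \<rho>: "r / 2 < \<rho>" "\<rho> < r" for \<rho>
  proof -
    have "(\<integral>\<^sup>+z\<in>B. ?b \<rho> z \<partial>lborel) \<le> (\<integral>\<^sup>+z. ?b \<rho> z * indicator \<Omega> (x + \<rho> *\<^sub>R z) \<partial>lborel)"
      using cone[of \<rho>] \<rho> r by (intro nn_integral_mono) (auto split: split_indicator)
    also have "\<dots> = ennreal (\<rho> powr - real DIM('a)) * ?M"
      using \<rho> r by (subst nn_integral_affine[symmetric]) auto
    also have "\<dots> \<le> ennreal ((r / 2) powr - real DIM('a)) * ?M"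
      using \<rho> r by (intro mult_right_mono ennreal_leI powr_mono2') auto
    finally show ?thesis .
  qed
  have "ennreal (t powr p * (\<beta> * (r / 2))) = (\<integral>\<^sup>+\<rho>. ennreal (t powr p * \<beta>) * indicator {r/2<..<r} \<rho> \<partial>lborel)"
    using B r by (simp add: nn_integral_cmult_indicator ennreal_mult[symmetric] mult_ac)
  also have "\<dots> \<le> (\<integral>\<^sup>+\<rho>. ennreal (4 * t powr (p - 2) * r powr (1 + 2 * s)) * (ennreal (\<rho> powr (- 1 - 2 * s)) * (\<integral>\<^sup>+z\<in>B. ?d \<rho> z \<partial>lborel) * indicator {0<..<1} \<rho>)
      + (ennreal (2 powr p * (r / 2) powr - real DIM('a)) * ?M) * indicator {r/2<..<r} \<rho> \<partial>lborel)"
  proof (intro nn_integral_mono)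
    fix \<rho>
    show "ennreal (t powr p * \<beta>) * indicator {r/2<..<r} \<rho> \<le>
      ennreal (4 * t powr (p - 2) * r powr (1 + 2 * s)) * (ennreal (\<rho> powr (- 1 - 2 * s)) * (\<integral>\<^sup>+z\<in>B. ?d \<rho> z \<partial>lborel) * indicator {0<..<1} \<rho>)
      + (ennreal (2 powr p * (r / 2) powr - real DIM('a)) * ?M) * indicator {r/2<..<r} \<rho>"
    proof (cases "r / 2 < \<rho> \<and> \<rho> < r")
      case True
      \<comment> \<open>The weight decreases, so for scales below r it is at least its value at r;
        multiplied by \<open>r powr (1 + 2 * s)\<close> it dominates 1.\<close>
      have "1 = r powr (1 + 2 * s) * r powr (- 1 - 2 * s)" using r by (simp add: powr_add[symmetric])
      also have "\<dots> \<le> r powr (1 + 2 * s) * \<rho> powr (- 1 - 2 * s)"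
        using True r s by (intro mult_left_mono powr_mono2') auto
      finally have "4 * t powr (p - 2) * 1 \<le> 4 * t powr (p - 2) * (r powr (1 + 2 * s) * \<rho> powr (- 1 - 2 * s))"
        by (intro mult_left_mono) auto
      then have "ennreal (4 * t powr (p - 2)) \<le> ennreal (4 * t powr (p - 2) * r powr (1 + 2 * s)) * ennreal (\<rho> powr (- 1 - 2 * s))"
        by (simp add: ennreal_mult[symmetric] mult_ac)
      then have "ennreal (4 * t powr (p - 2)) * (\<integral>\<^sup>+z\<in>B. ?d \<rho> z \<partial>lborel) \<le>
         ennreal (4 * t powr (p - 2) * r powr (1 + 2 * s)) * ennreal (\<rho> powr (- 1 - 2 * s)) * (\<integral>\<^sup>+z\<in>B. ?d \<rho> z \<partial>lborel)"
        by (rule mult_right_mono) simp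
      moreover have "ennreal (2 powr p) * (\<integral>\<^sup>+z\<in>B. ?b \<rho> z \<partial>lborel) \<le> ennreal (2 powr p) * (ennreal ((r / 2) powr - real DIM('a)) * ?M)"
        using True by (intro mult_left_mono 2) auto
      ultimately have "ennreal (t powr p * \<beta>) \<le> ennreal (4 * t powr (p - 2) * r powr (1 + 2 * s)) * ennreal (\<rho> powr (- 1 - 2 * s)) * (\<integral>\<^sup>+z\<in>B. ?d \<rho> z \<partial>lborel)
         + ennreal (2 powr p) * (ennreal ((r / 2) powr - real DIM('a)) * ?M)"
        using 1[of \<rho>] by (meson add_mono order_trans)
      then show ?thesis using True r by (simp add: ennreal_mult mult.assoc)
    qed simp
  qed
  also have "\<dots> = ennreal (4 * t powr (p - 2) * r powr (1 + 2 * s)) * cone_incr s B f x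
     + ennreal (2 powr p * (r / 2) powr - real DIM('a)) * ?M * ennreal (r / 2)"
    using r unfolding cone_incr_def
    by (subst nn_integral_add) (auto simp: nn_integral_cmult nn_integral_cmult_indicator)
  also have "ennreal (2 powr p * (r / 2) powr - real DIM('a)) * ?M * ennreal (r / 2) = ennreal (2 powr p * (r / 2) * (r / 2) powr - real DIM('a)) * ?M"
  proof -
    have "ennreal (2 powr p * (r / 2) * (r / 2) powr - real DIM('a)) = ennreal (2 powr p * (r / 2) powr - real DIM('a)) * ennreal (r / 2)"
      using r by (subst ennreal_mult[symmetric]) (auto simp: mult_ac)
    then show ?thesis by (simp only: mult_ac)
  qed
  finally show ?thesis .
qed

text \<open>The radius is chosen so that the second term of \<open>H1\<close> is half of the left-hand side; if this
  radius exceeds 1, then \<open>t powr q\<close> is bounded by a multiple of \<open>W\<close>, and \<open>H2\<close> is multiplied by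
  \<open>t powr (q - 2)\<close>.\<close>
lemma sobolev_optimise:
  fixes t g W L N s q c1 c2 c3 :: real
  assumes s: "0 < s" and N: "2 * s < N" and q: "q = 2 * N / (N - 2 * s)"
    and t: "0 < t" and g: "0 \<le> g" and W: "0 < W" and L: "0 \<le> L" and c: "0 \<le> c1" "0 < c2" "0 \<le> c3"
    and H1: "\<And>r. 0 < r \<Longrightarrow> r \<le> 1 \<Longrightarrow> t powr q \<le> c1 * t powr (q - 2) * r powr (2 * s) * g + c2 * r powr (- N) * W"
    and H2: "t\<^sup>2 \<le> c1 * g + c3 * L"
  shows "t powr q \<le> (2 * c2) powr (1 - 2 / q) * (2 * c1 + c3) * W powr (1 - 2 / q) * (g + L)"
proof -
  define a where "a = 2 * c2 * W"
  have a: "0 < a" using c W by (simp add: a_def)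
  have Npos: "0 < N" using s N by simp
  have qpos: "0 < q" using q N Npos by simp
  have "2 / q = (N - 2 * s) / N" using N Npos by (simp add: q field_simps)
  then have e1: "2 * s / N = 1 - 2 / q" using Npos by (simp add: diff_divide_distrib)
  have e2: "2 * s * q / N = q - 2"
  proof -
    have "2 * s * q / N = q * (2 * s / N)" by simp
    also have "\<dots> = q - 2" unfolding e1 using qpos by (simp add: field_simps)
    finally show ?thesis .
  qed
  define r where "r = a powr (1 / N) * t powr (- q / N)"
  have rpos: "0 < r" using a t by (simp add: r_def)
  have aW: "a powr (1 - 2 / q) = (2 * c2) powr (1 - 2 / q) * W powr (1 - 2 / q)"
    unfolding a_def using c W by (simp add: powr_mult)
  have main: "t powr q \<le> a powr (1 - 2 / q) * (2 * c1 * g + c3 * L)"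
  proof (cases "r \<le> 1")
    case True
    have "r powr (- N) = a powr (-1) * t powr q"
      unfolding r_def using a t Npos by (simp add: powr_mult powr_powr)
    then have x1: "c2 * r powr (- N) * W = t powr q / 2"
      using a c W by (simp add: powr_minus a_def field_simps)
    \<comment> \<open>Criticality of q enters here: by \<open>e2\<close> the chosen radius
      contributes exactly \<open>t powr (2 - q)\<close>, which cancels the factor
      \<open>t powr (q - 2)\<close> in \<open>H1\<close>.\<close>
    have x2: "r powr (2 * s) = a powr (1 - 2 / q) * t powr (2 - q)"
    proof -
      have "r powr (2 * s) = a powr (2 * s / N) * t powr (- (2 * s * q / N))"
        unfolding r_def using a t by (simp add: powr_mult powr_powr mult_ac)
      then show ?thesis unfolding e1 e2 by simp
    qed
    have "t powr q \<le> c1 * t powr (q - 2) * r powr (2 * s) * g + t powr q / 2"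
      using H1[OF rpos True] x1 by simp
    then have "t powr q \<le> 2 * (c1 * t powr (q - 2) * r powr (2 * s) * g)" by simp
    also have "\<dots> = 2 * c1 * a powr (1 - 2 / q) * g * (t powr (q - 2) * t powr (2 - q))"
      unfolding x2 by simp
    also have "t powr (q - 2) * t powr (2 - q) = 1" using t by (simp add: powr_add[symmetric])
    also have "2 * c1 * a powr (1 - 2 / q) * g * 1 \<le> a powr (1 - 2 / q) * (2 * c1 * g + c3 * L)"
      using c L by (simp add: algebra_simps)
    finally show ?thesis .
  next
    case False
    then have "1 powr N < r powr N" using Npos by (intro powr_less_mono2) auto
    also have "r powr N = a * t powr (- q)"
      unfolding r_def using a t Npos by (simp add: powr_mult powr_powr)
    finally have tq: "t powr q < a" using t by (simp add: powr_minus field_simps)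
    have "t powr (q - 2) = (t powr q) powr (1 - 2 / q)"
    proof -
      have "q * (1 - 2 / q) = q - 2" using qpos by (simp add: right_diff_distrib)
      then show ?thesis by (simp only: powr_powr)
    qed
    also have "\<dots> \<le> a powr (1 - 2 / q)"
    proof -
      have "0 \<le> 2 * s / N" using s Npos by simp
      then have "0 \<le> 1 - 2 / q" unfolding e1 .
      then show ?thesis using tq by (intro powr_mono2) auto
    qed
    finally have "t powr (q - 2) * t\<^sup>2 \<le> a powr (1 - 2 / q) * (c1 * g + c3 * L)"
      using H2 by (intro mult_mono) auto
    moreover have "t powr (q - 2) * t\<^sup>2 = t powr q" using t powr_add[of t "q - 2" 2] by (simp add: powr_numeral)
    moreover have "a powr (1 - 2 / q) * (c1 * g + c3 * L) \<le> a powr (1 - 2 / q) * (2 * c1 * g + c3 * L)"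
      using c g by (intro mult_left_mono) auto
    ultimately show ?thesis by simp
  qed
  also have "\<dots> \<le> a powr (1 - 2 / q) * ((2 * c1 + c3) * (g + L))"
    using c g L by (intro mult_left_mono) (auto simp: algebra_simps)
  finally show ?thesis unfolding aW by (simp add: mult_ac)
qed

text \<open>Ensures that the critical integral of a trace is finite before a power of it is
  cancelled in the Sobolev inequality.\<close>

lemma nn_integral_bounded_continuous_finite:
  fixes u :: "'a::euclidean_space \<Rightarrow> real"
  assumes u: "continuous_on UNIV u" and \<Omega>: "bounded \<Omega>" "\<Omega> \<in> sets borel" and p: "0 < p"
  shows "(\<integral>\<^sup>+x\<in>\<Omega>. ennreal (\<bar>u x\<bar> powr p) \<partial>lborel) < top"
proof -
  have "compact (u ` closure \<Omega>)" using u \<Omega>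
    by (intro compact_continuous_image) (auto simp: compact_closure intro: continuous_on_subset)
  then obtain M where M: "\<And>x. x \<in> closure \<Omega> \<Longrightarrow> \<bar>u x\<bar> \<le> M"
    by (metis bounded_real compact_imp_bounded image_eqI)
  have "(\<integral>\<^sup>+x\<in>\<Omega>. ennreal (\<bar>u x\<bar> powr p) \<partial>lborel) \<le> (\<integral>\<^sup>+x. ennreal (\<bar>M\<bar> powr p) * indicator \<Omega> x \<partial>lborel)"
  proof (intro nn_integral_mono)
    fix x
    have "\<bar>u x\<bar> powr p \<le> \<bar>M\<bar> powr p" if "x \<in> \<Omega>"
      using M[of x] that p closure_subset[of \<Omega>] by (intro powr_mono2) auto
    then show "ennreal (\<bar>u x\<bar> powr p) * indicator \<Omega> x \<le> ennreal (\<bar>M\<bar> powr p) * indicator \<Omega> x"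
      by (auto split: split_indicator intro: ennreal_leI)
  qed
  also have "\<dots> = ennreal (\<bar>M\<bar> powr p) * emeasure lborel \<Omega>"
    using \<Omega> by (simp add: nn_integral_cmult_indicator)
  also have "\<dots> < top" using emeasure_bounded_finite[OF \<Omega>(1)] by (simp add: ennreal_mult_less_top less_top)
  finally show ?thesis .
qed

lemma C1_trace_continuous: "C1 f \<Longrightarrow> continuous_on UNIV (\<lambda>x. f (x, 0))"
  by (rule continuous_on_compose2[OF C1_continuous]) (auto intro: continuous_intros)

lemma local_sobolev:
  fixes \<Omega> V :: "'a::euclidean_space set" and s q :: real
  assumes \<Omega>: "open \<Omega>" and V: "V \<in> sets borel" "V \<subseteq> \<Omega>" "bounded V"
    and cone: "0 < \<theta>" "\<And>x r z. x \<in> V \<Longrightarrow> 0 \<le> r \<Longrightarrow> r \<le> 1 \<Longrightarrow> z \<in> ball e \<theta> \<Longrightarrow> x + r *\<^sub>R z \<in> \<Omega>"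
    and s: "0 < s" and N: "2 * s < real DIM('a)" and q: "q = 2 * real DIM('a) / (real DIM('a) - 2 * s)"
  shows "\<exists>C\<ge>0. \<forall>f W L. C1 f \<longrightarrow> 0 \<le> W \<longrightarrow> 0 \<le> L \<longrightarrow>
     trace_powr q \<Omega> f = ennreal W \<longrightarrow>
     trace_sq \<Omega> f = ennreal L \<longrightarrow>
     trace_powr q V f \<le> ennreal (C * W powr (1 - 2 / q)) * (wenergy s \<Omega> f + ennreal L)"
proof -
  have [measurable]: "\<Omega> \<in> sets borel" "V \<in> sets borel" using \<Omega> V by auto
  define \<beta> where "\<beta> = measure lborel (ball e \<theta>)"
  have B: "emeasure lborel (ball e \<theta>) = ennreal \<beta>"
    unfolding \<beta>_def using emeasure_lborel_ball_finite[of e \<theta>] by (intro emeasure_eq_ennreal_measure) auto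
  have \<beta>: "0 < \<beta>" unfolding \<beta>_def using cone(1) by simp
  define n where "n = real DIM('a)"
  have n: "0 < n" "2 * s < n" using s N by (auto simp: n_def)
  have qpos: "0 < q" using q n by (simp add: n_def)
  define c1 c2 c3 where "c1 = 8 / \<beta>" and "c2 = 2 powr (q + n) / \<beta>" and "c3 = 2 powr (2 + n) / \<beta>"
  have c: "0 < c1" "0 < c2" "0 < c3" using \<beta> by (auto simp: c1_def c2_def c3_def)
  define c4 where "c4 = (2 * c2) powr (1 - 2 / q) * (2 * c1 + c3)"
  have c4: "0 < c4" using c by (simp add: c4_def add_pos_pos)
  define M where "M = norm e + \<theta>"
  define K where "K = \<beta> * (6 / s\<^sup>2 + 3 * M\<^sup>2)"
  have K: "0 \<le> K" using \<beta> by (simp add: K_def)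
  define mV where "mV = measure lborel V"
  have mV: "emeasure lborel V = ennreal mV" "0 \<le> mV"
    unfolding mV_def using emeasure_bounded_finite[OF V(3)] by (auto intro!: emeasure_eq_ennreal_measure)
  show ?thesis
  proof (intro exI[of _ "c4 * (K + mV)"] conjI allI impI)
    show "0 \<le> c4 * (K + mV)" using c4 K mV by simp
    fix f :: "'a \<times> real \<Rightarrow> real" and W L :: real
    assume f: "C1 f" and W: "0 \<le> W" and L: "0 \<le> L"
      and Weq: "trace_powr q \<Omega> f = ennreal W"
      and Leq: "trace_sq \<Omega> f = ennreal L"
    have [measurable]: "f \<in> borel_measurable borel" using f by measurable
    show "trace_powr q V f \<le> ennreal (c4 * (K + mV) * W powr (1 - 2 / q)) * (wenergy s \<Omega> f + ennreal L)"
    proof (cases "W = 0")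
      case True
      have "trace_powr q V f \<le> trace_powr q \<Omega> f"
        using V by (intro nn_integral_mono) (auto split: split_indicator)
      then show ?thesis using True Weq by simp
    next
      case False
      then have W: "0 < W" using W by simp
      define w where "w = W powr (1 - 2 / q)"
      have w: "0 < w" using W by (simp add: w_def)
      \<comment> \<open>An infinite \<open>cone_incr\<close> makes the claim trivial, since
        \<open>c4 * w\<close> is positive; otherwise it is the real number g and the optimisation
        applies.\<close>
      have pt: "ennreal (\<bar>f (x, 0)\<bar> powr q) \<le> ennreal (c4 * w) * (cone_incr s (ball e \<theta>) f x + ennreal L)"
        if x: "x \<in> V" for x
      proof (cases "f (x, 0) = 0 \<or> cone_incr s (ball e \<theta>) f x = top")
        case True
        then show ?thesis using c4 w by (auto simp: ennreal_mult_top)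
      next
        case nz: False
        define t where "t = \<bar>f (x, 0)\<bar>"
        have t: "0 < t" using nz by (simp add: t_def)
        define g where "g = enn2real (cone_incr s (ball e \<theta>) f x)"
        have g: "cone_incr s (ball e \<theta>) f x = ennreal g" "0 \<le> g"
          using nz by (auto simp: g_def less_top)
        have pw: "t powr p * (\<beta> * (r / 2)) \<le> 4 * t powr (p - 2) * r powr (1 + 2 * s) * g + 2 powr p * (r / 2) * (r / 2) powr - n * I"
          if r: "0 < r" "r \<le> 1" and p: "0 < p" and I: "0 \<le> I" "trace_powr p \<Omega> f = ennreal I" for r p I
        proof -
          have "ennreal (t powr p * (\<beta> * (r / 2))) \<le> ennreal (4 * t powr (p - 2) * r powr (1 + 2 * s)) * cone_incr s (ball e \<theta>) f x
            + ennreal (2 powr p * (r / 2) * (r / 2) powr - real DIM('a)) * trace_powr p \<Omega> f"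
            by (rule cone_pointwise[OF f]) (use cone(2)[OF x] B \<beta> s p t r in \<open>auto simp: t_def\<close>)
          also have "\<dots> = ennreal (4 * t powr (p - 2) * r powr (1 + 2 * s) * g + 2 powr p * (r / 2) * (r / 2) powr - n * I)"
            unfolding g(1) I(2) n_def[symmetric] using g(2) I(1) r
            by (simp add: ennreal_mult[symmetric] ennreal_plus[symmetric] del: ennreal_plus)
          finally show ?thesis using g I r by (subst (asm) ennreal_le_iff) auto
        qed
        have "t powr q \<le> (2 * c2) powr (1 - 2 / q) * (2 * c1 + c3) * W powr (1 - 2 / q) * (g + L)"
        proof (rule sobolev_optimise[OF s n(2) _ t g(2) W L])
          show "q = 2 * n / (n - 2 * s)" using q by (simp add: n_def)
          fix r :: real assume r: "0 < r" "r \<le> 1"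
          \<comment> \<open>Division by \<beta> r / 2 turns the factor 4 into c1 = 8 / \<beta>, and
            the halved radius puts \<open>2 powr n\<close> into c2.\<close>
          have "t powr q = t powr q * (\<beta> * (r / 2)) * (2 / (\<beta> * r))" using \<beta> r by simp
          also have "\<dots> \<le> (4 * t powr (q - 2) * r powr (1 + 2 * s) * g + 2 powr q * (r / 2) * (r / 2) powr - n * W) * (2 / (\<beta> * r))"
            using \<beta> r by (intro mult_right_mono pw[OF r qpos _ Weq]) (use W in auto)
          also have "\<dots> = 8 / \<beta> * t powr (q - 2) * (r powr (1 + 2 * s) / r) * g + 2 powr q / \<beta> * (r / 2) powr - n * W"
            using \<beta> r by (simp add: field_simps)
          also have "r powr (1 + 2 * s) / r = r powr (2 * s)" using r by (simp add: powr_add)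
          also have "(r / 2) powr - n = 2 powr n * r powr - n" using r by (simp add: powr_divide powr_minus field_simps)
          finally show "t powr q \<le> c1 * t powr (q - 2) * r powr (2 * s) * g + c2 * r powr - n * W"
            by (simp add: c1_def c2_def powr_add mult_ac)
        next
          \<comment> \<open>The same pointwise estimate with exponent 2 at the largest admissible
            radius 1 is the hypothesis \<open>H2\<close>.\<close>
          have Leq': "trace_powr 2 \<Omega> f = ennreal L"
            using Leq by (simp add: powr_numeral)
          have h: "(1 / 2) powr - n = (2::real) powr n" by (simp add: powr_divide powr_minus field_simps)
          have "t\<^sup>2 = t powr 2 * (\<beta> * (1 / 2)) * (2 / \<beta>)" using \<beta> t by (simp add: powr_numeral)
          also have "\<dots> \<le> (4 * t powr (2 - 2) * 1 powr (1 + 2 * s) * g + 2 powr 2 * (1 / 2) * (1 / 2) powr - n * L) * (2 / \<beta>)"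
            using \<beta> by (intro mult_right_mono pw[OF _ _ _ L Leq']) auto
          also have "\<dots> = 8 / \<beta> * g + 4 * 2 powr n / \<beta> * L"
            unfolding h using \<beta> t by (simp add: field_simps powr_numeral)
          finally show "t\<^sup>2 \<le> c1 * g + c3 * L"
            by (simp add: c1_def c3_def powr_add powr_numeral)
        qed (use c in auto)
        then have "ennreal (t powr q) \<le> ennreal (c4 * w * (g + L))"
          by (intro ennreal_leI) (simp add: c4_def w_def)
        also have "\<dots> = ennreal (c4 * w) * (cone_incr s (ball e \<theta>) f x + ennreal L)"
          unfolding g(1) using g(2) L c4 w by (simp add: ennreal_mult ennreal_plus)
        finally show ?thesis by (simp add: t_def)
      qed
      have [measurable]: "cone_incr s (ball e \<theta>) f \<in> borel_measurable borel"
        by (rule measurable_cone_incr[OF f]) simp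
      have "trace_powr q V f \<le>
        (\<integral>\<^sup>+x. ennreal (c4 * w) * (cone_incr s (ball e \<theta>) f x * indicator V x + ennreal L * indicator V x) \<partial>lborel)"
        using pt by (intro nn_integral_mono) (auto split: split_indicator)
      also have "\<dots> = ennreal (c4 * w) * ((\<integral>\<^sup>+x\<in>V. cone_incr s (ball e \<theta>) f x \<partial>lborel) + ennreal L * ennreal mV)"
        by (simp add: nn_integral_cmult nn_integral_add nn_integral_cmult_indicator mV)
      also have "\<dots> \<le> ennreal (c4 * w) * (ennreal K * wenergy s \<Omega> f + ennreal L * ennreal mV)"
        unfolding K_def
      proof (intro mult_left_mono add_right_mono cone_incr_integral[OF f _ _ _ V(2) cone(2) B])
        show "norm z \<le> M" if "z \<in> ball e \<theta>" for z
          using that norm_triangle_sub[of z e] by (simp add: M_def dist_norm norm_minus_commute)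
      qed (use \<beta> s in auto)
      also have "\<dots> \<le> ennreal (c4 * w) * (ennreal (K + mV) * wenergy s \<Omega> f + ennreal L * ennreal (K + mV))"
        using K mV by (intro mult_left_mono add_mono mult_right_mono mult_left_mono ennreal_leI) auto
      also have "\<dots> = (ennreal (c4 * w) * ennreal (K + mV)) * (wenergy s \<Omega> f + ennreal L)"
        by (simp only: distrib_left mult_ac)
      also have "ennreal (c4 * w) * ennreal (K + mV) = ennreal (c4 * (K + mV) * W powr (1 - 2 / q))"
        using c4 w K mV by (subst ennreal_mult[symmetric]) (auto simp: w_def mult_ac)
      finally show ?thesis .
    qed
  qed
qed

text \<open>The local bounds over a finite cover add up to
  \<open>W \<le> K * \<epsilon> * W powr (1 - 2 / q)\<close>, the L^2 mass being absorbed by the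
  Poincare inequality. As W is finite, cancelling leaves
  \<open>W powr (2 / q) \<le> K * \<epsilon>\<close> unless W is 0.\<close>

lemma trace_sobolev:
  fixes \<Omega> :: "'a::euclidean_space set" and s q :: real
  assumes T: "\<And>f. f \<in> T \<Longrightarrow> C1 f" and \<Omega>: "open \<Omega>" "bounded \<Omega>" and cone: "cone_condition \<Omega>"
    and P: "energy_controlled s \<Omega> T \<Omega>"
    and s: "0 < s" and N: "2 * s < real DIM('a)" and q: "q = 2 * real DIM('a) / (real DIM('a) - 2 * s)"
  obtains C where "0 \<le> C" "\<And>f \<epsilon>. f \<in> T \<Longrightarrow> 0 \<le> \<epsilon> \<Longrightarrow> wenergy s \<Omega> f \<le> ennreal \<epsilon> \<Longrightarrow>
     trace_powr q \<Omega> f \<le> ennreal (C * \<epsilon> powr (q / 2))"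
proof -
  have [measurable]: "\<Omega> \<in> sets borel" using \<Omega> by auto
  have qpos: "0 < q" using q N s by simp
  have q2: "0 < 1 - 2 / q"
  proof -
    have "2 < q" unfolding q using s N by (simp add: field_simps)
    then show ?thesis by simp
  qed
  define R where "R p \<rho> C \<longleftrightarrow> (\<forall>f W L. C1 f \<longrightarrow> 0 \<le> W \<longrightarrow> 0 \<le> L \<longrightarrow>
     trace_powr q \<Omega> f = ennreal W \<longrightarrow>
     trace_sq \<Omega> f = ennreal L \<longrightarrow>
     trace_powr q (\<Omega> \<inter> ball p \<rho>) f \<le> ennreal (C * W powr (1 - 2 / q)) * (wenergy s \<Omega> f + ennreal L))"
    for p \<rho> C
  have "\<exists>\<rho> C. 0 < \<rho> \<and> 0 \<le> C \<and> R p \<rho> C" if p: "p \<in> closure \<Omega>" for p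
  proof -
    obtain e \<theta> \<rho> where c: "0 < \<theta>" "0 < \<rho>"
      "\<And>x r z. x \<in> \<Omega> \<inter> ball p \<rho> \<Longrightarrow> 0 \<le> r \<Longrightarrow> r \<le> 1 \<Longrightarrow> z \<in> ball e \<theta> \<Longrightarrow> x + r *\<^sub>R z \<in> \<Omega>"
      using cone p unfolding cone_condition_def by metis
    have "\<exists>C\<ge>0. R p \<rho> C" unfolding R_def
      by (rule local_sobolev[OF \<Omega>(1) _ _ _ c(1,3) s N q]) (use \<Omega> in \<open>auto intro: bounded_subset\<close>)
    then show ?thesis using c(2) by blast
  qed
  then obtain \<rho> C where R: "\<And>p. p \<in> closure \<Omega> \<Longrightarrow> 0 < \<rho> p \<and> 0 \<le> C p \<and> R p (\<rho> p) (C p)"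
    by metis
  then have \<rho>: "\<And>p. p \<in> closure \<Omega> \<Longrightarrow> 0 < \<rho> p" and C: "\<And>p. p \<in> closure \<Omega> \<Longrightarrow> 0 \<le> C p"
    "\<And>p f W L. p \<in> closure \<Omega> \<Longrightarrow> C1 f \<Longrightarrow> 0 \<le> W \<Longrightarrow> 0 \<le> L \<Longrightarrow>
     trace_powr q \<Omega> f = ennreal W \<Longrightarrow>
     trace_sq \<Omega> f = ennreal L \<Longrightarrow>
     trace_powr q (\<Omega> \<inter> ball p (\<rho> p)) f \<le> ennreal (C p * W powr (1 - 2 / q)) * (wenergy s \<Omega> f + ennreal L)"
    unfolding R_def by auto
  have "compact (closure \<Omega>)" using \<Omega> by (simp add: compact_closure)
  then obtain I where I: "I \<subseteq> closure \<Omega>" "finite I" "closure \<Omega> \<subseteq> (\<Union>p\<in>I. ball p (\<rho> p))"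
    by (rule compactE_image[where C = "closure \<Omega>" and f = "\<lambda>p. ball p (\<rho> p)"]) (use \<rho> in auto)
  obtain D where D: "0 \<le> D" "\<And>f. f \<in> T \<Longrightarrow> trace_sq \<Omega> f \<le> ennreal D * wenergy s \<Omega> f"
    using P unfolding energy_controlled_def by blast
  define K where "K = (\<Sum>p\<in>I. C p) * (1 + D)"
  have K: "0 \<le> K" unfolding K_def using D C(1) I by (intro mult_nonneg_nonneg sum_nonneg) auto
  show thesis
  proof (rule that[of "K powr (q / 2)"])
    fix f \<epsilon> assume f: "f \<in> T" and \<epsilon>: "0 \<le> (\<epsilon>::real)" and E: "wenergy s \<Omega> f \<le> ennreal \<epsilon>"
    have f1: "C1 f" using f T by blast
    have [measurable]: "f \<in> borel_measurable borel" using f1 by measurable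
    have Wf: "trace_powr q \<Omega> f < top"
      by (rule nn_integral_bounded_continuous_finite[OF C1_trace_continuous[OF f1] \<Omega>(2) _ qpos]) simp
    define W where "W = enn2real (trace_powr q \<Omega> f)"
    have W: "0 \<le> W" "trace_powr q \<Omega> f = ennreal W"
      using Wf by (auto simp: W_def)
    have Lle: "trace_sq \<Omega> f \<le> ennreal (D * \<epsilon>)"
      using D(2)[OF f] mult_left_mono[OF E, of "ennreal D"] D(1) \<epsilon> by (simp add: ennreal_mult)
    define L where "L = enn2real (trace_sq \<Omega> f)"
    have L: "0 \<le> L" "trace_sq \<Omega> f = ennreal L"
      using Lle by (auto simp: L_def ennreal_enn2real_if top_unique)
    have L': "L \<le> D * \<epsilon>" using Lle unfolding L(2) using D \<epsilon> by (simp add: ennreal_le_iff)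
    have "ennreal W = trace_powr q \<Omega> f" using W by simp
    also have "\<dots> \<le> (\<integral>\<^sup>+x. (\<Sum>p\<in>I. ennreal (\<bar>f (x, 0)\<bar> powr q) * indicator (\<Omega> \<inter> ball p (\<rho> p)) x) \<partial>lborel)"
    proof (intro nn_integral_mono)
      fix x
      show "ennreal (\<bar>f (x, 0)\<bar> powr q) * indicator \<Omega> x \<le> (\<Sum>p\<in>I. ennreal (\<bar>f (x, 0)\<bar> powr q) * indicator (\<Omega> \<inter> ball p (\<rho> p)) x)"
      proof (cases "x \<in> \<Omega>")
        case True
        then obtain p where p: "p \<in> I" "x \<in> ball p (\<rho> p)" using I closure_subset by blast
        have "ennreal (\<bar>f (x, 0)\<bar> powr q) * indicator (\<Omega> \<inter> ball p (\<rho> p)) x \<le>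
           (\<Sum>p\<in>I. ennreal (\<bar>f (x, 0)\<bar> powr q) * indicator (\<Omega> \<inter> ball p (\<rho> p)) x)"
          by (rule member_le_sum) (use p I in auto)
        then show ?thesis using True p by simp
      qed simp
    qed
    also have "\<dots> = (\<Sum>p\<in>I. trace_powr q (\<Omega> \<inter> ball p (\<rho> p)) f)"
    proof (rule nn_integral_sum)
      fix p
      have [measurable]: "\<Omega> \<inter> ball p (\<rho> p) \<in> sets borel" by auto
      show "(\<lambda>x. ennreal (\<bar>f (x, 0)\<bar> powr q) * indicator (\<Omega> \<inter> ball p (\<rho> p)) x) \<in> borel_measurable lborel"
        by (intro borel_measurable_times_ennreal borel_measurable_indicator) auto
    qed
    also have "\<dots> \<le> (\<Sum>p\<in>I. ennreal (C p * W powr (1 - 2 / q) * ((1 + D) * \<epsilon>)))"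
    proof (rule sum_mono)
      fix p assume "p \<in> I"
      then have p: "p \<in> closure \<Omega>" using I by auto
      have "trace_powr q (\<Omega> \<inter> ball p (\<rho> p)) f \<le> ennreal (C p * W powr (1 - 2 / q)) * (wenergy s \<Omega> f + ennreal L)"
        by (rule C(2)[OF p f1 W(1) L(1) W(2) L(2)])
      also have "\<dots> \<le> ennreal (C p * W powr (1 - 2 / q)) * (ennreal \<epsilon> + ennreal (D * \<epsilon>))"
        using L' by (intro mult_left_mono add_mono E ennreal_leI) auto
      also have "\<dots> = ennreal (C p * W powr (1 - 2 / q) * (\<epsilon> + D * \<epsilon>))"
        using C(1)[OF p] \<epsilon> D by (simp add: ennreal_mult ennreal_plus)
      finally show "trace_powr q (\<Omega> \<inter> ball p (\<rho> p)) f \<le> ennreal (C p * W powr (1 - 2 / q) * ((1 + D) * \<epsilon>))"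
        by (simp add: algebra_simps)
    qed
    also have "\<dots> = ennreal (\<Sum>p\<in>I. C p * W powr (1 - 2 / q) * ((1 + D) * \<epsilon>))"
      using C(1) I \<epsilon> D by (intro sum_ennreal) auto
    also have "(\<Sum>p\<in>I. C p * W powr (1 - 2 / q) * ((1 + D) * \<epsilon>)) = K * \<epsilon> * W powr (1 - 2 / q)"
      by (simp add: K_def sum_distrib_right sum_distrib_left mult_ac)
    finally have WK: "W \<le> K * \<epsilon> * W powr (1 - 2 / q)" using K \<epsilon> by (simp add: ennreal_le_iff)
    have "W \<le> K powr (q / 2) * \<epsilon> powr (q / 2)"
    proof (cases "W = 0")
      case False
      then have Wp: "0 < W" using W by simp
      have "W powr (2 / q) * W powr (1 - 2 / q) \<le> K * \<epsilon> * W powr (1 - 2 / q)"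
        using WK Wp by (simp add: powr_add[symmetric])
      then have "W powr (2 / q) \<le> K * \<epsilon>" using Wp by simp
      then have "(W powr (2 / q)) powr (q / 2) \<le> (K * \<epsilon>) powr (q / 2)"
        using qpos by (intro powr_mono2) auto
      then show ?thesis using qpos Wp K \<epsilon> by (simp add: powr_powr powr_mult)
    qed simp
    then show "trace_powr q \<Omega> f \<le> ennreal (K powr (q / 2) * \<epsilon> powr (q / 2))"
      unfolding W(2) by (rule ennreal_leI)
  qed simp
qed

section \<open>Compactness of the trace\<close>

lemma set_integrable_continuous_bounded:
  fixes u :: "'a::euclidean_space \<Rightarrow> real"
  assumes u: "continuous_on UNIV u" and A: "bounded A" "A \<in> sets borel"
  shows "set_integrable lborel A u"
proof -
  have "set_integrable lborel (closure A) u"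
    unfolding set_integrable_def using u A
    by (intro borel_integrable_compact) (auto simp: compact_closure intro: continuous_on_subset)
  then show ?thesis
    by (rule set_integrable_subset) (use A closure_subset in auto)
qed

lemma nn_integral_continuous_bounded:
  fixes u :: "'a::euclidean_space \<Rightarrow> real"
  assumes u: "continuous_on UNIV u" and A: "bounded A" "A \<in> sets borel" and nn: "\<And>x. 0 \<le> u x"
  shows "(\<integral>\<^sup>+x\<in>A. ennreal (u x) \<partial>lborel) = ennreal (LINT x:A|lborel. u x)"
proof -
  have "integrable lborel (\<lambda>x. indicator A x *\<^sub>R u x)"
    using set_integrable_continuous_bounded[OF u A] by (simp add: set_integrable_def)
  then have "(\<integral>\<^sup>+x. ennreal (indicator A x *\<^sub>R u x) \<partial>lborel) = ennreal (LINT x:A|lborel. u x)"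
    unfolding set_lebesgue_integral_def by (intro nn_integral_eq_integral) (auto simp: nn)
  moreover have "(\<integral>\<^sup>+x\<in>A. ennreal (u x) \<partial>lborel) = (\<integral>\<^sup>+x. ennreal (indicator A x *\<^sub>R u x) \<partial>lborel)"
    by (intro nn_integral_cong) (auto split: split_indicator)
  ultimately show ?thesis by simp
qed

text \<open>Jensen's inequality for the square, from its tangent line at the mean a, followed by the
  splitting of t into a and t - a.\<close>

lemma mean_square_bound:
  fixes w :: "'a::euclidean_space \<Rightarrow> real"
  assumes w: "continuous_on UNIV w" and B: "bounded B" "B \<in> sets borel" and \<beta>: "measure lborel B = \<beta>" "0 < \<beta>"
    and a: "a = (LINT y:B|lborel. w y) / \<beta>"
  shows "ennreal (t\<^sup>2) \<le> ennreal (2 / \<beta>) * (\<integral>\<^sup>+y\<in>B. ennreal ((w y - t)\<^sup>2) \<partial>lborel) + ennreal (2 * a\<^sup>2)"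
proof -
  have i1: "set_integrable lborel B (\<lambda>y. (w y - t)\<^sup>2)"
    by (rule set_integrable_continuous_bounded[OF _ B]) (intro continuous_intros w)
  have i2: "set_integrable lborel B w" by (rule set_integrable_continuous_bounded[OF w B])
  have i3: "set_integrable lborel B (\<lambda>y. c)" for c :: real
    by (rule set_integrable_continuous_bounded[OF _ B]) (intro continuous_intros)
  have c: "(LINT y:B|lborel. c) = \<beta> * c" for c :: real
    using \<beta>(1) B by (simp add: set_lebesgue_integral_def)
  have "\<beta> * ((a - t)\<^sup>2 - 2 * (a - t) * a) + 2 * (a - t) * (LINT y:B|lborel. w y) =
    (LINT y:B|lborel. ((a - t)\<^sup>2 - 2 * (a - t) * a) + 2 * (a - t) * w y)"
    using i2 i3 by (subst set_integral_add) (auto simp: c)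
  also have "\<dots> \<le> (LINT y:B|lborel. (w y - t)\<^sup>2)"
  proof (rule set_integral_mono)
    show "set_integrable lborel B (\<lambda>y. ((a - t)\<^sup>2 - 2 * (a - t) * a) + 2 * (a - t) * w y)"
      by (rule set_integrable_continuous_bounded[OF _ B]) (intro continuous_intros w)
    show "((a - t)\<^sup>2 - 2 * (a - t) * a) + 2 * (a - t) * w y \<le> (w y - t)\<^sup>2" for y
      using zero_le_power2[of "w y - a"] by (simp add: power2_eq_square algebra_simps)
  qed (rule i1)
  also have "(LINT y:B|lborel. w y) = \<beta> * a" using \<beta>(2) a by simp
  finally have "\<beta> * (a - t)\<^sup>2 \<le> (LINT y:B|lborel. (w y - t)\<^sup>2)" by (simp add: algebra_simps)
  then have "(a - t)\<^sup>2 \<le> (LINT y:B|lborel. (w y - t)\<^sup>2) / \<beta>" using \<beta> by (simp add: field_simps)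
  moreover have "t\<^sup>2 \<le> 2 * (a - t)\<^sup>2 + 2 * a\<^sup>2"
    using zero_le_power2[of "2 * a - t"] by (simp add: power2_eq_square algebra_simps)
  ultimately have "t\<^sup>2 \<le> (2 / \<beta>) * (LINT y:B|lborel. (w y - t)\<^sup>2) + 2 * a\<^sup>2" by (simp add: field_simps)
  then have "ennreal (t\<^sup>2) \<le> ennreal ((2 / \<beta>) * (LINT y:B|lborel. (w y - t)\<^sup>2) + 2 * a\<^sup>2)" by (rule ennreal_leI)
  also have "\<dots> = ennreal (2 / \<beta>) * ennreal (LINT y:B|lborel. (w y - t)\<^sup>2) + ennreal (2 * a\<^sup>2)"
  proof -
    have 0: "0 \<le> (LINT y:B|lborel. (w y - t)\<^sup>2)" unfolding set_lebesgue_integral_def by (rule integral_nonneg_AE) auto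
    then have "ennreal (2 / \<beta> * (LINT y:B|lborel. (w y - t)\<^sup>2)) = ennreal (2 / \<beta>) * ennreal (LINT y:B|lborel. (w y - t)\<^sup>2)"
      by (intro ennreal_mult) (use \<beta> in simp_all)
    moreover have "0 \<le> 2 / \<beta> * (LINT y:B|lborel. (w y - t)\<^sup>2)"
      using 0 \<beta> by simp
    ultimately show ?thesis by (simp only: ennreal_plus zero_le_power2 mult_nonneg_nonneg zero_le_numeral)
  qed
  also have "ennreal (LINT y:B|lborel. (w y - t)\<^sup>2) = (\<integral>\<^sup>+y\<in>B. ennreal ((w y - t)\<^sup>2) \<partial>lborel)"
    by (rule nn_integral_continuous_bounded[OF _ B, symmetric]) (auto intro!: continuous_intros w)
  finally show ?thesis .
qed

text \<open>The value at x is compared with the mean over one covering ball that contains x. Writing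
  y = x + h turns the mean into an integral over displacements shorter than 2 \<delta>, each handled
  by a translation estimate. Their volume is 2^N \<beta>, and the factor 2 / \<beta> makes this the
  power of 2 in the constant.\<close>

lemma oscillation_bound:
  fixes \<Omega> :: "'a::euclidean_space set" and c :: "nat \<Rightarrow> 'a"
  assumes f: "C1 f" and \<Omega>: "open \<Omega>" and K: "K \<subseteq> (\<Union>j<m. ball (c j) \<delta>)" "K \<in> sets borel" "K \<subseteq> \<Omega>"
    and sub: "\<And>j. j < m \<Longrightarrow> ball (c j) \<delta> \<subseteq> \<Omega>" and \<delta>: "0 < \<delta>" and s: "0 < s"
    and \<beta>: "\<beta> = measure lborel (ball (0::'a) \<delta>)"
    and a: "\<And>j. j < m \<Longrightarrow> \<bar>(LINT y:ball (c j) \<delta>|lborel. f (y, 0)) / \<beta>\<bar> \<le> \<alpha>"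
  shows "trace_sq K f \<le>
     ennreal (2 ^ (DIM('a) + 1) * ((12 / s + 6 * s) * (2 * \<delta>) powr (2 * s))) * wenergy s \<Omega> f + ennreal (2 * \<alpha>\<^sup>2) * emeasure lborel \<Omega>"
proof -
  have [measurable]: "f \<in> borel_measurable borel" using f by measurable
  have [measurable]: "\<Omega> \<in> sets borel" "K \<in> sets borel" using \<Omega> K by auto
  have \<beta>pos: "0 < \<beta>" using \<beta> \<delta> by simp
  have meas_ball: "measure lborel (ball (x::'a) \<delta>) = \<beta>" for x
    unfolding \<beta> using \<delta> by (simp add: content_ball)
  define B where "B j = ball (c j) \<delta>" for j
  have [measurable]: "B j \<in> sets borel" for j by (simp add: B_def)
  \<comment> \<open>The disjoint pieces \<open>P j\<close> keep the number of overlaps of the balls out of the constant.\<close>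
  define P where "P j = K \<inter> (B j - (\<Union>i<j. B i))" for j
  have [measurable]: "P j \<in> sets borel" for j unfolding P_def by measurable
  have Pex: "\<exists>j<m. x \<in> P j" if xK: "x \<in> K" for x
  proof -
    define j where "j = (LEAST j. x \<in> B j)"
    obtain i where i: "i < m" "x \<in> B i" using subsetD[OF K(1) xK] by (auto simp: B_def)
    have "x \<in> B j" unfolding j_def by (rule LeastI[of "\<lambda>j. x \<in> B j", OF i(2)])
    moreover have "j \<le> i" unfolding j_def by (rule Least_le[of "\<lambda>j. x \<in> B j", OF i(2)])
    moreover have "x \<notin> B k" if "k < j" for k using not_less_Least[of k "\<lambda>j. x \<in> B j"] that by (auto simp: j_def)
    ultimately show ?thesis using i xK by (auto simp: P_def intro!: exI[of _ j])
  qed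
  have Puniq: "i = j" if "x \<in> P i" "x \<in> P j" for i j x
    using that by (cases i j rule: linorder_cases) (auto simp: P_def)
  let ?D = "\<lambda>x h. ennreal ((f (x + h, 0) - f (x, 0))\<^sup>2)"
  \<comment> \<open>\<open>V h\<close> consists of the x whose selected ball also contains
    \<open>x + h\<close>; by convexity of that ball the whole segment stays in \<Omega>.\<close>
  define V where "V h = (\<Union>j<m. P j \<inter> (\<lambda>x. x + h) -` B j)" for h
  have vm: "(\<lambda>x. x + h) -` B j \<in> sets borel" for h j
    using measurable_sets_borel[of "\<lambda>x. x + h" borel "B j"] by simp
  have Vm: "V h \<in> sets borel" for h unfolding V_def
    by (intro sets.finite_UN sets.Int vm) auto
  have Vbound: "(\<integral>\<^sup>+x\<in>V h. ?D x h \<partial>lborel) \<le> ennreal ((12 / s + 6 * s) * (2 * \<delta>) powr (2 * s)) * wenergy s \<Omega> f * indicator (ball 0 (2 * \<delta>)) h" for h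
  proof (cases "h \<in> ball 0 (2 * \<delta>)")
    case True
    have "(\<integral>\<^sup>+x\<in>V h. ?D x h \<partial>lborel) \<le> ennreal ((12 / s + 6 * s) * (2 * \<delta>) powr (2 * s)) * wenergy s \<Omega> f"
    proof (rule translation_bound[OF f _ Vm _ _ s])
      show "V h \<subseteq> \<Omega>" using K by (auto simp: V_def P_def)
      fix x t assume x: "x \<in> V h" and t: "0 \<le> t" "t \<le> (1::real)"
      then obtain j where j: "j < m" "x \<in> B j" "x + h \<in> B j" by (auto simp: V_def P_def)
      have "(1 - t) *\<^sub>R x + t *\<^sub>R (x + h) \<in> B j"
        using j t convex_ball[of "c j" \<delta>] unfolding convex_alt B_def by blast
      then show "x + t *\<^sub>R h \<in> \<Omega>" using sub[OF j(1)] by (auto simp: B_def algebra_simps)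
    qed (use \<delta> True in auto)
    then show ?thesis using True by simp
  next
    case False
    have "V h = {}"
    proof (rule equals0I)
      fix x assume "x \<in> V h"
      then obtain j where j: "x \<in> B j" "x + h \<in> B j" by (auto simp: V_def P_def)
      then have "norm (x - c j) < \<delta>" "norm (x + h - c j) < \<delta>" by (auto simp: B_def dist_norm norm_minus_commute)
      then have "norm h < 2 * \<delta>" using norm_triangle_ineq4[of "x + h - c j" "x - c j"] by simp
      then show False using False by simp
    qed
    then show ?thesis by simp
  qed
  have pt: "ennreal ((f (x, 0))\<^sup>2) * indicator K x \<le>
      ennreal (2 / \<beta>) * (\<integral>\<^sup>+h. ?D x h * indicator (V h) x \<partial>lborel) + ennreal (2 * \<alpha>\<^sup>2) * indicator \<Omega> x" for x
  proof (cases "x \<in> K")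
    case True
    then obtain j where j: "j < m" "x \<in> P j" using Pex by blast
    define a0 where "a0 = (LINT y:B j|lborel. f (y, 0)) / \<beta>"
    have a0: "a0\<^sup>2 \<le> \<alpha>\<^sup>2" using a[OF j(1)] unfolding a0_def B_def by (metis abs_le_square_iff abs_ge_self order_trans)
    have "ennreal ((f (x, 0))\<^sup>2) \<le> ennreal (2 / \<beta>) * (\<integral>\<^sup>+y\<in>B j. ennreal ((f (y, 0) - f (x, 0))\<^sup>2) \<partial>lborel) + ennreal (2 * a0\<^sup>2)"
      by (rule mean_square_bound[OF C1_trace_continuous[OF f] _ _ _ \<beta>pos]) (auto simp: B_def a0_def meas_ball)
    also have "(\<integral>\<^sup>+y\<in>B j. ennreal ((f (y, 0) - f (x, 0))\<^sup>2) \<partial>lborel) = (\<integral>\<^sup>+h. ?D x h * indicator (B j) (h + x) \<partial>lborel)"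
      using nn_integral_translate[of "\<lambda>y. ennreal ((f (y, 0) - f (x, 0))\<^sup>2) * indicator (B j) y" x] by (simp add: add.commute)
    also have "\<dots> = (\<integral>\<^sup>+h. ?D x h * indicator (V h) x \<partial>lborel)"
    proof (intro nn_integral_cong arg_cong2[where f = "(*)"] refl)
      fix h
      have "x \<in> V h \<longleftrightarrow> x + h \<in> B j" using j Puniq unfolding V_def by auto
      then show "indicator (B j) (h + x) = (indicator (V h) x :: ennreal)" by (simp add: indicator_def add.commute)
    qed
    finally have "ennreal ((f (x, 0))\<^sup>2) \<le> ennreal (2 / \<beta>) * (\<integral>\<^sup>+h. ?D x h * indicator (V h) x \<partial>lborel) + ennreal (2 * a0\<^sup>2)" .
    also have "\<dots> \<le> ennreal (2 / \<beta>) * (\<integral>\<^sup>+h. ?D x h * indicator (V h) x \<partial>lborel) + ennreal (2 * \<alpha>\<^sup>2)"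
      using a0 by (intro add_left_mono ennreal_leI) simp
    finally show ?thesis using True K by auto
  qed simp
  \<comment> \<open>As a finite disjunction the indicator of the moving set \<open>V h\<close> is
    visibly measurable in x and h jointly.\<close>
  have indV: "indicator (V h) x = (if \<exists>j\<in>{..<m}. x \<in> P j \<and> x + h \<in> B j then 1 else (0::ennreal))" for h x
    unfolding V_def by (auto simp: indicator_def)
  have jm: "(\<lambda>(x, h). ?D x h * indicator (V h) x) \<in> borel_measurable (lborel \<Otimes>\<^sub>M lborel)"
    unfolding indV by measurable
  have "trace_sq K f \<le>
     (\<integral>\<^sup>+x. ennreal (2 / \<beta>) * (\<integral>\<^sup>+h. ?D x h * indicator (V h) x \<partial>lborel) + ennreal (2 * \<alpha>\<^sup>2) * indicator \<Omega> x \<partial>lborel)"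
    by (intro nn_integral_mono pt)
  also have "\<dots> = ennreal (2 / \<beta>) * (\<integral>\<^sup>+x. (\<integral>\<^sup>+h. ?D x h * indicator (V h) x \<partial>lborel) \<partial>lborel) + ennreal (2 * \<alpha>\<^sup>2) * emeasure lborel \<Omega>"
  proof -
    have [measurable]: "(\<lambda>x. \<integral>\<^sup>+h. ?D x h * indicator (V h) x \<partial>lborel) \<in> borel_measurable lborel"
      using lborel.borel_measurable_nn_integral_fst[OF jm] by simp
    show ?thesis by (simp add: nn_integral_add nn_integral_cmult nn_integral_cmult_indicator)
  qed
  also have "(\<integral>\<^sup>+x. (\<integral>\<^sup>+h. ?D x h * indicator (V h) x \<partial>lborel) \<partial>lborel) = (\<integral>\<^sup>+h. (\<integral>\<^sup>+x. ?D x h * indicator (V h) x \<partial>lborel) \<partial>lborel)"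
    by (rule lborel_pair.Fubini'[symmetric]) (rule jm)
  also have "ennreal (2 / \<beta>) * (\<integral>\<^sup>+h. (\<integral>\<^sup>+x. ?D x h * indicator (V h) x \<partial>lborel) \<partial>lborel) + ennreal (2 * \<alpha>\<^sup>2) * emeasure lborel \<Omega> \<le>
     ennreal (2 / \<beta>) * (\<integral>\<^sup>+h. ennreal ((12 / s + 6 * s) * (2 * \<delta>) powr (2 * s)) * wenergy s \<Omega> f * indicator (ball 0 (2 * \<delta>)) (h::'a) \<partial>lborel) + ennreal (2 * \<alpha>\<^sup>2) * emeasure lborel \<Omega>"
    by (intro add_right_mono mult_left_mono nn_integral_mono Vbound) simp
  also have "(\<integral>\<^sup>+h. ennreal ((12 / s + 6 * s) * (2 * \<delta>) powr (2 * s)) * wenergy s \<Omega> f * indicator (ball 0 (2 * \<delta>)) (h::'a) \<partial>lborel) =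
     ennreal ((12 / s + 6 * s) * (2 * \<delta>) powr (2 * s)) * wenergy s \<Omega> f * ennreal (2 ^ DIM('a) * \<beta>)"
  proof -
    have "emeasure lborel (ball (0::'a) (2 * \<delta>)) = ennreal (measure lborel (ball (0::'a) (2 * \<delta>)))"
      using emeasure_lborel_ball_finite[of "0::'a" "2 * \<delta>"] by (intro emeasure_eq_ennreal_measure) auto
    also have "measure lborel (ball (0::'a) (2 * \<delta>)) = 2 ^ DIM('a) * \<beta>"
      unfolding \<beta> using \<delta> by (simp add: content_ball power_mult_distrib)
    finally show ?thesis by (simp add: nn_integral_cmult_indicator)
  qed
  also have "ennreal (2 / \<beta>) * (ennreal ((12 / s + 6 * s) * (2 * \<delta>) powr (2 * s)) * wenergy s \<Omega> f * ennreal (2 ^ DIM('a) * \<beta>)) =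
     (ennreal (2 / \<beta>) * ennreal ((12 / s + 6 * s) * (2 * \<delta>) powr (2 * s)) * ennreal (2 ^ DIM('a) * \<beta>)) * wenergy s \<Omega> f"
    by (simp only: mult_ac)
  also have "ennreal (2 / \<beta>) * ennreal ((12 / s + 6 * s) * (2 * \<delta>) powr (2 * s)) * ennreal (2 ^ DIM('a) * \<beta>) =
     ennreal (2 / \<beta> * ((12 / s + 6 * s) * (2 * \<delta>) powr (2 * s)) * (2 ^ DIM('a) * \<beta>))"
  proof -
    have "ennreal x * ennreal y * ennreal z = ennreal (x * y * z)" if "0 \<le> x" "0 \<le> y" "0 \<le> z" for x y z
      using that by (simp add: ennreal_mult)
    then show ?thesis using \<beta>pos s by (auto intro!: mult_nonneg_nonneg)
  qed
  also have "2 / \<beta> * ((12 / s + 6 * s) * (2 * \<delta>) powr (2 * s)) * (2 ^ DIM('a) * \<beta>) = 2 ^ (DIM('a) + 1) * ((12 / s + 6 * s) * (2 * \<delta>) powr (2 * s))"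
    using \<beta>pos by simp
  finally show ?thesis .
qed

lemma compact_inner_approximation:
  fixes \<Omega> :: "'a::euclidean_space set"
  assumes \<Omega>: "open \<Omega>" "bounded \<Omega>" and \<epsilon>: "0 < \<epsilon>"
  obtains K where "compact K" "K \<subseteq> \<Omega>" "emeasure lborel (\<Omega> - K) < ennreal \<epsilon>"
proof -
  have "\<Omega> \<in> sets lebesgue" using \<Omega> by simp
  from sets_lebesgue_inner_closed[OF this \<epsilon>] obtain K where K: "closed K" "K \<subseteq> \<Omega>" "emeasure lebesgue (\<Omega> - K) < ennreal \<epsilon>"
    by metis
  have "compact K" using K \<Omega> by (meson bounded_subset compact_eq_bounded_closed)
  moreover have "emeasure lborel (\<Omega> - K) < ennreal \<epsilon>" using K \<Omega> by (simp add: borel_open borel_closed)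
  ultimately show thesis using that K by blast
qed

lemma square_le_power_split:
  fixes a R q :: real
  assumes "0 < R" "2 < q"
  shows "a\<^sup>2 \<le> R powr (2 - q) * \<bar>a\<bar> powr q + R\<^sup>2"
proof (cases "\<bar>a\<bar> \<le> R")
  case True
  then have "a\<^sup>2 \<le> R\<^sup>2" using assms by (simp add: abs_le_square_iff[symmetric])
  then show ?thesis by (simp add: add_increasing)
next
  case False
  then have p: "0 < \<bar>a\<bar>" using assms by simp
  have "a\<^sup>2 = \<bar>a\<bar> powr (2 - q) * \<bar>a\<bar> powr q"
    using p by (simp add: powr_add[symmetric] powr_numeral)
  also have "\<dots> \<le> R powr (2 - q) * \<bar>a\<bar> powr q"
    using False assms by (intro mult_right_mono powr_mono2') auto
  finally show ?thesis by (simp add: add_increasing2)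
qed

text \<open>Centres come from D, in the application a countable set, and radii are reciprocals of
  integers, so only countably many averages have to be made convergent. The numbering of the centres
  permits a disjoint refinement.\<close>

lemma finite_ball_cover:
  fixes K :: "'a::euclidean_space set"
  assumes K: "compact K" "K \<subseteq> \<Omega>" "open \<Omega>" and D: "\<And>X. open X \<Longrightarrow> X \<noteq> {} \<Longrightarrow> \<exists>d\<in>D. d \<in> X"
  obtains i0 where "\<And>i. i0 \<le> i \<Longrightarrow> \<exists>c (m::nat). (\<forall>j<m. c j \<in> D \<and> ball (c j) (1 / Suc i) \<subseteq> \<Omega>) \<and> K \<subseteq> (\<Union>j<m. ball (c j) (1 / Suc i))"
proof -
  obtain d where d: "0 < d" "(\<Union>x\<in>K. ball x d) \<subseteq> \<Omega>"
    using compact_subset_open_imp_ball_epsilon_subset[OF K(1,3,2)] by blast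
  obtain i0 where i0: "2 / real (Suc i0) < d"
  proof -
    obtain n where "2 / d < real n" using reals_Archimedean2 by blast
    then have "2 / real (Suc n) < d" using d by (simp add: field_simps)
    then show thesis using that by blast
  qed
  have "\<exists>c (m::nat). (\<forall>j<m. c j \<in> D \<and> ball (c j) (1 / Suc i) \<subseteq> \<Omega>) \<and> K \<subseteq> (\<Union>j<m. ball (c j) (1 / Suc i))" if i: "i0 \<le> i" for i
  proof -
    define \<delta> where "\<delta> = 1 / real (Suc i)"
    have "2 * \<delta> \<le> 2 / real (Suc i0)" unfolding \<delta>_def using i by (simp add: frac_le)
    then have \<delta>: "0 < \<delta>" "2 * \<delta> \<le> d" using i0 by (auto simp: \<delta>_def)
    let ?D = "{c \<in> D. ball c \<delta> \<subseteq> \<Omega>}"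
    have cov: "K \<subseteq> (\<Union>c\<in>?D. ball c \<delta>)"
    proof
      fix x assume x: "x \<in> K"
      obtain c where c: "c \<in> D" "c \<in> ball x \<delta>" using D[of "ball x \<delta>"] \<delta> by auto
      have "ball c \<delta> \<subseteq> ball x d"
      proof
        fix y assume "y \<in> ball c \<delta>"
        then have "dist x y < 2 * \<delta>" using c dist_triangle[of x y c] by simp
        then show "y \<in> ball x d" using \<delta> by simp
      qed
      then have "ball c \<delta> \<subseteq> \<Omega>" using d x by blast
      then show "x \<in> (\<Union>c\<in>?D. ball c \<delta>)" using c by (auto simp: dist_commute)
    qed
    obtain I where I: "I \<subseteq> ?D" "finite I" "K \<subseteq> (\<Union>c\<in>I. ball c \<delta>)"
      using compactE_image[OF K(1), of ?D "\<lambda>c. ball c \<delta>"] cov by auto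
    obtain c m where "I = c ` {i::nat. i < m}" using finite_imp_nat_seg_image_inj_on[OF I(2)] by blast
    then show ?thesis using I unfolding \<delta>_def
      by (intro exI[of _ c] exI[of _ m]) (auto simp: subset_iff)
  qed
  then show thesis using that by blast
qed

text \<open>A Kolmogorov-Riesz argument for differences. One diagonal subsequence works for all
  \<epsilon>, because the averages over a countable family of balls are made convergent before
  \<epsilon> is given.\<close>

lemma trace_compactness:
  fixes \<Omega> :: "'a::euclidean_space set" and \<phi> :: "nat \<Rightarrow> 'a \<times> real \<Rightarrow> real"
  assumes \<Omega>: "open \<Omega>" "bounded \<Omega>" and s: "0 < s"
    and \<phi>: "\<And>n. C1 (\<phi> n)" "\<And>m n. C1 (\<lambda>p. \<phi> m p - \<phi> n p)"
    and E: "0 \<le> M" "\<And>m n. wenergy s \<Omega> (\<lambda>p. \<phi> m p - \<phi> n p) \<le> ennreal M"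
    and W: "2 < q" "0 \<le> S" "\<And>m n. (\<integral>\<^sup>+x\<in>\<Omega>. ennreal (\<bar>\<phi> m (x, 0) - \<phi> n (x, 0)\<bar> powr q) \<partial>lborel) \<le> ennreal S"
    and L1: "\<And>n. (LINT x:\<Omega>|lborel. \<bar>\<phi> n (x, 0)\<bar>) \<le> \<Lambda>"
  obtains k :: "nat \<Rightarrow> nat" where "strict_mono k"
    "\<And>\<epsilon>. 0 < \<epsilon> \<Longrightarrow> \<exists>n0. \<forall>m\<ge>n0. \<forall>n\<ge>n0. (\<integral>\<^sup>+x\<in>\<Omega>. ennreal ((\<phi> (k m) (x, 0) - \<phi> (k n) (x, 0))\<^sup>2) \<partial>lborel) \<le> ennreal \<epsilon>"
proof -
  have [measurable]: "\<Omega> \<in> sets borel" using \<Omega> by simp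
  have cont: "continuous_on UNIV (\<lambda>x. \<phi> n (x, 0))" for n by (rule C1_trace_continuous[OF \<phi>(1)])
  obtain D :: "'a set" where D: "countable D" "\<And>X. open X \<Longrightarrow> X \<noteq> {} \<Longrightarrow> \<exists>d\<in>D. d \<in> X"
    using countable_dense_exists by metis
  \<comment> \<open>The intersection with \<Omega> keeps the integrals bounded by \<Lambda> for
    every centre and radius; for the balls of the cover it is the ball itself. Division by the
    volume \<beta> is postponed.\<close>
  define A where "A n x = (LINT y:\<Omega> \<inter> ball (fst x) (1 / Suc (snd x))|lborel. \<phi> n (y, 0))" for n and x :: "'a \<times> nat"
  have bA: "norm (A n x) \<le> \<Lambda>" for n x
  proof -
    have "norm (A n x) \<le> (LINT y:\<Omega> \<inter> ball (fst x) (1 / Suc (snd x))|lborel. norm (\<phi> n (y, 0)))"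
      unfolding A_def by (intro set_integral_norm_bound set_integrable_continuous_bounded[OF cont])
        (use \<Omega> in \<open>auto intro: bounded_subset\<close>)
    also have "\<dots> \<le> (LINT y:\<Omega>|lborel. \<bar>\<phi> n (y, 0)\<bar>)"
      unfolding set_lebesgue_integral_def
    proof (rule integral_mono)
      show "integrable lborel (\<lambda>x. indicator \<Omega> x *\<^sub>R \<bar>\<phi> n (x, 0)\<bar>)"
        using set_integrable_continuous_bounded[OF continuous_on_rabs[OF cont], of \<Omega> n] \<Omega>
        by (simp add: set_integrable_def)
      show "integrable lborel (\<lambda>xa. indicator (\<Omega> \<inter> ball (fst x) (1 / real (Suc (snd x)))) xa *\<^sub>R norm (\<phi> n (xa, 0)))"
        using set_integrable_continuous_bounded[OF continuous_on_rabs[OF cont], of "\<Omega> \<inter> ball (fst x) (1 / real (Suc (snd x)))" n] \<Omega>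
        by (simp add: set_integrable_def bounded_Int)
    qed (auto split: split_indicator)
    finally show ?thesis using L1[of n] by simp
  qed
  have "countable (D \<times> (UNIV::nat set))" using D by auto
  then obtain k where k: "strict_mono k" "\<And>x. x \<in> D \<times> UNIV \<Longrightarrow> \<exists>l. (\<lambda>n. A (k n) x) \<longlonglongrightarrow> l"
    using function_convergent_subsequence[of "D \<times> UNIV" A \<Lambda>] bA by metis
  show thesis
  proof (rule that[OF k(1)])
    fix \<epsilon> :: real assume \<epsilon>: "0 < \<epsilon>"
    \<comment> \<open>The choices are made in the order R, K, i, n1, each responsible for \<epsilon>
      / 4. Values above R are paid by the critical bound S, values up to R by the thinness of the
      layer \<Omega> - K, the oscillation at scale 1 / (i + 1) by the energy, and the averages by
      n1.\<close>
    define R where "R = (\<epsilon> / (4 * (S + 1))) powr (1 / (2 - q))"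
    have R: "0 < R" "R powr (2 - q) * S \<le> \<epsilon> / 4"
    proof -
      have "R powr (2 - q) = \<epsilon> / (4 * (S + 1))" unfolding R_def using W \<epsilon> by (simp add: powr_powr)
      moreover have "\<epsilon> / (4 * (S + 1)) * S \<le> \<epsilon> / 4" using W(2) \<epsilon> by (simp add: field_simps)
      ultimately show "R powr (2 - q) * S \<le> \<epsilon> / 4" by simp
    qed (use W \<epsilon> in \<open>simp add: R_def\<close>)
    obtain K where K: "compact K" "K \<subseteq> \<Omega>" "emeasure lborel (\<Omega> - K) < ennreal (\<epsilon> / (4 * R\<^sup>2))"
      using compact_inner_approximation[OF \<Omega>, of "\<epsilon> / (4 * R\<^sup>2)"] \<epsilon> R by auto
    have [measurable]: "K \<in> sets borel" using K by (simp add: borel_compact)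
    obtain i0 where i0: "\<And>i. i0 \<le> i \<Longrightarrow> \<exists>c (m::nat). (\<forall>j<m. c j \<in> D \<and> ball (c j) (1 / Suc i) \<subseteq> \<Omega>) \<and> K \<subseteq> (\<Union>j<m. ball (c j) (1 / Suc i))"
      using finite_ball_cover[OF K(1,2) \<Omega>(1) D(2)] by blast
    define C where "C = 2 ^ (DIM('a) + 1) * (12 / s + 6 * s)"
    have C: "0 < C" using s by (simp add: C_def add_pos_pos)
    have "(\<lambda>i. C * (2 * (1 / real (Suc i))) powr (2 * s) * M) \<longlonglongrightarrow> C * (2 * 0) powr (2 * s) * M"
      using s by (intro tendsto_intros LIMSEQ_Suc[OF lim_1_over_n] tendsto_powr') (auto intro!: LIMSEQ_Suc[OF lim_1_over_n])
    then have "(\<lambda>i. C * (2 * (1 / real (Suc i))) powr (2 * s) * M) \<longlonglongrightarrow> 0" by simp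
    then have "\<forall>\<^sub>F i in sequentially. C * (2 * (1 / real (Suc i))) powr (2 * s) * M < \<epsilon> / 4"
      using \<epsilon> by (intro order_tendstoD) auto
    then obtain i1 where i1: "\<And>i. i1 \<le> i \<Longrightarrow> C * (2 * (1 / real (Suc i))) powr (2 * s) * M < \<epsilon> / 4"
      unfolding eventually_sequentially by blast
    define i where "i = max i0 i1"
    define \<delta> where "\<delta> = 1 / real (Suc i)"
    have \<delta>: "0 < \<delta>" "C * (2 * \<delta>) powr (2 * s) * M < \<epsilon> / 4" using i1[of i] by (auto simp: \<delta>_def i_def)
    obtain c and m :: nat where c: "\<And>j. j < m \<Longrightarrow> c j \<in> D" "\<And>j. j < m \<Longrightarrow> ball (c j) \<delta> \<subseteq> \<Omega>" "K \<subseteq> (\<Union>j<m. ball (c j) \<delta>)"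
    proof -
      have "i0 \<le> i" by (simp add: i_def)
      from i0[OF this] obtain c and m :: nat where "(\<forall>j<m. c j \<in> D \<and> ball (c j) \<delta> \<subseteq> \<Omega>) \<and> K \<subseteq> (\<Union>j<m. ball (c j) \<delta>)"
        unfolding \<delta>_def[symmetric] by blast
      then show thesis by (intro that[of m c]) auto
    qed
    define \<beta> where "\<beta> = measure lborel (ball (0::'a) \<delta>)"
    have \<beta>: "0 < \<beta>" using \<delta> by (simp add: \<beta>_def)
    define \<mu> where "\<mu> = measure lborel \<Omega>"
    have \<mu>: "emeasure lborel \<Omega> = ennreal \<mu>" "0 \<le> \<mu>"
      unfolding \<mu>_def using emeasure_bounded_finite[OF \<Omega>(2)] by (auto intro!: emeasure_eq_ennreal_measure)
    define \<alpha> where "\<alpha> = sqrt (\<epsilon> / (8 * (\<mu> + 1)))"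
    have \<alpha>: "0 < \<alpha>" "2 * \<alpha>\<^sup>2 * \<mu> \<le> \<epsilon> / 4"
      using \<epsilon> \<mu> by (auto simp: \<alpha>_def field_simps)
    have "\<exists>n0. \<forall>m\<ge>n0. \<forall>n\<ge>n0. \<bar>A (k m) (c j, i) - A (k n) (c j, i)\<bar> < \<alpha> * \<beta>" if j: "j < m" for j
    proof -
      have "Cauchy (\<lambda>n. A (k n) (c j, i))"
        using k(2)[of "(c j, i)"] c(1)[OF j] by (auto intro: LIMSEQ_imp_Cauchy)
      then show ?thesis using \<alpha> \<beta> unfolding Cauchy_def dist_real_def by simp
    qed
    then obtain n0 where n0: "\<And>j m' n. j < m \<Longrightarrow> n0 j \<le> m' \<Longrightarrow> n0 j \<le> n \<Longrightarrow> \<bar>A (k m') (c j, i) - A (k n) (c j, i)\<bar> < \<alpha> * \<beta>"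
      by metis
    define n1 where "n1 = Max (insert 0 (n0 ` {..<m}))"
    have n1: "n0 j \<le> n1" if "j < m" for j unfolding n1_def using that by (intro Max_ge) auto
    show "\<exists>n0. \<forall>m\<ge>n0. \<forall>n\<ge>n0. (\<integral>\<^sup>+x\<in>\<Omega>. ennreal ((\<phi> (k m) (x, 0) - \<phi> (k n) (x, 0))\<^sup>2) \<partial>lborel) \<le> ennreal \<epsilon>"
    proof (intro exI[of _ n1] allI impI)
      fix m' n assume mn: "n1 \<le> m'" "n1 \<le> n"
      define f where "f p = \<phi> (k m') p - \<phi> (k n) p" for p
      have f: "C1 f" unfolding f_def[abs_def] by (rule \<phi>(2))
      have [measurable]: "f \<in> borel_measurable borel" using f by measurable
      have Ef: "wenergy s \<Omega> f \<le> ennreal M" unfolding f_def[abs_def] by (rule E(2))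
      have Wf: "trace_powr q \<Omega> f \<le> ennreal S" unfolding f_def by (rule W(3))
      have avg: "\<bar>(LINT y:ball (c j) \<delta>|lborel. f (y, 0)) / \<beta>\<bar> \<le> \<alpha>" if j: "j < m" for j
      proof -
        have "(LINT y:ball (c j) \<delta>|lborel. f (y, 0)) = A (k m') (c j, i) - A (k n) (c j, i)"
          unfolding f_def A_def fst_conv snd_conv \<delta>_def[symmetric] Int_absorb1[OF c(2)[OF j]]
          by (intro set_integral_diff set_integrable_continuous_bounded cont) auto
        then have "\<bar>LINT y:ball (c j) \<delta>|lborel. f (y, 0)\<bar> < \<alpha> * \<beta>"
          using n0[OF j, of m' n] n1[OF j] mn by simp
        then show ?thesis using \<beta> by (simp add: field_simps)
      qed
      have K1: "trace_sq K f \<le> ennreal (\<epsilon> / 2)"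
      proof -
        have "trace_sq K f \<le>
           ennreal (2 ^ (DIM('a) + 1) * ((12 / s + 6 * s) * (2 * \<delta>) powr (2 * s))) * wenergy s \<Omega> f + ennreal (2 * \<alpha>\<^sup>2) * emeasure lborel \<Omega>"
          by (rule oscillation_bound[OF f \<Omega>(1) c(3) _ K(2) c(2) \<delta>(1) s \<beta>_def avg]) simp_all
        also have "\<dots> \<le> ennreal (C * (2 * \<delta>) powr (2 * s)) * ennreal M + ennreal (2 * \<alpha>\<^sup>2) * ennreal \<mu>"
          unfolding C_def \<mu>(1) by (intro add_right_mono mult_mono Ef) (auto simp: mult.assoc)
        also have "\<dots> = ennreal (C * (2 * \<delta>) powr (2 * s) * M + 2 * \<alpha>\<^sup>2 * \<mu>)"
          using C E(1) \<mu>(2) by (simp add: ennreal_mult[symmetric] ennreal_plus[symmetric] del: ennreal_plus)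
        also have "\<dots> \<le> ennreal (\<epsilon> / 2)" using \<delta>(2) \<alpha>(2) by (intro ennreal_leI) simp
        finally show ?thesis .
      qed
      have K2: "trace_sq (\<Omega> - K) f \<le> ennreal (\<epsilon> / 2)"
      proof -
        have "trace_sq (\<Omega> - K) f \<le>
          (\<integral>\<^sup>+x. ennreal (R powr (2 - q)) * (ennreal (\<bar>f (x, 0)\<bar> powr q) * indicator \<Omega> x) + ennreal (R\<^sup>2) * indicator (\<Omega> - K) x \<partial>lborel)"
        proof (intro nn_integral_mono)
          fix x
          have "ennreal ((f (x, 0))\<^sup>2) \<le> ennreal (R powr (2 - q) * \<bar>f (x, 0)\<bar> powr q + R\<^sup>2)"
            by (intro ennreal_leI square_le_power_split R W)
          then show "ennreal ((f (x, 0))\<^sup>2) * indicator (\<Omega> - K) x \<le>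
              ennreal (R powr (2 - q)) * (ennreal (\<bar>f (x, 0)\<bar> powr q) * indicator \<Omega> x) + ennreal (R\<^sup>2) * indicator (\<Omega> - K) x"
            by (auto split: split_indicator simp: ennreal_mult ennreal_plus)
        qed
        also have "\<dots> = ennreal (R powr (2 - q)) * trace_powr q \<Omega> f + ennreal (R\<^sup>2) * emeasure lborel (\<Omega> - K)"
          by (simp add: nn_integral_add nn_integral_cmult nn_integral_cmult_indicator)
        also have "\<dots> \<le> ennreal (R powr (2 - q)) * ennreal S + ennreal (R\<^sup>2) * ennreal (\<epsilon> / (4 * R\<^sup>2))"
          using K(3) by (intro add_mono mult_left_mono Wf) auto
        also have "\<dots> = ennreal (R powr (2 - q) * S + R\<^sup>2 * (\<epsilon> / (4 * R\<^sup>2)))"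
          using W(2) \<epsilon> by (simp add: ennreal_mult[symmetric] ennreal_plus[symmetric] del: ennreal_plus)
        also have "R\<^sup>2 * (\<epsilon> / (4 * R\<^sup>2)) = \<epsilon> / 4" using R by simp
        also have "ennreal (R powr (2 - q) * S + \<epsilon> / 4) \<le> ennreal (\<epsilon> / 2)" using R by (intro ennreal_leI) simp
        finally show ?thesis .
      qed
      have "trace_sq \<Omega> f =
        (\<integral>\<^sup>+x. ennreal ((f (x, 0))\<^sup>2) * indicator K x + ennreal ((f (x, 0))\<^sup>2) * indicator (\<Omega> - K) x \<partial>lborel)"
        using K(2) by (intro nn_integral_cong) (auto split: split_indicator)
      also have "\<dots> = trace_sq K f + trace_sq (\<Omega> - K) f"
        by (rule nn_integral_add) measurable
      also have "\<dots> \<le> ennreal (\<epsilon> / 2) + ennreal (\<epsilon> / 2)" by (intro add_mono K1 K2)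
      also have "\<dots> = ennreal \<epsilon>" using \<epsilon> by (simp add: ennreal_plus[symmetric] del: ennreal_plus)
      finally show "(\<integral>\<^sup>+x\<in>\<Omega>. ennreal ((\<phi> (k m') (x, 0) - \<phi> (k n) (x, 0))\<^sup>2) \<partial>lborel) \<le> ennreal \<epsilon>"
        by (simp add: f_def)
    qed
  qed
qed

section \<open>Test functions\<close>

lemma frechet_derivative_lincomb:
  fixes f g :: "'b::euclidean_space \<Rightarrow> real"
  assumes "f differentiable at x" "g differentiable at x"
  shows "frechet_derivative (\<lambda>x. a * f x + b * g x) (at x) = (\<lambda>v. a * frechet_derivative f (at x) v + b * frechet_derivative g (at x) v)"
proof -
  have "((\<lambda>x. a * f x + b * g x) has_derivative (\<lambda>v. a * frechet_derivative f (at x) v + b * frechet_derivative g (at x) v)) (at x)"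
    using assms unfolding frechet_derivative_works
    by (intro has_derivative_add has_derivative_mult_right)
  then show ?thesis by (rule frechet_derivative_at[symmetric])
qed

lemma Ck_on_lincomb:
  fixes f g :: "'b::euclidean_space \<Rightarrow> real"
  shows "Ck_on k UNIV f \<Longrightarrow> Ck_on k UNIV g \<Longrightarrow> Ck_on k UNIV (\<lambda>x. a * f x + b * g x)"
proof (induction k arbitrary: f g)
  case 0
  then show ?case by (auto intro!: continuous_intros)
next
  case (Suc k)
  have d: "f differentiable at x" "g differentiable at x" for x using Suc.prems by auto
  show ?case
    unfolding Ck_on.simps(2) frechet_derivative_lincomb[OF d]
  proof (intro conjI ballI)
    show "continuous_on UNIV (\<lambda>x. a * f x + b * g x)" using Suc.prems by (auto intro!: continuous_intros)
    show "(\<lambda>x. a * f x + b * g x) differentiable at x" for x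
      by (intro differentiable_add differentiable_mult differentiable_const d)
    show "Ck_on k UNIV (\<lambda>x. a * frechet_derivative f (at x) i + b * frechet_derivative g (at x) i)" if "i \<in> Basis" for i
      using Suc.prems that by (intro Suc.IH) auto
  qed
qed

lemma test_fun_lincomb:
  assumes f: "test_fun \<Omega> \<Sigma> f" and g: "test_fun \<Omega> \<Sigma> g"
  shows "test_fun \<Omega> \<Sigma> (\<lambda>p. a * f p + b * g p)"
proof -
  let ?S = "\<lambda>f. closure {q \<in> closure \<Omega> \<times> {0..}. f q \<noteq> 0}"
  have "?S (\<lambda>p. a * f p + b * g p) \<subseteq> closure ({q \<in> closure \<Omega> \<times> {0..}. f q \<noteq> 0} \<union> {q \<in> closure \<Omega> \<times> {0..}. g q \<noteq> 0})"
    by (intro closure_mono) auto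
  then have sub: "?S (\<lambda>p. a * f p + b * g p) \<subseteq> ?S f \<union> ?S g" by (simp add: closure_Un)
  have "compact (?S f \<union> ?S g)" using f g by (intro compact_Un) (auto simp: test_fun_def)
  then have "compact ((?S f \<union> ?S g) \<inter> ?S (\<lambda>p. a * f p + b * g p))" by (rule compact_Int_closed) simp
  then have "compact (?S (\<lambda>p. a * f p + b * g p))" using sub by (simp add: Int_absorb1)
  moreover have "?S (\<lambda>p. a * f p + b * g p) \<subseteq> (\<Omega> \<union> \<Sigma>) \<times> {0..}"
    using sub f g unfolding test_fun_def by blast
  moreover have "Cinf_on UNIV (\<lambda>p. a * f p + b * g p)"
    using f g unfolding test_fun_def Cinf_on_def by (blast intro: Ck_on_lincomb)
  ultimately show ?thesis by (simp add: test_fun_def)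
qed

lemma test_fun_C1: "test_fun \<Omega> \<Sigma> f \<Longrightarrow> C1 f"
  by (simp add: test_fun_def Cinf_on_imp_C1)

text \<open>The Dirichlet condition in the form used by the estimates: pointwise and at every
  height, not merely for the trace.\<close>

lemma test_fun_vanishes:
  assumes "test_fun \<Omega> \<Sigma> f" "b \<in> closure \<Omega>" "b \<notin> \<Omega> \<union> \<Sigma>" "0 \<le> y"
  shows "f (b, y) = 0"
proof (rule ccontr)
  assume "f (b, y) \<noteq> 0"
  then have "(b, y) \<in> closure {q \<in> closure \<Omega> \<times> {0..}. f q \<noteq> 0}"
    using assms by (intro closure_subset[THEN subsetD]) auto
  then show False using assms unfolding test_fun_def by blast
qed

section \<open>Finiteness and quadratic structure of the energy\<close>

lemma grad2_zero_open:
  assumes "open U" "p \<in> U" "\<And>q. q \<in> U \<Longrightarrow> f q = 0"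
  shows "grad2 f p = 0"
proof -
  have "(f has_derivative (\<lambda>v. 0)) (at p)"
    by (rule has_derivative_transform_within_open[OF has_derivative_const assms(1,2)]) (use assms in auto)
  then have "frechet_derivative f (at p) = (\<lambda>v. 0)" by (metis frechet_derivative_at)
  then show ?thesis by (simp add: grad2_def)
qed

text \<open>On the compact support the gradient and the height are bounded, and s < 1 makes the
  weight integrable down to height 0.\<close>

lemma wenergy_finite:
  assumes f: "test_fun \<Omega> \<Sigma> f" and \<Omega>: "open \<Omega>" "bounded \<Omega>" and s: "s < 1"
  shows "wenergy s \<Omega> f < top"
proof -
  have f1: "C1 f" using f by (rule test_fun_C1)
  have [measurable]: "\<Omega> \<in> sets borel" "grad2 f \<in> borel_measurable borel" using \<Omega> f1 by (auto, measurable)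
  define S where "S = closure {q \<in> closure \<Omega> \<times> {0..}. f q \<noteq> 0}"
  have S: "compact S" "closed S" using f by (auto simp: S_def test_fun_def)
  obtain R where R: "\<And>p. p \<in> S \<Longrightarrow> norm p \<le> R" using S(1) compact_imp_bounded bounded_iff by metis
  have "compact (grad2 f ` S)" using S C1_continuous_grad2[OF f1]
    by (intro compact_continuous_image) (auto intro: continuous_on_subset)
  then obtain G where G: "\<And>p. p \<in> S \<Longrightarrow> \<bar>grad2 f p\<bar> \<le> G"
    by (metis bounded_real compact_imp_bounded image_eqI)
  define R' where "R' = \<bar>R\<bar> + 1"
  have R': "0 < R'" by (simp add: R'_def)
  have bd: "grad2 f (x, y) \<le> \<bar>G\<bar> * indicator {0<..<R'} y" if x: "x \<in> \<Omega>" and y: "0 < y" for x y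
  proof (cases "(x, y) \<in> S")
    case True
    have "\<bar>y\<bar> \<le> norm (x, y)" using norm_snd_le[of y x] by simp
    then have "y < R'" using R[OF True] y by (simp add: R'_def)
    then show ?thesis using G[OF True] y by (simp add: indicator_def)
  next
    case False
    \<comment> \<open>A test function may be nonzero outside the closed cylinder, so the gradient is
      seen to vanish only on the open set \<Omega> \<times> {0<..} - S.\<close>
    have "grad2 f (x, y) = 0"
    proof (rule grad2_zero_open)
      show "open (\<Omega> \<times> {0<..} - S)" using \<Omega> S by (intro open_Diff open_Times) auto
      show "(x, y) \<in> \<Omega> \<times> {0<..} - S" using x y False by auto
      fix q assume q: "q \<in> \<Omega> \<times> {0<..} - S"
      have "q \<notin> {q \<in> closure \<Omega> \<times> {0..}. f q \<noteq> 0}"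
        using q unfolding S_def by (meson DiffD2 closure_subset subsetD)
      moreover have "q \<in> closure \<Omega> \<times> {0..}" using q closure_subset[of \<Omega>] by (cases q) auto
      ultimately show "f q = 0" by blast
    qed
    then show ?thesis by simp
  qed
  have "wenergy s \<Omega> f \<le> (\<integral>\<^sup>+x\<in>\<Omega>. (\<integral>\<^sup>+y. ennreal \<bar>G\<bar> * (ennreal (y powr (1 - 2 * s)) * indicator {0<..<R'} y) \<partial>lborel) \<partial>lborel)"
    unfolding wenergy_def
  proof (intro nn_integral_mono)
    fix x
    show "(\<integral>\<^sup>+y\<in>{0<..}. ennreal (y powr (1 - 2 * s) * grad2 f (x, y)) \<partial>lborel) * indicator \<Omega> x \<le>
       (\<integral>\<^sup>+y. ennreal \<bar>G\<bar> * (ennreal (y powr (1 - 2 * s)) * indicator {0<..<R'} y) \<partial>lborel) * indicator \<Omega> x"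
    proof (cases "x \<in> \<Omega>")
      case True
      have "ennreal (y powr (1 - 2 * s) * grad2 f (x, y)) * indicator {0<..} y \<le> ennreal \<bar>G\<bar> * (ennreal (y powr (1 - 2 * s)) * indicator {0<..<R'} y)" for y
      proof (cases "0 < y")
        case y: True
        have "y powr (1 - 2 * s) * grad2 f (x, y) \<le> y powr (1 - 2 * s) * (\<bar>G\<bar> * indicator {0<..<R'} y)"
          by (intro mult_left_mono bd True y) simp
        then have "ennreal (y powr (1 - 2 * s) * grad2 f (x, y)) \<le> ennreal (y powr (1 - 2 * s) * (\<bar>G\<bar> * indicator {0<..<R'} y))"
          by (rule ennreal_leI)
        then show ?thesis using y by (auto simp: ennreal_mult mult_ac split: split_indicator_asm split_indicator)
      qed simp
      then show ?thesis using True by (simp add: nn_integral_mono)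
    qed simp
  qed
  also have "\<dots> = ennreal \<bar>G\<bar> * ennreal (R' powr (2 - 2 * s) / (2 - 2 * s)) * emeasure lborel \<Omega>"
    using nn_integral_powr_from_0[of "1 - 2 * s" R'] s R'
    by (simp add: nn_integral_cmult nn_integral_cmult_indicator)
  also have "\<dots> < top"
    using emeasure_bounded_finite[OF \<Omega>(2)] by (simp add: ennreal_mult_less_top less_top)
  finally show ?thesis .
qed

lemma wenergy_product:
  assumes f: "C1 f" and [measurable]: "\<Omega> \<in> sets borel"
  shows "wenergy s \<Omega> f = (\<integral>\<^sup>+p. ennreal (indicator (\<Omega> \<times> {0<..}) p * (snd p powr (1 - 2 * s) * grad2 f p)) \<partial>lborel)"
proof -
  have [measurable]: "grad2 f \<in> borel_measurable borel" using f by measurable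
  let ?F = "\<lambda>p. ennreal (snd p powr (1 - 2 * s) * grad2 f p) * (indicator \<Omega> (fst p) * indicator {0<..} (snd p))"
  have [measurable]: "grad2 f \<in> borel_measurable (borel \<Otimes>\<^sub>M borel)" using f by (simp add: borel_prod C1_measurable_grad2)
  have Fm: "?F \<in> borel_measurable (borel \<Otimes>\<^sub>M borel)" by measurable
  have "(\<integral>\<^sup>+p. ennreal (indicator (\<Omega> \<times> {0<..}) p * (snd p powr (1 - 2 * s) * grad2 f p)) \<partial>lborel) = (\<integral>\<^sup>+p. ?F p \<partial>lborel)"
    by (intro nn_integral_cong) (auto simp: indicator_def)
  also have "\<dots> = (\<integral>\<^sup>+p. ?F p \<partial>(lborel \<Otimes>\<^sub>M lborel))" by (simp add: lborel_prod)
  also have "\<dots> = (\<integral>\<^sup>+x. (\<integral>\<^sup>+y. ?F (x, y) \<partial>lborel) \<partial>lborel)"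
    by (rule lborel.nn_integral_fst[symmetric]) (use Fm in \<open>simp add: lborel_prod borel_prod\<close>)
  also have "\<dots> = wenergy s \<Omega> f"
    unfolding wenergy_def by (intro nn_integral_cong, subst nn_integral_multc[symmetric]) (auto simp: mult_ac)
  finally show ?thesis by simp
qed

text \<open>Integrability matters because the integral of a non-integrable function is 0 by default;
  it follows from the finiteness of \<open>wenergy\<close>.\<close>

lemma energy_integrable:
  assumes f: "test_fun \<Omega> \<Sigma> f" and \<Omega>: "open \<Omega>" "bounded \<Omega>" and s: "s < 1"
  shows "set_integrable lborel (\<Omega> \<times> {0<..}) (\<lambda>p. snd p powr (1 - 2 * s) * grad2 f p)"
    and "wenergy s \<Omega> f = ennreal (LINT p : \<Omega> \<times> {0<..} | lborel. snd p powr (1 - 2 * s) * grad2 f p)"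
proof -
  have f1: "C1 f" using f by (rule test_fun_C1)
  have [measurable]: "\<Omega> \<in> sets borel" "grad2 f \<in> borel_measurable borel" using \<Omega> f1 by (auto, measurable)
  have [measurable]: "\<Omega> \<times> {0<..} \<in> sets (borel :: ('a \<times> real) measure)"
    using \<Omega> by (intro borel_open open_Times) auto
  let ?F = "\<lambda>p. indicator (\<Omega> \<times> {0<..}) p * (snd p powr (1 - 2 * s) * grad2 f p)"
  have [measurable]: "(\<lambda>p. snd p) \<in> borel_measurable (borel :: ('a \<times> real) measure)"
    by (intro borel_measurable_continuous_onI continuous_intros)
  have m: "?F \<in> borel_measurable lborel" by simp
  have nn: "0 \<le> ?F p" for p by (simp add: grad2_nonneg)
  have fin: "(\<integral>\<^sup>+p. ennreal (?F p) \<partial>lborel) < \<infinity>"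
    using wenergy_finite[OF f \<Omega> s] wenergy_product[OF f1, of \<Omega> s] by simp
  have int: "integrable lborel ?F"
    by (rule integrableI_bounded[OF m]) (use fin nn in \<open>simp add: abs_of_nonneg\<close>)
  then show "set_integrable lborel (\<Omega> \<times> {0<..}) (\<lambda>p. snd p powr (1 - 2 * s) * grad2 f p)"
    by (simp add: set_integrable_def)
  show "wenergy s \<Omega> f = ennreal (LINT p : \<Omega> \<times> {0<..} | lborel. snd p powr (1 - 2 * s) * grad2 f p)"
    unfolding wenergy_product[OF f1 \<open>\<Omega> \<in> sets borel\<close>] set_lebesgue_integral_def real_scaleR_def
    by (rule nn_integral_eq_integral[OF int]) (simp add: nn)
qed

lemma ext_energy_eq_wenergy:
  assumes f: "test_fun \<Omega> \<Sigma> f" and \<Omega>: "open \<Omega>" "bounded \<Omega>" and s: "s < 1" and \<kappa>: "0 < \<kappa>"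
  shows "wenergy s \<Omega> f = ennreal (ext_energy \<kappa> s \<Omega> f / \<kappa>)" "0 \<le> ext_energy \<kappa> s \<Omega> f"
proof -
  show "wenergy s \<Omega> f = ennreal (ext_energy \<kappa> s \<Omega> f / \<kappa>)"
    using energy_integrable(2)[OF f \<Omega> s] \<kappa> by (simp add: ext_energy_def)
  show "0 \<le> ext_energy \<kappa> s \<Omega> f"
    unfolding ext_energy_def set_lebesgue_integral_def using \<kappa>
    by (intro mult_nonneg_nonneg integral_nonneg_AE) (auto simp: grad2_nonneg)
qed

lemma grad2_lincomb:
  assumes "f differentiable at p" "g differentiable at p"
  shows "grad2 (\<lambda>p. (1 - t) * f p + t * g p) p = (1 - t) * grad2 f p + t * grad2 g p - t * (1 - t) * grad2 (\<lambda>p. f p - g p) p"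
proof -
  have d: "frechet_derivative (\<lambda>p. f p - g p) (at p) = (\<lambda>v. frechet_derivative f (at p) v - frechet_derivative g (at p) v)"
    using frechet_derivative_lincomb[OF assms, of 1 "- 1"] by simp
  have "((1 - t) * a + t * b)\<^sup>2 = (1 - t) * a\<^sup>2 + t * b\<^sup>2 - t * (1 - t) * (a - b)\<^sup>2" for a b :: real
    by (simp add: power2_eq_square algebra_simps)
  then show ?thesis
    unfolding grad2_def d frechet_derivative_lincomb[OF assms]
    by (simp add: sum.distrib sum_subtractf sum_distrib_left)
qed

text \<open>The parallelogram law without an inner product, valid for every real t: t in [0, 1]
  gives convexity, and t > 1 will give a Young inequality.\<close>

lemma ext_energy_lincomb:
  assumes f: "test_fun \<Omega> \<Sigma> f" and g: "test_fun \<Omega> \<Sigma> g" and \<Omega>: "open \<Omega>" "bounded \<Omega>" and s: "s < 1"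
  shows "ext_energy \<kappa> s \<Omega> (\<lambda>p. (1 - t) * f p + t * g p) =
     (1 - t) * ext_energy \<kappa> s \<Omega> f + t * ext_energy \<kappa> s \<Omega> g - t * (1 - t) * ext_energy \<kappa> s \<Omega> (\<lambda>p. f p - g p)"
proof -
  have d: "test_fun \<Omega> \<Sigma> (\<lambda>p. f p - g p)" using test_fun_lincomb[OF f g, of 1 "- 1"] by simp
  have diff: "f differentiable at p" "g differentiable at p" for p
    using test_fun_C1[OF f] test_fun_C1[OF g] unfolding C1_def by blast+
  let ?w = "\<lambda>f p. snd p powr (1 - 2 * s) * grad2 f p"
  note i = energy_integrable(1)[OF f \<Omega> s] energy_integrable(1)[OF g \<Omega> s] energy_integrable(1)[OF d \<Omega> s]
  have "(LINT p : \<Omega> \<times> {0<..} | lborel. ?w (\<lambda>p. (1 - t) * f p + t * g p) p) =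
    (LINT p : \<Omega> \<times> {0<..} | lborel. (1 - t) * ?w f p + t * ?w g p - t * (1 - t) * ?w (\<lambda>p. f p - g p) p)"
    unfolding grad2_lincomb[OF diff] by (simp add: algebra_simps)
  also have "\<dots> = (1 - t) * (LINT p : \<Omega> \<times> {0<..} | lborel. ?w f p) + t * (LINT p : \<Omega> \<times> {0<..} | lborel. ?w g p)
      - t * (1 - t) * (LINT p : \<Omega> \<times> {0<..} | lborel. ?w (\<lambda>p. f p - g p) p)"
    using i by (subst set_integral_diff, simp, simp, subst set_integral_add) auto
  finally have eq: "(LINT p : \<Omega> \<times> {0<..} | lborel. ?w (\<lambda>p. (1 - t) * f p + t * g p) p) = \<dots>" .
  show ?thesis unfolding ext_energy_def eq by (simp add: algebra_simps)
qed

lemma ext_energy_scale: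
  assumes f: "C1 f"
  shows "ext_energy \<kappa> s \<Omega> (\<lambda>p. c * f p) = c\<^sup>2 * ext_energy \<kappa> s \<Omega> f"
proof -
  have diff: "f differentiable at p" for p using f unfolding C1_def by blast
  have "frechet_derivative (\<lambda>p. c * f p) (at p) = (\<lambda>v. c * frechet_derivative f (at p) v)" for p
    using frechet_derivative_lincomb[OF diff diff, of c 0] by simp
  then have "grad2 (\<lambda>p. c * f p) p = c\<^sup>2 * grad2 f p" for p
    by (simp add: grad2_def power_mult_distrib sum_distrib_left)
  then show ?thesis by (simp add: ext_energy_def mult.left_commute)
qed

section \<open>Decoupling of power integrals\<close>

text \<open>By homogeneity only b / a matters. If it is small, continuity at 1 suffices; otherwise
  both powers are at most C times that of b. In integrated form this replaces Minkowski's
  inequality.\<close>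

lemma abs_powr_perturb:
  fixes q \<epsilon> :: real
  assumes q: "0 < q" and \<epsilon>: "0 < \<epsilon>"
  obtains C where "0 \<le> C" "\<And>a b. \<bar>\<bar>a + b\<bar> powr q - \<bar>a\<bar> powr q\<bar> \<le> \<epsilon> * \<bar>a\<bar> powr q + C * \<bar>b\<bar> powr q"
proof -
  have "((\<lambda>t. \<bar>1 + t\<bar> powr q) \<longlongrightarrow> \<bar>1 + 0\<bar> powr q) (at (0::real))"
    by (intro tendsto_intros) auto
  then have "\<forall>\<^sub>F t in at (0::real). dist (\<bar>1 + t\<bar> powr q) 1 < \<epsilon>"
    using \<epsilon> unfolding tendsto_iff by simp
  then obtain d where d: "0 < d" "\<And>t. t \<noteq> 0 \<Longrightarrow> \<bar>t\<bar> < d \<Longrightarrow> \<bar>\<bar>1 + t\<bar> powr q - 1\<bar> < \<epsilon>"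
    unfolding eventually_at by (auto simp: dist_real_def)
  define C where "C = (1 + 1 / d) powr q"
  have C: "0 \<le> C" by (simp add: C_def)
  have "\<bar>\<bar>a + b\<bar> powr q - \<bar>a\<bar> powr q\<bar> \<le> \<epsilon> * \<bar>a\<bar> powr q + C * \<bar>b\<bar> powr q" for a b
  proof (cases "\<bar>b\<bar> < d * \<bar>a\<bar>")
    case True
    then have a: "a \<noteq> 0" using d(1) by auto
    have ba: "\<bar>b / a\<bar> < d" using True a by (simp add: abs_divide field_simps)
    have "\<bar>\<bar>1 + b / a\<bar> powr q - 1\<bar> \<le> \<epsilon>"
    proof (cases "b = 0")
      case False
      then show ?thesis using d(2)[OF _ ba] a by (simp del: abs_divide)
    qed (use \<epsilon> in simp)
    then have "\<bar>a\<bar> powr q * \<bar>\<bar>1 + b / a\<bar> powr q - 1\<bar> \<le> \<bar>a\<bar> powr q * \<epsilon>" by (intro mult_left_mono) auto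
    also have "\<bar>a\<bar> powr q * \<bar>\<bar>1 + b / a\<bar> powr q - 1\<bar> = \<bar>\<bar>a\<bar> powr q * (\<bar>1 + b / a\<bar> powr q - 1)\<bar>"
      by (simp add: abs_mult)
    also have "\<bar>a\<bar> powr q * (\<bar>1 + b / a\<bar> powr q - 1) = \<bar>a\<bar> powr q * \<bar>1 + b / a\<bar> powr q - \<bar>a\<bar> powr q"
      by (simp add: right_diff_distrib)
    also have "\<bar>a\<bar> powr q * \<bar>1 + b / a\<bar> powr q = \<bar>a + b\<bar> powr q"
      using a by (simp add: powr_mult[symmetric] abs_mult[symmetric] distrib_left)
    finally show ?thesis using C by (simp add: add_increasing2 mult.commute)
  next
    case False
    then have "\<bar>a\<bar> \<le> \<bar>b\<bar> / d" using d(1) by (simp add: field_simps)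
    then have le: "\<bar>a\<bar> \<le> (1 + 1 / d) * \<bar>b\<bar>" "\<bar>a + b\<bar> \<le> (1 + 1 / d) * \<bar>b\<bar>"
      by (auto simp: distrib_right)
    have "\<bar>a\<bar> powr q \<le> ((1 + 1 / d) * \<bar>b\<bar>) powr q" "\<bar>a + b\<bar> powr q \<le> ((1 + 1 / d) * \<bar>b\<bar>) powr q"
      using q le by (auto intro: powr_mono2)
    moreover have "((1 + 1 / d) * \<bar>b\<bar>) powr q = C * \<bar>b\<bar> powr q"
      unfolding C_def by (rule powr_mult)
    moreover have "0 \<le> \<bar>a\<bar> powr q" "0 \<le> \<bar>a + b\<bar> powr q" by auto
    ultimately have "\<bar>\<bar>a + b\<bar> powr q - \<bar>a\<bar> powr q\<bar> \<le> C * \<bar>b\<bar> powr q" by linarith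
    then show ?thesis using \<epsilon> by (simp add: add_increasing)
  qed
  then show thesis using that C by blast
qed

text \<open>For large a the bounded b is negligible against
  \<open>\<epsilon> * \<bar>a\<bar> powr q\<close>. Below the threshold R, q > 2 makes
  \<open>\<bar>a\<bar> powr q\<close> a multiple of the square of a, so the error is governed by L^2
  smallness.\<close>

lemma abs_powr_decouple:
  fixes q \<epsilon> M :: real
  assumes q: "2 < q" and \<epsilon>: "0 < \<epsilon>"
  obtains C where "0 \<le> C" "\<And>a b. \<bar>b\<bar> \<le> M \<Longrightarrow>
     \<bar>\<bar>a + b\<bar> powr q - \<bar>a\<bar> powr q - \<bar>b\<bar> powr q\<bar> \<le> \<epsilon> * (\<bar>a\<bar> powr q + 1) + C * a\<^sup>2"
proof -
  have q0: "0 < q" using q by simp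
  define m where "m = \<bar>M\<bar> powr q"
  have m: "0 \<le> m" by (simp add: m_def)
  obtain C1 where C1: "0 \<le> C1" "\<And>a b. \<bar>\<bar>a + b\<bar> powr q - \<bar>a\<bar> powr q\<bar> \<le> \<epsilon> / 2 * \<bar>a\<bar> powr q + C1 * \<bar>b\<bar> powr q"
    using abs_powr_perturb[OF q0, of "\<epsilon> / 2"] \<epsilon> by auto
  obtain C2 where C2: "0 \<le> C2" "\<And>a b. \<bar>\<bar>a + b\<bar> powr q - \<bar>a\<bar> powr q\<bar> \<le> \<epsilon> / (m + 1) * \<bar>a\<bar> powr q + C2 * \<bar>b\<bar> powr q"
    using abs_powr_perturb[OF q0, of "\<epsilon> / (m + 1)"] \<epsilon> m by auto
  \<comment> \<open>From R on, half of \<open>\<epsilon> * \<bar>a\<bar> powr q\<close> is at least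
    \<open>(C1 + 1) * (m + 1)\<close> and absorbs all terms in b.\<close>
  define R where "R = (2 * (C1 + 1) * (m + 1) / \<epsilon>) powr (1 / q)"
  have Rq: "R powr q = 2 * (C1 + 1) * (m + 1) / \<epsilon>" "0 < R"
    unfolding R_def using q0 C1 m \<epsilon> by (auto simp: powr_powr)
  define C where "C = (C2 + 1) * R powr (q - 2)"
  have "\<bar>\<bar>a + b\<bar> powr q - \<bar>a\<bar> powr q - \<bar>b\<bar> powr q\<bar> \<le> \<epsilon> * (\<bar>a\<bar> powr q + 1) + C * a\<^sup>2" if b: "\<bar>b\<bar> \<le> M" for a b
  proof -
    have bm: "\<bar>b\<bar> powr q \<le> m" unfolding m_def using b q0 by (intro powr_mono2) auto
    have Ca: "0 \<le> C * a\<^sup>2" using C2 by (simp add: C_def)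
    show ?thesis
    proof (cases "R \<le> \<bar>a\<bar>")
      case True
      then have "R powr q \<le> \<bar>a\<bar> powr q" using Rq q0 by (intro powr_mono2) auto
      then have "2 * (C1 + 1) * (m + 1) \<le> \<epsilon> * \<bar>a\<bar> powr q" unfolding Rq using \<epsilon> by (simp add: field_simps)
      moreover have "(C1 + 1) * m \<le> (C1 + 1) * (m + 1)" using C1 by (intro mult_left_mono) auto
      ultimately have 1: "C1 * m + m \<le> \<epsilon> / 2 * \<bar>a\<bar> powr q" by (simp add: algebra_simps)
      have "C1 * \<bar>b\<bar> powr q \<le> C1 * m" using C1 bm by (intro mult_left_mono) auto
      then have "\<bar>\<bar>a + b\<bar> powr q - \<bar>a\<bar> powr q\<bar> \<le> \<epsilon> / 2 * \<bar>a\<bar> powr q + C1 * m"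
        using C1(2)[of a b] by simp
      then have "\<bar>\<bar>a + b\<bar> powr q - \<bar>a\<bar> powr q - \<bar>b\<bar> powr q\<bar> \<le> \<epsilon> / 2 * \<bar>a\<bar> powr q + C1 * m + m"
        using bm abs_triangle_ineq4[of "\<bar>a + b\<bar> powr q - \<bar>a\<bar> powr q" "\<bar>b\<bar> powr q"] by simp
      also have "\<dots> \<le> \<epsilon> * \<bar>a\<bar> powr q" using 1 by simp
      also have "\<dots> \<le> \<epsilon> * (\<bar>a\<bar> powr q + 1) + C * a\<^sup>2" using Ca \<epsilon> by (simp add: distrib_left)
      finally show ?thesis .
    next
      case False
      have "\<epsilon> / (m + 1) * \<bar>b\<bar> powr q \<le> \<epsilon> / (m + 1) * (m + 1)"
        using bm m \<epsilon> by (intro mult_left_mono) auto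
      then have 1: "\<epsilon> / (m + 1) * \<bar>b\<bar> powr q \<le> \<epsilon>" using m by simp
      have "\<bar>a\<bar> powr q \<le> R powr (q - 2) * a\<^sup>2"
      proof (cases "a = 0")
        case nz: False
        have "\<bar>a\<bar> powr q = \<bar>a\<bar> powr (q - 2) * a\<^sup>2"
          using nz powr_add[of "\<bar>a\<bar>" "q - 2" 2] by (simp add: powr_numeral)
        also have "\<dots> \<le> R powr (q - 2) * a\<^sup>2"
          using False q by (intro mult_right_mono powr_mono2) auto
        finally show ?thesis .
      qed (use q0 in simp)
      then have 2: "(C2 + 1) * \<bar>a\<bar> powr q \<le> C * a\<^sup>2"
        unfolding C_def mult.assoc using C2 by (intro mult_left_mono) auto
      have "\<bar>\<bar>a + b\<bar> powr q - \<bar>a\<bar> powr q - \<bar>b\<bar> powr q\<bar> \<le> \<bar>\<bar>b + a\<bar> powr q - \<bar>b\<bar> powr q\<bar> + \<bar>a\<bar> powr q"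
        using abs_triangle_ineq4[of "\<bar>b + a\<bar> powr q - \<bar>b\<bar> powr q" "\<bar>a\<bar> powr q"]
        by (simp add: add.commute algebra_simps)
      also have "\<dots> \<le> \<epsilon> + C2 * \<bar>a\<bar> powr q + \<bar>a\<bar> powr q" using C2(2)[of b a] 1 by simp
      also have "\<dots> \<le> \<epsilon> + C * a\<^sup>2" using 2 by (simp add: distrib_right)
      also have "\<dots> \<le> \<epsilon> * (\<bar>a\<bar> powr q + 1) + C * a\<^sup>2" using \<epsilon> by (simp add: distrib_left)
      finally show ?thesis .
    qed
  qed
  moreover have "0 \<le> C" using C2 by (simp add: C_def)
  ultimately show thesis using that by blast
qed

text \<open>The power of the norm and not the norm, because the power splits additively in the
  Brezis-Lieb argument. For traces of test functions the integrand is continuous on a bounded set,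
  so the integral is never a default value.\<close>

definition pint :: "real \<Rightarrow> 'a::euclidean_space set \<Rightarrow> ('a \<Rightarrow> real) \<Rightarrow> real" where
  "pint q \<Omega> u = (LINT x:\<Omega>|lborel. \<bar>u x\<bar> powr q)"

section \<open>Power integrals of continuous functions on a bounded open set\<close>

locale bounded_open =
  fixes \<Omega> :: "'a::euclidean_space set"
  assumes op: "open \<Omega>" and bd: "bounded \<Omega>"
begin

lemma Om_sets[measurable]: "\<Omega> \<in> sets borel" using op by simp

lemma integ: "continuous_on UNIV u \<Longrightarrow> set_integrable lborel \<Omega> u" for u :: "'a \<Rightarrow> real"
  by (rule set_integrable_continuous_bounded[OF _ bd]) simp_all

lemma cont_powr: "continuous_on UNIV u \<Longrightarrow> 0 < q \<Longrightarrow> continuous_on UNIV (\<lambda>x. \<bar>u x\<bar> powr q)" for u :: "'a \<Rightarrow> real"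
  by (intro continuous_on_powr' continuous_intros) auto

lemma integ_powr: "continuous_on UNIV u \<Longrightarrow> 0 < q \<Longrightarrow> set_integrable lborel \<Omega> (\<lambda>x. \<bar>u x\<bar> powr q)" for u :: "'a \<Rightarrow> real"
  by (intro integ cont_powr)

lemma LINT_mono:
  fixes u v :: "'a \<Rightarrow> real"
  assumes "continuous_on UNIV u" "continuous_on UNIV v" "\<And>x. x \<in> \<Omega> \<Longrightarrow> u x \<le> v x"
  shows "(LINT x:\<Omega>|lborel. u x) \<le> (LINT x:\<Omega>|lborel. v x)"
  using assms by (intro set_integral_mono integ) auto

lemma LINT_const: "(LINT x:\<Omega>|lborel. (c::real)) = measure lborel \<Omega> * c"
  by (simp add: set_lebesgue_integral_def)

lemma pint_nonneg: "0 \<le> pint q \<Omega> u"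
  unfolding pint_def set_lebesgue_integral_def by (rule integral_nonneg_AE) auto

lemma pint_nn:
  assumes "continuous_on UNIV u" "0 < q"
  shows "(\<integral>\<^sup>+x\<in>\<Omega>. ennreal (\<bar>u x\<bar> powr q) \<partial>lborel) = ennreal (pint q \<Omega> u)"
  unfolding pint_def by (rule nn_integral_continuous_bounded[OF cont_powr bd]) (use assms in auto)

lemma pint_2: "pint 2 \<Omega> u = (LINT x:\<Omega>|lborel. (u x)\<^sup>2)"
  unfolding pint_def by (simp add: powr_numeral)

lemma pint_scale: "pint q \<Omega> (\<lambda>x. c * u x) = \<bar>c\<bar> powr q * pint q \<Omega> u"
  unfolding pint_def by (simp add: abs_mult powr_mult)

text \<open>R is free: a small R tames the volume term, so smallness of the critical integral passes
  to L^2.\<close>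

lemma pint_2_split:
  assumes u: "continuous_on UNIV u" and R: "0 < R" and q: "2 < q"
  shows "pint 2 \<Omega> u \<le> R powr (2 - q) * pint q \<Omega> u + R\<^sup>2 * measure lborel \<Omega>"
proof -
  have "pint 2 \<Omega> u \<le> (LINT x:\<Omega>|lborel. R powr (2 - q) * \<bar>u x\<bar> powr q + R\<^sup>2)"
    unfolding pint_2 using u q R
    by (intro LINT_mono square_le_power_split) (auto intro!: continuous_intros cont_powr)
  also have "\<dots> = R powr (2 - q) * pint q \<Omega> u + R\<^sup>2 * measure lborel \<Omega>"
    unfolding pint_def using integ_powr[OF u, of q] q integ[of "\<lambda>x. R\<^sup>2"]
    by (subst set_integral_add) (auto simp: LINT_const)
  finally show ?thesis .
qed

lemma pint_perturb:
  assumes q: "0 < q" and \<epsilon>: "0 < \<epsilon>"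
  obtains C where "0 \<le> C" "\<And>u v. continuous_on UNIV u \<Longrightarrow> continuous_on UNIV v \<Longrightarrow>
    \<bar>pint q \<Omega> u - pint q \<Omega> v\<bar> \<le> \<epsilon> * pint q \<Omega> v + C * pint q \<Omega> (\<lambda>x. u x - v x)"
proof -
  obtain C where C: "0 \<le> C" "\<And>a b. \<bar>\<bar>a + b\<bar> powr q - \<bar>a\<bar> powr q\<bar> \<le> \<epsilon> * \<bar>a\<bar> powr q + C * \<bar>b\<bar> powr q"
    using abs_powr_perturb[OF q \<epsilon>] by blast
  have "\<bar>pint q \<Omega> u - pint q \<Omega> v\<bar> \<le> \<epsilon> * pint q \<Omega> v + C * pint q \<Omega> (\<lambda>x. u x - v x)"
    if u: "continuous_on UNIV u" and v: "continuous_on UNIV v" for u v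
  proof -
    have d: "continuous_on UNIV (\<lambda>x. u x - v x)" by (intro continuous_intros u v)
    note cp = cont_powr[OF u q] cont_powr[OF v q] cont_powr[OF d q]
    have "pint q \<Omega> u - pint q \<Omega> v = (LINT x:\<Omega>|lborel. \<bar>u x\<bar> powr q - \<bar>v x\<bar> powr q)"
      unfolding pint_def by (rule set_integral_diff(2)[symmetric]) (intro integ cp)+
    then have "\<bar>pint q \<Omega> u - pint q \<Omega> v\<bar> \<le> (LINT x:\<Omega>|lborel. \<bar>\<bar>u x\<bar> powr q - \<bar>v x\<bar> powr q\<bar>)"
      using set_integral_norm_bound[of lborel \<Omega> "\<lambda>x. \<bar>u x\<bar> powr q - \<bar>v x\<bar> powr q"]
      by (simp add: integ continuous_on_diff cp)
    also have "\<dots> \<le> (LINT x:\<Omega>|lborel. \<epsilon> * \<bar>v x\<bar> powr q + C * \<bar>u x - v x\<bar> powr q)"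
    proof (rule LINT_mono)
      show "\<bar>\<bar>u x\<bar> powr q - \<bar>v x\<bar> powr q\<bar> \<le> \<epsilon> * \<bar>v x\<bar> powr q + C * \<bar>u x - v x\<bar> powr q" for x
        using C(2)[of "v x" "u x - v x"] by simp
    qed (intro continuous_intros cp)+
    also have "\<dots> = \<epsilon> * pint q \<Omega> v + C * pint q \<Omega> (\<lambda>x. u x - v x)"
      unfolding pint_def using integ[OF cp(2)] integ[OF cp(3)] by (subst set_integral_add) auto
    finally show ?thesis .
  qed
  then show thesis using that C(1) by blast
qed

lemma pint_decouple:
  assumes q: "2 < q" and \<epsilon>: "0 < \<epsilon>"
  obtains C where "0 \<le> C" "\<And>a b. continuous_on UNIV a \<Longrightarrow> continuous_on UNIV b \<Longrightarrow> (\<And>x. x \<in> \<Omega> \<Longrightarrow> \<bar>b x\<bar> \<le> M) \<Longrightarrow>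
    \<bar>pint q \<Omega> (\<lambda>x. a x + b x) - pint q \<Omega> a - pint q \<Omega> b\<bar> \<le> \<epsilon> * (pint q \<Omega> a + measure lborel \<Omega>) + C * pint 2 \<Omega> a"
proof -
  obtain C where C: "0 \<le> C" "\<And>a b. \<bar>b\<bar> \<le> M \<Longrightarrow>
     \<bar>\<bar>a + b\<bar> powr q - \<bar>a\<bar> powr q - \<bar>b\<bar> powr q\<bar> \<le> \<epsilon> * (\<bar>a\<bar> powr q + 1) + C * a\<^sup>2"
    using abs_powr_decouple[OF q \<epsilon>, of M] by metis
  have q0: "0 < q" using q by simp
  have "\<bar>pint q \<Omega> (\<lambda>x. a x + b x) - pint q \<Omega> a - pint q \<Omega> b\<bar> \<le> \<epsilon> * (pint q \<Omega> a + measure lborel \<Omega>) + C * pint 2 \<Omega> a"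
    if a: "continuous_on UNIV a" and b: "continuous_on UNIV b" and M: "\<And>x. x \<in> \<Omega> \<Longrightarrow> \<bar>b x\<bar> \<le> M" for a b
  proof -
    have d: "continuous_on UNIV (\<lambda>x. a x + b x)" by (intro continuous_intros a b)
    note cp = cont_powr[OF a q0] cont_powr[OF b q0] cont_powr[OF d q0]
    let ?w = "\<lambda>x. \<bar>a x + b x\<bar> powr q - \<bar>a x\<bar> powr q - \<bar>b x\<bar> powr q"
    have cw: "continuous_on UNIV ?w" by (intro continuous_intros cp)
    have "(LINT x:\<Omega>|lborel. ?w x) = pint q \<Omega> (\<lambda>x. a x + b x) - pint q \<Omega> a - pint q \<Omega> b"
      unfolding pint_def
      by (subst set_integral_diff, (intro integ continuous_intros cp)+, subst set_integral_diff, (intro integ continuous_intros cp)+, rule refl)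
    then have "\<bar>pint q \<Omega> (\<lambda>x. a x + b x) - pint q \<Omega> a - pint q \<Omega> b\<bar> \<le> (LINT x:\<Omega>|lborel. \<bar>?w x\<bar>)"
      using set_integral_norm_bound[OF integ[OF cw]] by simp
    also have "\<dots> \<le> (LINT x:\<Omega>|lborel. (\<epsilon> * \<bar>a x\<bar> powr q + \<epsilon>) + C * (a x)\<^sup>2)"
    proof (rule LINT_mono)
      show "\<bar>?w x\<bar> \<le> (\<epsilon> * \<bar>a x\<bar> powr q + \<epsilon>) + C * (a x)\<^sup>2" if "x \<in> \<Omega>" for x
        using C(2)[OF M[OF that], of "a x"] by (simp add: distrib_left)
    qed (intro continuous_intros cp cw a)+
    also have "\<dots> = (\<epsilon> * pint q \<Omega> a + measure lborel \<Omega> * \<epsilon>) + C * pint 2 \<Omega> a"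
      unfolding pint_2 unfolding pint_def
      by (subst set_integral_add, (intro integ continuous_intros cp a)+, subst set_integral_add, (intro integ continuous_intros cp a)+, simp add: LINT_const)
    finally show ?thesis by (simp add: distrib_left mult.commute)
  qed
  then show thesis using that C(1) by blast
qed

end

text \<open>The case \<epsilon> = 1 bounds the sequence; a small \<epsilon> then gives the Cauchy
  property, its constant C being absorbed by d. The same argument serves the energy and both power
  integrals.\<close>

lemma convergent_from_perturb:
  fixes a :: "nat \<Rightarrow> real" and d :: "nat \<Rightarrow> nat \<Rightarrow> real"
  assumes nn: "\<And>n. 0 \<le> a n"
    and le: "\<And>\<epsilon>. 0 < \<epsilon> \<Longrightarrow> \<exists>C\<ge>0. \<forall>m n. a m \<le> (1 + \<epsilon>) * a n + C * d m n"
    and d: "\<And>\<epsilon>. 0 < \<epsilon> \<Longrightarrow> \<exists>n0. \<forall>m\<ge>n0. \<forall>n\<ge>n0. d m n < \<epsilon>"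
  shows "convergent a"
proof -
  obtain C where C: "0 \<le> C" "\<And>m n. a m \<le> (1 + 1) * a n + C * d m n" using le[of 1] by auto
  obtain n1 where n1: "\<And>m n. n1 \<le> m \<Longrightarrow> n1 \<le> n \<Longrightarrow> d m n < 1" using d[of 1] by auto
  define K where "K = 2 * a n1 + C + 1"
  have K: "a m \<le> K" if "n1 \<le> m" for m
  proof -
    have "C * d m n1 \<le> C * 1" using n1[OF that, of n1] C by (intro mult_left_mono) auto
    then show ?thesis using C(2)[of m n1] by (simp add: K_def)
  qed
  have Kpos: "0 < K" using nn[of n1] C by (simp add: K_def)
  have "Cauchy a" unfolding Cauchy_def
  proof (intro allI impI)
    fix e :: real assume e: "0 < e"
    define \<epsilon> where "\<epsilon> = e / (4 * K)"
    have \<epsilon>: "0 < \<epsilon>" using e Kpos by (simp add: \<epsilon>_def)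
    obtain D where D: "0 \<le> D" "\<And>m n. a m \<le> (1 + \<epsilon>) * a n + D * d m n" using le[OF \<epsilon>] by auto
    have "0 < e / (4 * (D + 1))" using e D by simp
    from d[OF this] obtain n2 where n2: "\<And>m n. n2 \<le> m \<Longrightarrow> n2 \<le> n \<Longrightarrow> d m n < e / (4 * (D + 1))"
      by blast
    have one: "a m - a n < e" if "max n1 n2 \<le> m" "max n1 n2 \<le> n" for m n
    proof -
      have "\<epsilon> * a n \<le> \<epsilon> * K" using K[of n] that \<epsilon> by (intro mult_left_mono) auto
      also have "\<dots> = e / 4" using Kpos by (simp add: \<epsilon>_def)
      finally have 1: "\<epsilon> * a n \<le> e / 4" .
      have "D * d m n \<le> D * (e / (4 * (D + 1)))" using n2[of m n] that D by (intro mult_left_mono) auto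
      also have "\<dots> \<le> e / 4" using D e by (simp add: field_simps)
      finally have 2: "D * d m n \<le> e / 4" .
      have "a m \<le> a n + \<epsilon> * a n + D * d m n" using D(2)[of m n] by (simp add: distrib_right)
      then show ?thesis using 1 2 e by linarith
    qed
    show "\<exists>M. \<forall>m\<ge>M. \<forall>n\<ge>M. dist (a m) (a n) < e"
    proof (intro exI[of _ "max n1 n2"] allI impI)
      fix m n assume "max n1 n2 \<le> m" "max n1 n2 \<le> n"
      then show "dist (a m) (a n) < e" using one[of m n] one[of n m] by (auto simp: dist_real_def abs_less_iff)
    qed
  qed
  then show ?thesis by (simp add: Cauchy_convergent_iff)
qed

section \<open>The variational problem\<close>

text \<open>The convex hull of a tail, generated by binary combinations so that every claim about
  convexity becomes an induction.\<close>

inductive_set cvx_tail :: "(nat \<Rightarrow> 'b \<Rightarrow> real) \<Rightarrow> nat \<Rightarrow> ('b \<Rightarrow> real) set" for \<psi> m where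
  base: "m \<le> n \<Longrightarrow> \<psi> n \<in> cvx_tail \<psi> m"
| step: "f \<in> cvx_tail \<psi> m \<Longrightarrow> g \<in> cvx_tail \<psi> m \<Longrightarrow> 0 \<le> t \<Longrightarrow> t \<le> 1 \<Longrightarrow>
    (\<lambda>p. (1 - t) * f p + t * g p) \<in> cvx_tail \<psi> m"

lemma cvx_tail_antimono:
  assumes "m \<le> m'" "f \<in> cvx_tail \<psi> m'"
  shows "f \<in> cvx_tail \<psi> m"
  using assms(2)
proof induction
  case (base n)
  then show ?case using assms(1) by (intro cvx_tail.base) simp
qed (rule cvx_tail.step)

text \<open>The concavity that penalises a split of mass: on [0, 1] a number is at most its power p,
  applied to \<theta> and 1 - \<theta>.\<close>

lemma one_minus_powr_le:
  fixes \<theta> p :: real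
  assumes "0 \<le> \<theta>" "\<theta> \<le> 1" "0 < p" "p \<le> 1"
  shows "1 - \<theta> powr p \<le> (1 - \<theta>) powr p"
proof -
  have le: "x \<le> x powr p" if "0 \<le> x" "x \<le> 1" for x :: real
    using powr_mono'[of p 1 x] assms that by simp
  show ?thesis using le[of \<theta>] le[of "1 - \<theta>"] assms by simp
qed

text \<open>\<open>E_conv\<close> and \<open>E_scale\<close> describe a quadratic form without
  naming a bilinear one. The geometry of the domain and the boundary condition are present only
  through \<open>sobolev\<close> and \<open>compact_trace\<close>.\<close>

locale trace_minimisation = bounded_open \<Omega> for \<Omega> :: "'a::euclidean_space set" +
  fixes T :: "('a \<times> real \<Rightarrow> real) set" and E :: "('a \<times> real \<Rightarrow> real) \<Rightarrow> real" and q :: real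
  assumes q2: "2 < q"
    and lincomb: "\<And>f g a b. f \<in> T \<Longrightarrow> g \<in> T \<Longrightarrow> (\<lambda>p. a * f p + b * g p) \<in> T"
    and cont: "\<And>f. f \<in> T \<Longrightarrow> continuous_on UNIV (\<lambda>x. f (x, 0))"
    and E_nonneg: "\<And>f. f \<in> T \<Longrightarrow> 0 \<le> E f"
    and E_conv: "\<And>f g t. f \<in> T \<Longrightarrow> g \<in> T \<Longrightarrow>
        E (\<lambda>p. (1 - t) * f p + t * g p) = (1 - t) * E f + t * E g - t * (1 - t) * E (\<lambda>p. f p - g p)"
    and E_scale: "\<And>f c. f \<in> T \<Longrightarrow> E (\<lambda>p. c * f p) = c\<^sup>2 * E f"
    and sobolev: "\<exists>C\<ge>0. \<forall>f\<in>T. pint q \<Omega> (\<lambda>x. f (x, 0)) \<le> C * E f powr (q / 2)"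
    and compact_trace: "\<And>\<phi> M. (\<And>n. \<phi> n \<in> T) \<Longrightarrow> (\<And>n. E (\<phi> n) \<le> M) \<Longrightarrow>
        \<exists>k::nat \<Rightarrow> nat. strict_mono k \<and> (\<forall>\<epsilon>>0. \<exists>n0. \<forall>m\<ge>n0. \<forall>n\<ge>n0.
           pint 2 \<Omega> (\<lambda>x. \<phi> (k m) (x, 0) - \<phi> (k n) (x, 0)) < \<epsilon>)"
begin

abbreviation "W f \<equiv> pint q \<Omega> (\<lambda>x. f (x, 0))"
abbreviation "L f \<equiv> pint 2 \<Omega> (\<lambda>x. f (x, 0))"
abbreviation "\<mu> \<equiv> measure lborel \<Omega>"

lemma diff_T: "f \<in> T \<Longrightarrow> g \<in> T \<Longrightarrow> (\<lambda>p. f p - g p) \<in> T"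
  using lincomb[of f g 1 "- 1"] by simp

lemma scale_T: "f \<in> T \<Longrightarrow> (\<lambda>p. c * f p) \<in> T"
  using lincomb[of f f c 0] by simp

lemma q0: "0 < q" using q2 by simp

lemma L_small:
  assumes "f \<in> T" "0 < R"
  shows "L f \<le> R powr (2 - q) * W f + R\<^sup>2 * \<mu>"
  by (rule pint_2_split[OF cont[OF assms(1)] assms(2) q2])

text \<open>Young's inequality: E is nonnegative at the extrapolated combination with t = 1 + 1 /
  \<epsilon>, outside [0, 1].\<close>

lemma E_perturb:
  assumes f: "f \<in> T" and g: "g \<in> T" and \<epsilon>: "0 < \<epsilon>"
  shows "E f \<le> (1 + \<epsilon>) * E g + (1 + 1 / \<epsilon>) * E (\<lambda>p. f p - g p)"
proof -
  define t where "t = 1 + 1 / \<epsilon>"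
  have "0 \<le> E (\<lambda>p. (1 - t) * f p + t * g p)" by (intro E_nonneg lincomb f g)
  then have "0 \<le> (1 - t) * E f + t * E g - t * (1 - t) * E (\<lambda>p. f p - g p)" by (simp add: E_conv f g)
  then have "E f / \<epsilon> \<le> t * E g + t * (1 / \<epsilon>) * E (\<lambda>p. f p - g p)" by (simp add: t_def algebra_simps)
  then have "\<epsilon> * (E f / \<epsilon>) \<le> \<epsilon> * (t * E g + t * (1 / \<epsilon>) * E (\<lambda>p. f p - g p))"
    using \<epsilon> by (intro mult_left_mono) auto
  moreover have "\<epsilon> * (t * E g + t * (1 / \<epsilon>) * E (\<lambda>p. f p - g p)) = (\<epsilon> * t) * E g + t * E (\<lambda>p. f p - g p)"
    using \<epsilon> by (simp add: algebra_simps)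
  moreover have "\<epsilon> * t = 1 + \<epsilon>" using \<epsilon> by (simp add: t_def algebra_simps)
  ultimately show ?thesis using \<epsilon> by (simp add: t_def)
qed

section \<open>Cauchy sequences as elements of the completion\<close>

definition ecauchy :: "(nat \<Rightarrow> 'a \<times> real \<Rightarrow> real) \<Rightarrow> bool" where
  "ecauchy F \<longleftrightarrow> (\<forall>n. F n \<in> T) \<and> (\<forall>\<epsilon>>0. \<exists>M. \<forall>m\<ge>M. \<forall>n\<ge>M. E (\<lambda>p. F m p - F n p) < \<epsilon>)"

lemma ecauchy_W:
  assumes F: "ecauchy F" and \<epsilon>: "0 < \<epsilon>"
  shows "\<exists>M. \<forall>m\<ge>M. \<forall>n\<ge>M. W (\<lambda>p. F m p - F n p) < \<epsilon>"
proof -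
  obtain C where C: "0 \<le> C" "\<And>f. f \<in> T \<Longrightarrow> W f \<le> C * E f powr (q / 2)" using sobolev by blast
  define d where "d = (\<epsilon> / (C + 1)) powr (2 / q)"
  have d: "0 < d" using \<epsilon> C by (simp add: d_def)
  obtain M where M: "\<And>m n. M \<le> m \<Longrightarrow> M \<le> n \<Longrightarrow> E (\<lambda>p. F m p - F n p) < d"
    using F d unfolding ecauchy_def by blast
  have "W (\<lambda>p. F m p - F n p) < \<epsilon>" if "M \<le> m" "M \<le> n" for m n
  proof -
    have T: "(\<lambda>p. F m p - F n p) \<in> T" using F by (simp add: ecauchy_def diff_T)
    have "E (\<lambda>p. F m p - F n p) powr (q / 2) \<le> d powr (q / 2)"
      using M[OF that] E_nonneg[OF T] q0 by (intro powr_mono2) auto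
    also have "\<dots> = \<epsilon> / (C + 1)" using q0 \<epsilon> C by (simp add: d_def powr_powr)
    finally have "C * E (\<lambda>p. F m p - F n p) powr (q / 2) \<le> C * (\<epsilon> / (C + 1))"
      using C by (intro mult_left_mono)
    also have "\<dots> < \<epsilon>" using C \<epsilon> by (simp add: field_simps)
    finally show ?thesis using C(2)[OF T] by simp
  qed
  then show ?thesis by blast
qed

text \<open>R is chosen first, so that the volume term is at most \<epsilon> / 2; the critical
  integral then beats the fixed factor \<open>R powr (2 - q)\<close>.\<close>

lemma L_from_W:
  assumes F: "\<And>m n. d m n \<in> T" and W: "\<And>\<epsilon>. 0 < \<epsilon> \<Longrightarrow> \<exists>M::nat. \<forall>m\<ge>M. \<forall>n\<ge>M. W (d m n) < \<epsilon>" and \<epsilon>: "0 < \<epsilon>"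
  shows "\<exists>M. \<forall>m\<ge>M. \<forall>n\<ge>M. L (d m n) < \<epsilon>"
proof -
  define R where "R = sqrt (\<epsilon> / (2 * (\<mu> + 1)))"
  have \<mu>: "0 \<le> \<mu>" by simp
  have \<mu>1: "0 < \<mu> + 1" using \<mu> by linarith
  then have R2: "0 < R" "R\<^sup>2 = \<epsilon> / 2 / (\<mu> + 1)" using \<epsilon> by (auto simp: R_def)
  have "R\<^sup>2 * \<mu> \<le> R\<^sup>2 * (\<mu> + 1)" by (intro mult_left_mono) auto
  also have "\<dots> = \<epsilon> / 2" unfolding R2(2) by (rule nonzero_eq_divide_eq[THEN iffD1]) (use \<mu>1 in auto)
  finally have R: "0 < R" "R\<^sup>2 * \<mu> \<le> \<epsilon> / 2" using R2 by auto
  define c where "c = R powr (2 - q)"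
  have c: "0 < c" using R by (simp add: c_def)
  have "0 < \<epsilon> / (2 * c)" using \<epsilon> c by simp
  from W[OF this] obtain M where M: "\<And>m n. M \<le> m \<Longrightarrow> M \<le> n \<Longrightarrow> W (d m n) < \<epsilon> / (2 * c)" by blast
  have "L (d m n) < \<epsilon>" if "M \<le> m" "M \<le> n" for m n
  proof -
    have "c * W (d m n) < c * (\<epsilon> / (2 * c))" using M[OF that] c by (intro mult_strict_left_mono)
    also have "\<dots> = \<epsilon> / 2" using c by simp
    finally show ?thesis using L_small[OF F R(1), of m n] R(2) by (simp add: c_def)
  qed
  then show ?thesis by blast
qed

lemma pint_convergent:
  assumes F: "\<And>n. F n \<in> T" and r: "0 < r"
    and d: "\<And>\<epsilon>. 0 < \<epsilon> \<Longrightarrow> \<exists>M::nat. \<forall>m\<ge>M. \<forall>n\<ge>M. pint r \<Omega> (\<lambda>x. F m (x, 0) - F n (x, 0)) < \<epsilon>"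
  shows "convergent (\<lambda>n. pint r \<Omega> (\<lambda>x. F n (x, 0)))"
proof (rule convergent_from_perturb[where d = "\<lambda>m n. pint r \<Omega> (\<lambda>x. F m (x, 0) - F n (x, 0))"])
  fix \<epsilon> :: real assume "0 < \<epsilon>"
  from pint_perturb[OF r this] obtain C where C: "0 \<le> C" "\<And>u v. continuous_on UNIV u \<Longrightarrow> continuous_on UNIV v \<Longrightarrow>
    \<bar>pint r \<Omega> u - pint r \<Omega> v\<bar> \<le> \<epsilon> * pint r \<Omega> v + C * pint r \<Omega> (\<lambda>x. u x - v x)" by blast
  show "\<exists>C\<ge>0. \<forall>m n. pint r \<Omega> (\<lambda>x. F m (x, 0)) \<le> (1 + \<epsilon>) * pint r \<Omega> (\<lambda>x. F n (x, 0)) + C * pint r \<Omega> (\<lambda>x. F m (x, 0) - F n (x, 0))"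
  proof (intro exI[of _ C] conjI allI C(1))
    fix m n
    show "pint r \<Omega> (\<lambda>x. F m (x, 0)) \<le> (1 + \<epsilon>) * pint r \<Omega> (\<lambda>x. F n (x, 0)) + C * pint r \<Omega> (\<lambda>x. F m (x, 0) - F n (x, 0))"
      using C(2)[OF cont[OF F] cont[OF F], of m n] by (simp add: algebra_simps abs_le_iff)
  qed
qed (use d pint_nonneg in auto)

text \<open>Guarantees that the \<open>lim\<close> defining norm and traces is a genuine limit and
  not an unspecified value.\<close>

lemma ecauchy_convergent:
  assumes F: "ecauchy F"
  shows "convergent (\<lambda>n. E (F n))" "convergent (\<lambda>n. W (F n))" "convergent (\<lambda>n. L (F n))"
proof -
  have T: "F n \<in> T" for n using F by (simp add: ecauchy_def)
  show "convergent (\<lambda>n. E (F n))"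
  proof (rule convergent_from_perturb[where d = "\<lambda>m n. E (\<lambda>p. F m p - F n p)"])
    fix \<epsilon> :: real assume "0 < \<epsilon>"
    then show "\<exists>C\<ge>0. \<forall>m n. E (F m) \<le> (1 + \<epsilon>) * E (F n) + C * E (\<lambda>p. F m p - F n p)"
      by (intro exI[of _ "1 + 1 / \<epsilon>"]) (auto intro!: E_perturb T)
  qed (use F in \<open>auto simp: ecauchy_def E_nonneg\<close>)
  show "convergent (\<lambda>n. W (F n))"
    by (rule pint_convergent[OF T q0]) (rule ecauchy_W[OF F])
  show "convergent (\<lambda>n. L (F n))"
    by (rule pint_convergent[OF T], simp)
      (rule L_from_W[of "\<lambda>m n p. F m p - F n p"], auto intro!: diff_T T ecauchy_W[OF F])
qed

lemma ecauchy_const: "f \<in> T \<Longrightarrow> ecauchy (\<lambda>n. f)"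
  using E_scale[of f 0] by (auto simp: ecauchy_def)

lemma cvx_tail_T:
  assumes "\<And>n. \<psi> n \<in> T" "f \<in> cvx_tail \<psi> m"
  shows "f \<in> T"
  using assms(2) by induction (auto intro: lincomb assms(1))

text \<open>The squared L^2 distance to g is convex, so a bound along the tail passes to every
  convex combination of it.\<close>

lemma cvx_tail_L:
  assumes \<psi>: "\<And>n. \<psi> n \<in> T" and g: "g \<in> T" and \<eta>: "\<And>n. m \<le> n \<Longrightarrow> L (\<lambda>p. \<psi> n p - g p) \<le> \<eta>"
    and f: "f \<in> cvx_tail \<psi> m"
  shows "L (\<lambda>p. f p - g p) \<le> \<eta>"
  using f
proof induction
  case (step f h t)
  have T: "f \<in> T" "h \<in> T" using step cvx_tail_T[OF \<psi>] by auto
  note c = cont[OF T(1)] cont[OF T(2)] cont[OF g]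
  have "L (\<lambda>p. (1 - t) * f p + t * h p - g p) \<le> (LINT x:\<Omega>|lborel. (1 - t) * (f (x, 0) - g (x, 0))\<^sup>2 + t * (h (x, 0) - g (x, 0))\<^sup>2)"
    unfolding pint_2
  proof (rule LINT_mono)
    fix x
    have "0 \<le> t * (1 - t) * (f (x, 0) - h (x, 0))\<^sup>2" using step by (intro mult_nonneg_nonneg) auto
    then show "((1 - t) * f (x, 0) + t * h (x, 0) - g (x, 0))\<^sup>2 \<le> (1 - t) * (f (x, 0) - g (x, 0))\<^sup>2 + t * (h (x, 0) - g (x, 0))\<^sup>2"
      by (simp add: power2_eq_square algebra_simps)
  qed (intro continuous_intros c)+
  also have "\<dots> = (1 - t) * L (\<lambda>p. f p - g p) + t * L (\<lambda>p. h p - g p)"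
    unfolding pint_2 by (subst set_integral_add, (intro integ continuous_intros c)+) simp
  also have "\<dots> \<le> (1 - t) * \<eta> + t * \<eta>" using step by (intro add_mono mult_left_mono) auto
  finally show ?case by (simp add: algebra_simps)
qed (rule \<eta>)

lemma bounded_trace:
  assumes "f \<in> T"
  obtains M where "\<And>x. x \<in> \<Omega> \<Longrightarrow> \<bar>f (x, 0)\<bar> \<le> M"
proof -
  have "compact ((\<lambda>x. f (x, 0)) ` closure \<Omega>)"
    using cont[OF assms] bd by (intro compact_continuous_image) (auto simp: compact_closure intro: continuous_on_subset)
  then obtain M where "\<And>x. x \<in> closure \<Omega> \<Longrightarrow> \<bar>f (x, 0)\<bar> \<le> M"
    by (metis bounded_real compact_imp_bounded image_eqI)
  then show thesis using that closure_subset[of \<Omega>] by blast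
qed

text \<open>A Brezis--Lieb lemma without a limit function: the Cauchy sequence \<open>\<sigma>\<close> stands for the limit,
  and it is replaced by one fixed bounded member \<open>\<sigma> l\<close> up to a small error.\<close>
lemma brezis_lieb:
  assumes \<psi>: "\<And>n. \<psi> n \<in> T" and \<sigma>: "ecauchy \<sigma>" and K: "\<And>n. W (\<psi> n) \<le> K"
    and L0: "(\<lambda>n. L (\<lambda>p. \<psi> n p - \<sigma> n p)) \<longlonglongrightarrow> 0"
  shows "(\<lambda>n. W (\<psi> n) - W (\<lambda>p. \<psi> n p - \<sigma> n p) - W (\<sigma> n)) \<longlonglongrightarrow> 0"
proof -
  have \<sigma>T: "\<sigma> n \<in> T" for n using \<sigma> by (simp add: ecauchy_def)
  have K0: "0 \<le> K" using K[of 0] pint_nonneg[of q "\<lambda>x. \<psi> 0 (x, 0)"] by simp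
  have "Bseq (\<lambda>n. W (\<sigma> n))" using ecauchy_convergent(2)[OF \<sigma>] convergent_imp_Bseq by blast
  then obtain K1 where K1: "0 < K1" "\<And>n. W (\<sigma> n) \<le> K1" unfolding Bseq_def by (auto simp: abs_le_iff)
  obtain C0 where C0: "0 \<le> C0" "\<And>u v. continuous_on UNIV u \<Longrightarrow> continuous_on UNIV v \<Longrightarrow>
    \<bar>pint q \<Omega> u - pint q \<Omega> v\<bar> \<le> 1 * pint q \<Omega> v + C0 * pint q \<Omega> (\<lambda>x. u x - v x)"
    using pint_perturb[OF q0, of 1] by auto
  define K2 where "K2 = 2 * K + C0 * K1"
  have K2: "W (\<lambda>p. \<psi> n p - \<sigma> n p) \<le> K2" for n
  proof -
    have "\<bar>W (\<lambda>p. \<psi> n p - \<sigma> n p) - W (\<psi> n)\<bar> \<le> 1 * W (\<psi> n) + C0 * W (\<lambda>p. - \<sigma> n p)"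
      using C0(2)[OF cont[OF diff_T[OF \<psi>[of n] \<sigma>T[of n]]] cont[OF \<psi>[of n]]] by simp
    moreover have "W (\<lambda>p. - \<sigma> n p) = W (\<sigma> n)" using pint_scale[of q "- 1" "\<lambda>x. \<sigma> n (x, 0)"] by simp
    moreover have "C0 * W (\<sigma> n) \<le> C0 * K1" using C0 K1 by (intro mult_left_mono) auto
    ultimately show ?thesis using K[of n] by (simp add: K2_def abs_le_iff)
  qed
  have K20: "0 \<le> K2" using K0 C0 K1 by (simp add: K2_def)
  have \<mu>0: "0 \<le> \<mu>" by simp
  show ?thesis
  proof (rule LIMSEQ_I)
    fix r :: real assume r: "0 < r"
    \<comment> \<open>D0 dominates every mass that \<epsilon> will multiply. Six error terms of size
      r / 8 arise in all, which leaves room for the strict inequality.\<close>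
    define D0 where "D0 = K + K1 + K2 + \<mu> + 1"
    define \<epsilon> where "\<epsilon> = r / (8 * D0)"
    have den: "0 < D0" unfolding D0_def using K0 K1 K20 \<mu>0 by linarith
    have \<epsilon>: "0 < \<epsilon>" using r den by (simp add: \<epsilon>_def)
    have \<epsilon>1: "\<epsilon> * X \<le> r / 8" if "X \<le> K + K1 + K2 + \<mu> + 1" for X
    proof -
      have "\<epsilon> * X \<le> \<epsilon> * D0" using that \<epsilon> unfolding D0_def by (intro mult_left_mono) auto
      also have "\<dots> = r / 8" using den by (simp add: \<epsilon>_def)
      finally show ?thesis .
    qed
    obtain C where C: "0 \<le> C" "\<And>u v. continuous_on UNIV u \<Longrightarrow> continuous_on UNIV v \<Longrightarrow>
      \<bar>pint q \<Omega> u - pint q \<Omega> v\<bar> \<le> \<epsilon> * pint q \<Omega> v + C * pint q \<Omega> (\<lambda>x. u x - v x)"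
      using pint_perturb[OF q0 \<epsilon>] by blast
    have "0 < r / (8 * (C + 1))" using r C by simp
    from ecauchy_W[OF \<sigma> this] obtain l where l: "\<And>m n. l \<le> m \<Longrightarrow> l \<le> n \<Longrightarrow> W (\<lambda>p. \<sigma> m p - \<sigma> n p) < r / (8 * (C + 1))"
      by blast
    have Cl: "C * W (\<lambda>p. \<sigma> m p - \<sigma> n p) \<le> r / 8" if "l \<le> m" "l \<le> n" for m n
    proof -
      have "C * W (\<lambda>p. \<sigma> m p - \<sigma> n p) \<le> C * (r / (8 * (C + 1)))" using l[OF that] C by (intro mult_left_mono) auto
      also have "\<dots> \<le> r / 8" using C r by (simp add: field_simps)
      finally show ?thesis .
    qed
    \<comment> \<open>Mv, and with it D, depends on l but not on n; hence l is fixed before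
      n0.\<close>
    obtain Mv where Mv: "\<And>x. x \<in> \<Omega> \<Longrightarrow> \<bar>\<sigma> l (x, 0)\<bar> \<le> Mv" using bounded_trace[OF \<sigma>T] by blast
    obtain D where D: "0 \<le> D" "\<And>a b. continuous_on UNIV a \<Longrightarrow> continuous_on UNIV b \<Longrightarrow> (\<And>x. x \<in> \<Omega> \<Longrightarrow> \<bar>b x\<bar> \<le> Mv) \<Longrightarrow>
      \<bar>pint q \<Omega> (\<lambda>x. a x + b x) - pint q \<Omega> a - pint q \<Omega> b\<bar> \<le> \<epsilon> * (pint q \<Omega> a + \<mu>) + D * pint 2 \<Omega> a"
    proof (rule pint_decouple[OF q2 \<epsilon>, of Mv])
      fix D assume D: "0 \<le> D" "\<And>a b. continuous_on UNIV a \<Longrightarrow> continuous_on UNIV b \<Longrightarrow> (\<And>x. x \<in> \<Omega> \<Longrightarrow> \<bar>b x\<bar> \<le> Mv) \<Longrightarrow>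
        \<bar>pint q \<Omega> (\<lambda>x. a x + b x) - pint q \<Omega> a - pint q \<Omega> b\<bar> \<le> \<epsilon> * (pint q \<Omega> a + \<mu>) + D * pint 2 \<Omega> a"
      show thesis by (rule that[OF D])
    qed
    have "0 < r / (8 * (D + 1))" using r D by simp
    with L0 obtain n0 where n0: "\<And>n. n0 \<le> n \<Longrightarrow> norm (L (\<lambda>p. \<psi> n p - \<sigma> n p) - 0) < r / (8 * (D + 1))"
      using LIMSEQ_D by blast
    show "\<exists>no. \<forall>n\<ge>no. norm (W (\<psi> n) - W (\<lambda>p. \<psi> n p - \<sigma> n p) - W (\<sigma> n) - 0) < r"
    proof (intro exI[of _ "max l n0"] allI impI)
      fix n assume n: "max l n0 \<le> n"
      define a where "a x = \<psi> n (x, 0) - \<sigma> n (x, 0)" for x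
      define v where "v x = \<sigma> l (x, 0)" for x
      define b where "b x = \<sigma> n (x, 0)" for x
      have eqs: "pint r \<Omega> a = pint r \<Omega> (\<lambda>x. \<psi> n (x, 0) - \<sigma> n (x, 0))" "pint r \<Omega> b = pint r \<Omega> (\<lambda>x. \<sigma> n (x, 0))"
        "pint r \<Omega> v = pint r \<Omega> (\<lambda>x. \<sigma> l (x, 0))" for r
        by (simp_all add: a_def[abs_def] b_def[abs_def] v_def[abs_def])
      have c: "continuous_on UNIV a" "continuous_on UNIV v" "continuous_on UNIV b"
        unfolding a_def[abs_def] v_def[abs_def] b_def[abs_def] by (intro continuous_intros cont \<psi> \<sigma>T)+
      have e1: "\<bar>pint q \<Omega> (\<lambda>x. a x + v x) - pint q \<Omega> (\<lambda>x. a x + b x)\<bar> \<le> r / 4"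
      proof -
        have "\<bar>pint q \<Omega> (\<lambda>x. a x + v x) - pint q \<Omega> (\<lambda>x. a x + b x)\<bar> \<le>
          \<epsilon> * pint q \<Omega> (\<lambda>x. a x + b x) + C * pint q \<Omega> (\<lambda>x. (a x + v x) - (a x + b x))"
          by (intro C(2) continuous_intros c)
        also have "(\<lambda>x. (a x + v x) - (a x + b x)) = (\<lambda>x. \<sigma> l (x, 0) - \<sigma> n (x, 0))" by (simp add: v_def b_def)
        also have "(\<lambda>x. a x + b x) = (\<lambda>x. \<psi> n (x, 0))" by (simp add: a_def b_def)
        also have "\<epsilon> * W (\<psi> n) + C * W (\<lambda>p. \<sigma> l p - \<sigma> n p) \<le> r / 8 + r / 8"
        proof (intro add_mono \<epsilon>1 Cl)
          show "W (\<psi> n) \<le> K + K1 + K2 + \<mu> + 1" using K[of n] K1(1) K20 \<mu>0 by linarith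
        qed (use n in auto)
        finally show ?thesis by (simp add: a_def b_def)
      qed
      have e2: "\<bar>pint q \<Omega> v - pint q \<Omega> b\<bar> \<le> r / 4"
      proof -
        have "\<bar>pint q \<Omega> v - pint q \<Omega> b\<bar> \<le> \<epsilon> * pint q \<Omega> b + C * pint q \<Omega> (\<lambda>x. v x - b x)"
          by (intro C(2) c)
        also have "\<dots> \<le> r / 8 + r / 8"
          unfolding v_def b_def eqs
        proof (intro add_mono \<epsilon>1 Cl)
          show "W (\<sigma> n) \<le> K + K1 + K2 + \<mu> + 1" using K1(2)[of n] K0 K20 \<mu>0 by linarith
        qed (use n in auto)
        finally show ?thesis by simp
      qed
      have e3: "\<bar>pint q \<Omega> (\<lambda>x. a x + v x) - pint q \<Omega> a - pint q \<Omega> v\<bar> \<le> r / 4"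
      proof -
        have "\<bar>pint q \<Omega> (\<lambda>x. a x + v x) - pint q \<Omega> a - pint q \<Omega> v\<bar> \<le> \<epsilon> * (pint q \<Omega> a + \<mu>) + D * pint 2 \<Omega> a"
          using Mv by (intro D(2) c) (simp add: v_def)
        also have "\<dots> \<le> r / 8 + r / 8"
        proof (rule add_mono[OF \<epsilon>1])
          show "pint q \<Omega> a + \<mu> \<le> K + K1 + K2 + \<mu> + 1" using K2[of n] K0 K1(1) by (simp add: eqs)
          have "D * pint 2 \<Omega> a \<le> D * (r / (8 * (D + 1)))"
            using n0[of n] n D by (intro mult_left_mono) (auto simp: eqs abs_less_iff)
          also have "\<dots> \<le> r / 8" using D r by (simp add: field_simps)
          finally show "D * pint 2 \<Omega> a \<le> r / 8" .
        qed
        finally show ?thesis by simp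
      qed
      have "\<bar>pint q \<Omega> (\<lambda>x. a x + b x) - pint q \<Omega> a - pint q \<Omega> b\<bar> \<le> 3 * r / 4"
        using e1 e2 e3 by linarith
      moreover have "(\<lambda>x. a x + b x) = (\<lambda>x. \<psi> n (x, 0))" by (simp add: a_def b_def)
      ultimately show "norm (W (\<psi> n) - W (\<lambda>p. \<psi> n p - \<sigma> n p) - W (\<sigma> n) - 0) < r"
        using r by (simp add: eqs)
    qed
  qed
qed

end

lemma tendsto_le_everywhere:
  fixes x y :: real
  assumes "\<And>n. X n \<le> Y n" "X \<longlonglongrightarrow> x" "Y \<longlonglongrightarrow> y"
  shows "x \<le> y"
  using assms by (intro LIMSEQ_le[OF assms(2,3)]) auto

section \<open>Convex combinations of a minimising sequence and attainment\<close>

context trace_minimisation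
begin

text \<open>A substitute for weak limits: almost minimal convex combinations \<open>\<sigma> n\<close> of the tails form a
  Cauchy sequence, and minimality against \<open>(1 - t) \<sigma> n + t \<psi> n\<close> gives one half of the Pythagorean
  identity for \<open>\<psi> n\<close>, \<open>\<sigma> n\<close>, which is all that is needed.\<close>
lemma cvx_tail_minimising:
  assumes \<psi>: "\<And>n. \<psi> n \<in> T" and M: "\<And>n. E (\<psi> n) \<le> M"
  obtains \<sigma> where "ecauchy \<sigma>" "\<And>n. \<sigma> n \<in> cvx_tail \<psi> n"
    "\<And>n t. 0 < t \<Longrightarrow> t < 1 \<Longrightarrow> (1 - t) * E (\<lambda>p. \<sigma> n p - \<psi> n p) \<le> E (\<psi> n) - E (\<sigma> n) + 1 / Suc n / t"
proof -
  have M0: "0 \<le> M" using E_nonneg[OF \<psi>] M order_trans by blast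
  define d where "d m = Inf (E ` cvx_tail \<psi> m)" for m
  have ne: "E ` cvx_tail \<psi> m \<noteq> {}" for m using cvx_tail.base[of m m \<psi>] by blast
  have bb: "bdd_below (E ` cvx_tail \<psi> m)" for m
    by (rule bdd_belowI[of _ 0]) (auto intro: E_nonneg cvx_tail_T[OF \<psi>])
  have d_le: "d m \<le> E f" if "f \<in> cvx_tail \<psi> m" for f m
    unfolding d_def using that bb by (intro cInf_lower) auto
  have "\<exists>f \<in> cvx_tail \<psi> m. E f < d m + 1 / Suc m" for m
    using cInf_lessD[OF ne, of m "d m + 1 / Suc m"] by (auto simp: d_def)
  then obtain \<sigma> where \<sigma>: "\<And>m. \<sigma> m \<in> cvx_tail \<psi> m" "\<And>m. E (\<sigma> m) < d m + 1 / Suc m" by metis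
  have \<sigma>T: "\<sigma> m \<in> T" for m using cvx_tail_T[OF \<psi> \<sigma>(1)] .
  \<comment> \<open>Tails shrink, so their infima increase; they stay below M and therefore
    converge.\<close>
  have "incseq d" unfolding incseq_def
  proof (intro allI impI)
    fix m n :: nat assume "m \<le> n"
    then show "d m \<le> d n" unfolding d_def[of n]
      by (intro cInf_greatest ne) (auto intro!: d_le intro: cvx_tail_antimono)
  qed
  have "d n \<le> M" for n using d_le[OF cvx_tail.base[of n n \<psi>]] M[of n] by simp
  then have "\<forall>n. d n \<le> M" by blast
  then obtain b where b: "d \<longlonglongrightarrow> b" using incseq_convergent[OF \<open>incseq d\<close>, of M] by blast
  have inv: "(\<lambda>n. 1 / real (Suc n)) \<longlonglongrightarrow> 0" by (rule LIMSEQ_Suc[OF lim_1_over_n])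
  \<comment> \<open>The midpoint belongs to the hull of the tail from m, so its energy is at least
    \<open>d m\<close>; the parallelogram law bounds the distance by the growth of d and the two
    near-minimality errors.\<close>
  have EC: "E (\<lambda>p. \<sigma> m p - \<sigma> n p) \<le> 2 * (d n - d m) + 2 * (1 / Suc m) + 2 * (1 / Suc n)" if "m \<le> n" for m n
  proof -
    have "(\<lambda>p. (1 - 1 / 2) * \<sigma> m p + 1 / 2 * \<sigma> n p) \<in> cvx_tail \<psi> m"
      by (rule cvx_tail.step) (auto intro: \<sigma> cvx_tail_antimono[OF that])
    from d_le[OF this] have "d m \<le> (1 - 1 / 2) * E (\<sigma> m) + 1 / 2 * E (\<sigma> n) - 1 / 2 * (1 - 1 / 2) * E (\<lambda>p. \<sigma> m p - \<sigma> n p)"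
      by (simp only: E_conv \<sigma>T)
    then show ?thesis using \<sigma>(2)[of m] \<sigma>(2)[of n] by simp
  qed
  have symm: "E (\<lambda>p. f p - g p) = E (\<lambda>p. g p - f p)" if "f \<in> T" "g \<in> T" for f g
    using E_scale[OF diff_T[OF that], of "- 1"] by simp
  have "ecauchy \<sigma>" unfolding ecauchy_def
  proof (intro conjI allI impI \<sigma>T)
    fix e :: real assume e: "0 < e"
    define c where "c = e / 16"
    have c: "0 < c" using e by (simp add: c_def)
    have "\<forall>\<^sub>F n in sequentially. 1 / real (Suc n) < c" using inv c by (intro order_tendstoD) auto
    moreover have "\<forall>\<^sub>F n in sequentially. dist (d n) b < c" using b c by (intro tendstoD) auto
    ultimately have "\<forall>\<^sub>F n in sequentially. 1 / real (Suc n) < c \<and> dist (d n) b < c"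
      by (rule eventually_conj)
    then obtain N where N: "\<And>n. N \<le> n \<Longrightarrow> 1 / real (Suc n) < c \<and> dist (d n) b < c"
      unfolding eventually_sequentially by blast
    have one: "E (\<lambda>p. \<sigma> m p - \<sigma> n p) < e" if mn: "N \<le> m" "m \<le> n" for m n
    proof -
      have "b - d m < c" "d n - b < c"
        using N[of m] N[of n] mn by (auto simp: dist_real_def abs_less_iff)
      moreover have "1 / real (Suc m) < c" "1 / real (Suc n) < c" using N[of m] N[of n] mn by auto
      moreover have "2 * (d n - d m) + 2 * x + 2 * y < 8 * c" if "b - d m < c" "d n - b < c" "x < c" "y < c" for x y
      proof -
        have "d n - d m < 2 * c" using that by linarith
        then have "2 * (d n - d m) < 4 * c" by simp
        moreover have "2 * x < 2 * c" "2 * y < 2 * c" using that by auto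
        ultimately show ?thesis by linarith
      qed
      ultimately have "2 * (d n - d m) + 2 * (1 / real (Suc m)) + 2 * (1 / real (Suc n)) < 8 * c" by blast
      also have "8 * c < e" using e by (simp add: c_def)
      finally show ?thesis using EC[OF mn(2)] by (rule le_less_trans[rotated])
    qed
    show "\<exists>M. \<forall>m\<ge>M. \<forall>n\<ge>M. E (\<lambda>p. \<sigma> m p - \<sigma> n p) < e"
    proof (intro exI[of _ N] allI impI)
      fix m n assume "N \<le> m" "N \<le> n"
      then show "E (\<lambda>p. \<sigma> m p - \<sigma> n p) < e"
        using one[of m n] one[of n m] symm[OF \<sigma>T \<sigma>T, of m n] by (cases "m \<le> n") auto
    qed
  qed
  \<comment> \<open>Division by t inflates the near-minimality error to 1 / Suc n / t; a parameter
    tending to 0 has to do so more slowly than 1 / n.\<close>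
  moreover have "(1 - t) * E (\<lambda>p. \<sigma> n p - \<psi> n p) \<le> E (\<psi> n) - E (\<sigma> n) + 1 / Suc n / t" if t: "0 < t" "t < 1" for n t
  proof -
    have "(\<lambda>p. (1 - t) * \<sigma> n p + t * \<psi> n p) \<in> cvx_tail \<psi> n"
      by (rule cvx_tail.step) (use t in \<open>auto intro: \<sigma> cvx_tail.base\<close>)
    from d_le[OF this] have "d n \<le> (1 - t) * E (\<sigma> n) + t * E (\<psi> n) - t * (1 - t) * E (\<lambda>p. \<sigma> n p - \<psi> n p)"
      by (simp only: E_conv \<sigma>T \<psi>)
    then have "t * ((1 - t) * E (\<lambda>p. \<sigma> n p - \<psi> n p)) \<le> t * (E (\<psi> n) - E (\<sigma> n)) + 1 / Suc n"
      using \<sigma>(2)[of n] by (simp add: algebra_simps)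
    then have "(1 - t) * E (\<lambda>p. \<sigma> n p - \<psi> n p) \<le> (t * (E (\<psi> n) - E (\<sigma> n)) + 1 / Suc n) / t"
      using t(1) by (subst pos_le_divide_eq) (simp_all add: mult.commute)
    also have "\<dots> = E (\<psi> n) - E (\<sigma> n) + 1 / Suc n / t" using t(1) by (simp only: add_divide_distrib) simp
    finally show ?thesis .
  qed
  ultimately show thesis using that \<sigma>(1) by blast
qed

lemma normalise:
  assumes f: "f \<in> T" and W: "0 < W f"
  obtains g where "g \<in> T" "W g = 1" "E g = E f / W f powr (2 / q)" "L g = L f / W f powr (2 / q)"
proof -
  define c where "c = W f powr (- (1 / q))"
  have c: "0 < c" "c powr q = 1 / W f" "c\<^sup>2 = 1 / W f powr (2 / q)"
  proof -
    show "0 < c" using W by (simp add: c_def)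
    show "c powr q = 1 / W f" unfolding c_def powr_powr using W q0 by (simp add: powr_minus_divide)
    have "c\<^sup>2 = c powr 2" using \<open>0 < c\<close> by (simp add: powr_numeral)
    also have "\<dots> = 1 / W f powr (2 / q)" unfolding c_def powr_powr using W by (simp add: powr_minus_divide)
    finally show "c\<^sup>2 = 1 / W f powr (2 / q)" .
  qed
  show thesis
  proof (rule that[of "\<lambda>p. c * f p"])
    show "(\<lambda>p. c * f p) \<in> T" by (rule scale_T[OF f])
    show "W (\<lambda>p. c * f p) = 1" using c W by (simp add: pint_scale)
    show "E (\<lambda>p. c * f p) = E f / W f powr (2 / q)" using c by (simp add: E_scale[OF f])
    show "L (\<lambda>p. c * f p) = L f / W f powr (2 / q)" using c by (simp add: pint_scale powr_numeral)
  qed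
qed

text \<open>The quotients are multiplied out, so that \<open>st_le\<close> also covers \<psi> n -
  \<sigma> n, whose critical mass may vanish. It carries no term with \<open>lam\<close>, as the L^2
  mass of this difference tends to 0. In contrast \<open>sl_le\<close> speaks of Cauchy sequences,
  since it is applied to the limit element \<sigma>.\<close>

lemma minimum_attained:
  fixes lam sl st :: real
  assumes lam: "0 \<le> lam" and sl_st: "sl < st"
    and st_le: "\<And>f. f \<in> T \<Longrightarrow> st * W f powr (2 / q) \<le> E f"
    and st0: "0 \<le> st"
    and sl_le: "\<And>F. ecauchy F \<Longrightarrow> 0 < lim (\<lambda>n. W (F n)) \<Longrightarrow>
       sl * lim (\<lambda>n. W (F n)) powr (2 / q) \<le> lim (\<lambda>n. E (F n)) - lam * lim (\<lambda>n. L (F n))"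
    and min: "\<And>\<epsilon>. 0 < \<epsilon> \<Longrightarrow> \<exists>F. ecauchy F \<and> 0 < lim (\<lambda>n. W (F n)) \<and>
       lim (\<lambda>n. E (F n)) - lam * lim (\<lambda>n. L (F n)) < (sl + \<epsilon>) * lim (\<lambda>n. W (F n)) powr (2 / q)"
  shows "\<exists>F. ecauchy F \<and> 0 < lim (\<lambda>n. W (F n)) \<and>
       lim (\<lambda>n. E (F n)) - lam * lim (\<lambda>n. L (F n)) = sl * lim (\<lambda>n. W (F n)) powr (2 / q)"
proof -
  have \<mu>0: "0 \<le> \<mu>" by simp
  have L_le: "L f \<le> W f + \<mu>" if "f \<in> T" for f using L_small[OF that, of 1] by simp
  \<comment> \<open>The strict inequality survives at a late member of the Cauchy sequence, so a
    competitor in the completion can be replaced by one function of T and normalised.\<close>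
  have ex: "\<exists>g\<in>T. W g = 1 \<and> E g - lam * L g < sl + \<epsilon>" if \<epsilon>: "0 < \<epsilon>" for \<epsilon>
  proof -
    obtain F where F: "ecauchy F" "0 < lim (\<lambda>n. W (F n))"
      "lim (\<lambda>n. E (F n)) - lam * lim (\<lambda>n. L (F n)) < (sl + \<epsilon>) * lim (\<lambda>n. W (F n)) powr (2 / q)"
      using min[OF \<epsilon>] by blast
    note lims = ecauchy_convergent[OF F(1), THEN convergent_LIMSEQ_iff[THEN iffD1]]
    have "(\<lambda>n. (sl + \<epsilon>) * W (F n) powr (2 / q) - (E (F n) - lam * L (F n))) \<longlonglongrightarrow>
      (sl + \<epsilon>) * lim (\<lambda>n. W (F n)) powr (2 / q) - (lim (\<lambda>n. E (F n)) - lam * lim (\<lambda>n. L (F n)))"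
      using F(2) by (intro tendsto_intros lims) auto
    then have "\<forall>\<^sub>F n in sequentially. 0 < (sl + \<epsilon>) * W (F n) powr (2 / q) - (E (F n) - lam * L (F n))"
      by (rule order_tendstoD(1)) (use F(3) in simp)
    moreover have "\<forall>\<^sub>F n in sequentially. 0 < W (F n)" by (rule order_tendstoD(1)[OF lims(2) F(2)])
    ultimately have "\<forall>\<^sub>F n in sequentially. 0 < (sl + \<epsilon>) * W (F n) powr (2 / q) - (E (F n) - lam * L (F n)) \<and> 0 < W (F n)"
      by (rule eventually_conj)
    then obtain n where n: "0 < (sl + \<epsilon>) * W (F n) powr (2 / q) - (E (F n) - lam * L (F n))" "0 < W (F n)"
      unfolding eventually_sequentially by blast
    have FT: "F n \<in> T" using F by (simp add: ecauchy_def)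
    obtain g where g: "g \<in> T" "W g = 1" "E g = E (F n) / W (F n) powr (2 / q)" "L g = L (F n) / W (F n) powr (2 / q)"
      using normalise[OF FT n(2)] by blast
    have "E g - lam * L g = (E (F n) - lam * L (F n)) / W (F n) powr (2 / q)"
      unfolding g by (simp add: diff_divide_distrib)
    also have "\<dots> < sl + \<epsilon>" using n by (simp add: field_simps)
    finally show ?thesis using g by blast
  qed
  have "\<exists>g. g \<in> T \<and> W g = 1 \<and> E g - lam * L g < sl + 1 / Suc n" for n using ex[of "1 / Suc n"] by auto
  then obtain \<phi> where \<phi>: "\<And>n. \<phi> n \<in> T" "\<And>n. W (\<phi> n) = 1" "\<And>n. E (\<phi> n) - lam * L (\<phi> n) < sl + 1 / Suc n" by metis
  \<comment> \<open>At critical mass 1 the L^2 mass is at most 1 + \<mu>, so bounded quotients mean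
    bounded energies.\<close>
  define M where "M = sl + 1 + lam * (1 + \<mu>)"
  have \<phi>M: "E (\<phi> n) \<le> M" for n
  proof -
    have "lam * L (\<phi> n) \<le> lam * (1 + \<mu>)" using L_le[OF \<phi>(1)[of n]] \<phi>(2)[of n] lam by (intro mult_left_mono) auto
    moreover have "1 / real (Suc n) \<le> 1" by simp
    ultimately show ?thesis using \<phi>(3)[of n] unfolding M_def by linarith
  qed
  obtain k :: "nat \<Rightarrow> nat" where k: "strict_mono k" "\<And>\<epsilon>. 0 < \<epsilon> \<Longrightarrow> \<exists>n0. \<forall>m\<ge>n0. \<forall>n\<ge>n0.
           pint 2 \<Omega> (\<lambda>x. \<phi> (k m) (x, 0) - \<phi> (k n) (x, 0)) < \<epsilon>"
    using compact_trace[of \<phi> M] \<phi>(1) \<phi>M by blast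
  define \<psi> where "\<psi> n = \<phi> (k n)" for n
  have \<psi>: "\<And>n. \<psi> n \<in> T" "\<And>n. W (\<psi> n) = 1" "\<And>n. E (\<psi> n) \<le> M" using \<phi> \<phi>M by (auto simp: \<psi>_def)
  have inv: "(\<lambda>n. 1 / real (Suc n)) \<longlonglongrightarrow> 0" by (rule LIMSEQ_Suc[OF lim_1_over_n])
  have \<psi>Q: "(\<lambda>n. E (\<psi> n) - lam * L (\<psi> n)) \<longlonglongrightarrow> sl"
  proof (rule tendsto_sandwich[OF _ _ tendsto_const])
    have "sl \<le> E (\<psi> n) - lam * L (\<psi> n)" for n
      using sl_le[OF ecauchy_const[OF \<psi>(1)[of n]]] \<psi>(2)[of n] by simp
    then show "\<forall>\<^sub>F n in sequentially. sl \<le> E (\<psi> n) - lam * L (\<psi> n)" by simp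
    have "E (\<psi> n) - lam * L (\<psi> n) \<le> sl + 1 / real (Suc n)" for n
    proof -
      have "n \<le> k n" using k(1) by (rule strict_mono_imp_increasing)
      then have "1 / real (Suc (k n)) \<le> 1 / real (Suc n)" by (intro divide_left_mono) auto
      then show ?thesis using \<phi>(3)[of "k n"] by (simp add: \<psi>_def)
    qed
    then show "\<forall>\<^sub>F n in sequentially. E (\<psi> n) - lam * L (\<psi> n) \<le> sl + 1 / real (Suc n)" by simp
    show "(\<lambda>n. sl + 1 / real (Suc n)) \<longlonglongrightarrow> sl" using tendsto_add[OF tendsto_const inv, of sl] by simp
  qed
  have "convergent (\<lambda>n. L (\<psi> n))" by (rule pint_convergent[OF \<psi>(1)]) (use k(2) in \<open>auto simp: \<psi>_def\<close>)
  then obtain \<iota> where \<iota>: "(\<lambda>n. L (\<psi> n)) \<longlonglongrightarrow> \<iota>" by (auto simp: convergent_def)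
  define e where "e = sl + lam * \<iota>"
  have e: "(\<lambda>n. E (\<psi> n)) \<longlonglongrightarrow> e"
    using tendsto_add[OF \<psi>Q tendsto_mult_left[OF \<iota>, of lam]] by (simp add: e_def)
  obtain \<sigma> where \<sigma>: "ecauchy \<sigma>" "\<And>n. \<sigma> n \<in> cvx_tail \<psi> n"
    "\<And>n t. 0 < t \<Longrightarrow> t < 1 \<Longrightarrow> (1 - t) * E (\<lambda>p. \<sigma> n p - \<psi> n p) \<le> E (\<psi> n) - E (\<sigma> n) + 1 / Suc n / t"
  proof (rule cvx_tail_minimising[of \<psi> M, OF \<psi>(1,3)])
    fix \<sigma> assume \<sigma>: "ecauchy \<sigma>" "\<And>n. \<sigma> n \<in> cvx_tail \<psi> n"
      "\<And>n t. 0 < t \<Longrightarrow> t < 1 \<Longrightarrow> (1 - t) * E (\<lambda>p. \<sigma> n p - \<psi> n p) \<le> E (\<psi> n) - E (\<sigma> n) + 1 / Suc n / t"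
    show thesis by (rule that[OF \<sigma>])
  qed
  have \<sigma>T: "\<sigma> n \<in> T" for n using \<sigma> by (simp add: ecauchy_def)
  have symE: "E (\<lambda>p. \<sigma> n p - \<psi> n p) = E (\<lambda>p. \<psi> n p - \<sigma> n p)" for n
    using E_scale[OF diff_T[OF \<psi>(1) \<sigma>T], of "- 1"] by simp
  have symL: "L (\<lambda>p. g p - f p) = L (\<lambda>p. f p - g p)" for f g
    using pint_scale[of 2 "- 1" "\<lambda>x. f (x, 0) - g (x, 0)"] by simp
  define b \<theta> where "b = lim (\<lambda>n. E (\<sigma> n))" and "\<theta> = lim (\<lambda>n. W (\<sigma> n))"
  have b: "(\<lambda>n. E (\<sigma> n)) \<longlonglongrightarrow> b" and \<theta>: "(\<lambda>n. W (\<sigma> n)) \<longlonglongrightarrow> \<theta>"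
    using ecauchy_convergent[OF \<sigma>(1)] by (simp_all add: b_def \<theta>_def convergent_LIMSEQ_iff)
  have b0: "0 \<le> b" using b by (rule LIMSEQ_le_const) (auto intro: E_nonneg \<sigma>T)
  \<comment> \<open>Far out, the whole tail is L^2-close to \<psi> n, and the convex combination
    \<sigma> n of the tail inherits this.\<close>
  have L0: "(\<lambda>n. L (\<lambda>p. \<psi> n p - \<sigma> n p)) \<longlonglongrightarrow> 0"
  proof (rule LIMSEQ_I)
    fix r :: real assume r: "0 < r"
    then have "0 < r / 2" by simp
    from k(2)[OF this] obtain n0 where n0: "\<And>m n. n0 \<le> m \<Longrightarrow> n0 \<le> n \<Longrightarrow> L (\<lambda>p. \<psi> m p - \<psi> n p) < r / 2"
      unfolding \<psi>_def by blast
    have "norm (L (\<lambda>p. \<psi> n p - \<sigma> n p) - 0) < r" if n: "n0 \<le> n" for n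
    proof -
      have "L (\<lambda>p. \<sigma> n p - \<psi> n p) \<le> r / 2"
        by (rule cvx_tail_L[OF \<psi>(1) \<psi>(1) _ \<sigma>(2)]) (use n0 n in \<open>auto intro!: less_imp_le\<close>)
      then show ?thesis using r pint_nonneg[of 2 "\<lambda>x. \<psi> n (x, 0) - \<sigma> n (x, 0)"] symL[of "\<psi> n" "\<sigma> n"] by simp
    qed
    then show "\<exists>no. \<forall>n\<ge>no. norm (L (\<lambda>p. \<psi> n p - \<sigma> n p) - 0) < r" by blast
  qed
  have L\<sigma>: "(\<lambda>n. L (\<sigma> n)) \<longlonglongrightarrow> \<iota>"
  proof -
    obtain \<iota>' where \<iota>': "(\<lambda>n. L (\<sigma> n)) \<longlonglongrightarrow> \<iota>'" using ecauchy_convergent(3)[OF \<sigma>(1)] by (auto simp: convergent_def)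
    have "\<bar>\<iota>' - \<iota>\<bar> \<le> \<epsilon>' * \<iota>" if \<epsilon>': "0 < \<epsilon>'" for \<epsilon>'
    proof -
      have two: "(0::real) < 2" by simp
      from pint_perturb[OF two \<epsilon>'] obtain C where C: "0 \<le> C" "\<And>u v. continuous_on UNIV u \<Longrightarrow> continuous_on UNIV v \<Longrightarrow>
        \<bar>pint 2 \<Omega> u - pint 2 \<Omega> v\<bar> \<le> \<epsilon>' * pint 2 \<Omega> v + C * pint 2 \<Omega> (\<lambda>x. u x - v x)" by blast
      have 1: "\<bar>L (\<sigma> n) - L (\<psi> n)\<bar> \<le> \<epsilon>' * L (\<psi> n) + C * L (\<lambda>p. \<psi> n p - \<sigma> n p)" for n
        using C(2)[OF cont[OF \<sigma>T[of n]] cont[OF \<psi>(1)[of n]]] symL[of "\<sigma> n" "\<psi> n"] by simp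
      have 2: "(\<lambda>n. \<bar>L (\<sigma> n) - L (\<psi> n)\<bar>) \<longlonglongrightarrow> \<bar>\<iota>' - \<iota>\<bar>" by (intro tendsto_intros \<iota> \<iota>')
      have 3: "(\<lambda>n. \<epsilon>' * L (\<psi> n) + C * L (\<lambda>p. \<psi> n p - \<sigma> n p)) \<longlonglongrightarrow> \<epsilon>' * \<iota> + C * 0" by (intro tendsto_intros \<iota> L0)
      show ?thesis using tendsto_le_everywhere[OF 1 2 3] by simp
    qed
    note close = this
    have "\<bar>\<iota>' - \<iota>\<bar> \<le> 0"
    proof (rule field_le_epsilon)
      fix \<eta> :: real assume \<eta>: "0 < \<eta>"
      have "\<bar>\<iota>' - \<iota>\<bar> \<le> \<eta> / (\<bar>\<iota>\<bar> + 1) * \<iota>" using \<eta> by (intro close) simp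
      also have "\<dots> \<le> \<eta> / (\<bar>\<iota>\<bar> + 1) * (\<bar>\<iota>\<bar> + 1)" using \<eta> by (intro mult_left_mono) auto
      also have "\<dots> = \<eta>" by simp
      finally show "\<bar>\<iota>' - \<iota>\<bar> \<le> 0 + \<eta>" by simp
    qed
    then show ?thesis using \<iota>' by simp
  qed
  have "(\<lambda>n. W (\<psi> n) - W (\<lambda>p. \<psi> n p - \<sigma> n p) - W (\<sigma> n)) \<longlonglongrightarrow> 0"
    by (rule brezis_lieb[OF \<psi>(1) \<sigma>(1) _ L0, of 1]) (simp add: \<psi>(2))
  then have "(\<lambda>n. 1 - W (\<sigma> n) - (1 - W (\<lambda>p. \<psi> n p - \<sigma> n p) - W (\<sigma> n))) \<longlonglongrightarrow> 1 - \<theta> - 0"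
    unfolding \<psi>(2) by (intro tendsto_diff tendsto_const \<theta>)
  then have Wd: "(\<lambda>n. W (\<lambda>p. \<psi> n p - \<sigma> n p)) \<longlonglongrightarrow> 1 - \<theta>" by simp
  have \<theta>01: "0 \<le> \<theta>" "\<theta> \<le> 1"
  proof -
    show "0 \<le> \<theta>" using \<theta> by (rule LIMSEQ_le_const) (auto intro: pint_nonneg)
    have "0 \<le> 1 - \<theta>" using Wd by (rule LIMSEQ_le_const) (auto intro: pint_nonneg)
    then show "\<theta> \<le> 1" by simp
  qed
  have key: "st * (1 - \<theta>) powr (2 / q) \<le> e - b"
  proof -
    \<comment> \<open>Both t n and 1 / Suc n / t n have to tend to 0; the reciprocal square root
      achieves this, and the shift by 2 keeps t n below 1 already for n = 0.\<close>
    define t where "t n = 1 / sqrt (real (Suc (Suc n)))" for n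
    have t: "0 < t n" "t n < 1" for n by (auto simp: t_def)
    have t0: "t \<longlonglongrightarrow> 0" unfolding t_def
      by (intro real_tendsto_divide_at_top[OF tendsto_const] filterlim_compose[OF sqrt_at_top]
          filterlim_compose[OF filterlim_real_sequentially] filterlim_compose[OF filterlim_Suc filterlim_Suc])
    have t1: "(\<lambda>n. 1 / real (Suc n) / t n) \<longlonglongrightarrow> 0"
    proof (rule tendsto_sandwich[OF _ _ tendsto_const])
      show "\<forall>\<^sub>F n in sequentially. 0 \<le> 1 / real (Suc n) / t n" using t by (intro always_eventually allI divide_nonneg_pos) auto
      have "1 / real (Suc n) / t n \<le> 2 * t n" for n
      proof -
        define S where "S = real (Suc (Suc n))"
        have S: "0 < S" "sqrt S * sqrt S = S" "S \<le> 2 * real (Suc n)" by (auto simp: S_def)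
        have "1 / real (Suc n) / t n = sqrt S / real (Suc n)" by (simp add: t_def S_def)
        also have "\<dots> \<le> sqrt S / (S / 2)" using S by (intro divide_left_mono) auto
        also have "\<dots> = 2 * t n" using S unfolding t_def S_def[symmetric] by (simp add: field_simps)
        finally show ?thesis .
      qed
      then show "\<forall>\<^sub>F n in sequentially. 1 / real (Suc n) / t n \<le> 2 * t n" by simp
      show "(\<lambda>n. 2 * t n) \<longlonglongrightarrow> 0" using tendsto_mult_left[OF t0, of 2] by simp
    qed
    have 1: "(1 - t n) * (st * W (\<lambda>p. \<psi> n p - \<sigma> n p) powr (2 / q)) \<le> E (\<psi> n) - E (\<sigma> n) + 1 / real (Suc n) / t n" for n
    proof -
      have "(1 - t n) * (st * W (\<lambda>p. \<psi> n p - \<sigma> n p) powr (2 / q)) \<le> (1 - t n) * E (\<lambda>p. \<psi> n p - \<sigma> n p)"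
        using t[of n] st_le[OF diff_T[OF \<psi>(1) \<sigma>T, of n n]] by (intro mult_left_mono) auto
      then show ?thesis using \<sigma>(3)[OF t, of n n] symE[of n] by simp
    qed
    have 2: "(\<lambda>n. (1 - t n) * (st * W (\<lambda>p. \<psi> n p - \<sigma> n p) powr (2 / q))) \<longlonglongrightarrow> (1 - 0) * (st * (1 - \<theta>) powr (2 / q))"
    proof (intro tendsto_mult tendsto_diff tendsto_const t0)
      \<comment> \<open>The limit 1 - \<theta> may be 0; the powers still converge, as the bases are
        nonnegative and the exponent is positive.\<close>
      show "(\<lambda>n. W (\<lambda>p. \<psi> n p - \<sigma> n p) powr (2 / q)) \<longlonglongrightarrow> (1 - \<theta>) powr (2 / q)"
        by (rule tendsto_powr2[OF Wd tendsto_const]) (use q0 pint_nonneg in auto)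
    qed
    have 3: "(\<lambda>n. E (\<psi> n) - E (\<sigma> n) + 1 / real (Suc n) / t n) \<longlonglongrightarrow> e - b + 0" by (intro tendsto_intros e b t1)
    show ?thesis using tendsto_le_everywhere[OF 1 2 3] by simp
  qed
  have p: "0 < 2 / q" "2 / q \<le> 1" using q2 by auto
  \<comment> \<open>Positive mass is required by \<open>sl_le\<close>. If \<theta> were 0, the L^2
    mass would vanish in the limit and give e \<le> sl, whereas \<open>key\<close> would give st
    \<le> e.\<close>
  have \<theta>pos: "0 < \<theta>"
  proof (rule ccontr)
    assume "\<not> 0 < \<theta>"
    then have z: "\<theta> = 0" using \<theta>01 by simp
    have "\<iota> \<le> R\<^sup>2 * \<mu>" if R: "0 < R" for R
    proof -
      have "(\<lambda>n. R powr (2 - q) * W (\<sigma> n) + R\<^sup>2 * \<mu>) \<longlonglongrightarrow> R powr (2 - q) * \<theta> + R\<^sup>2 * \<mu>" by (intro tendsto_intros \<theta>)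
      from tendsto_le_everywhere[OF L_small[OF \<sigma>T R] L\<sigma> this] show ?thesis using z by simp
    qed
    note small = this
    have "\<iota> \<le> 0"
    proof (rule field_le_epsilon)
      fix \<eta> :: real assume \<eta>: "0 < \<eta>"
      have m1: "0 < \<mu> + 1" using \<mu>0 by linarith
      define R where "R = sqrt (\<eta> / (\<mu> + 1))"
      have R: "0 < R" "R\<^sup>2 = \<eta> / (\<mu> + 1)" using \<eta> m1 by (auto simp: R_def)
      have "\<iota> \<le> R\<^sup>2 * \<mu>" by (rule small[OF R(1)])
      also have "\<dots> \<le> R\<^sup>2 * (\<mu> + 1)" by (intro mult_left_mono) auto
      also have "\<dots> = \<eta>" unfolding R(2) by (rule nonzero_eq_divide_eq[THEN iffD1]) (use m1 in auto)
      finally show "\<iota> \<le> 0 + \<eta>" by simp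
    qed
    then have "lam * \<iota> \<le> 0" using lam by (simp add: mult_nonneg_nonpos)
    then have "e \<le> sl" by (simp add: e_def)
    then show False using key b0 sl_st z by simp
  qed
  have low: "sl * \<theta> powr (2 / q) \<le> b - lam * \<iota>"
    using sl_le[OF \<sigma>(1)] \<theta>pos limI[OF L\<sigma>] by (simp add: b_def \<theta>_def)
  \<comment> \<open>By definition e is \<open>sl + lam * \<iota>\<close>; the terms with \<iota>
    cancel between \<open>key\<close> and \<open>low\<close>.\<close>
  have le: "st * (1 - \<theta>) powr (2 / q) \<le> sl * (1 - \<theta> powr (2 / q))"
    using key low unfolding e_def by (simp add: algebra_simps)
  have one: "\<theta> = 1"
  proof (rule ccontr)
    assume "\<theta> \<noteq> 1"
    then have lt: "\<theta> < 1" using \<theta>01 by simp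
    have tp: "\<theta> powr (2 / q) < 1" using powr_less_mono2[OF p(1) _ lt] \<theta>pos by simp
    have pos: "0 < (1 - \<theta>) powr (2 / q)" using lt by simp
    show False
    \<comment> \<open>\<open>sl\<close> may be negative, since \<open>lam\<close> is subtracted. In
      that case the signs alone contradict \<open>le\<close>, as \<open>st\<close> is
      nonnegative.\<close>
    proof (cases "0 \<le> sl")
      case True
      have "sl * (1 - \<theta> powr (2 / q)) \<le> sl * (1 - \<theta>) powr (2 / q)"
        using one_minus_powr_le[OF \<theta>01 p] True by (intro mult_left_mono)
      also have "\<dots> < st * (1 - \<theta>) powr (2 / q)" using pos sl_st by (intro mult_strict_right_mono)
      finally show False using le by simp
    next
      case False
      then have "sl * (1 - \<theta> powr (2 / q)) < 0" using tp by (simp add: mult_neg_pos)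
      moreover have "0 \<le> st * (1 - \<theta>) powr (2 / q)" using st0 by simp
      ultimately show False using le by simp
    qed
  qed
  \<comment> \<open>At \<theta> = 1, \<open>key\<close> says b \<le> e and \<open>low\<close> is the
    reverse inequality.\<close>
  have "b - lam * \<iota> = sl" using low key unfolding one e_def by simp
  then show ?thesis using \<sigma>(1) \<theta>pos one limI[OF L\<sigma>] by (intro exI[of _ \<sigma>]) (simp add: b_def \<theta>_def)
qed

end

section \<open>Attainment of the infimum\<close>

text \<open>A cover by empty sets costs nothing. Consequently a Dirichlet part of positive measure
  is nonempty.\<close>

lemma hausdorff_measure_empty: "hausdorff_measure d ({}::'a::metric_space set) = 0"
proof -
  have "hausdorff_pre d \<delta> ({}::'a set) \<le> 0" if "0 < \<delta>" for \<delta>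
    unfolding hausdorff_pre_def
    by (rule INF_lower2[of "\<lambda>i. {}"]) (use that in auto)
  then have "hausdorff_measure d ({}::'a set) \<le> 0"
    unfolding hausdorff_measure_def by (intro SUP_least) simp
  then show ?thesis by simp
qed

text \<open>A nonempty set inside the closure of its relative interior contains a whole boundary
  patch: near some p all frontier points are Dirichlet points. Segments leaving \<Omega> through
  this patch provide the initial ball.\<close>

lemma test_fun_energy_controlled:
  fixes \<Omega> \<Sigma>D \<Sigma>N :: "'a::euclidean_space set"
  assumes s: "0 < s" and \<Omega>: "smooth_bounded_domain \<Omega>"
    and \<Sigma>: "\<Sigma>D \<inter> \<Sigma>N = {}" "\<Sigma>D \<union> \<Sigma>N = frontier \<Omega>"
    and int: "\<Sigma>D \<subseteq> closure ((top_of_set (frontier \<Omega>)) interior_of \<Sigma>D)" and ne: "\<Sigma>D \<noteq> {}"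
  shows "energy_controlled s \<Omega> {f. test_fun \<Omega> \<Sigma>N f} \<Omega>"
proof -
  have op: "open \<Omega>" "bounded \<Omega>" "connected \<Omega>" using \<Omega> by (auto simp: smooth_bounded_domain_def)
  obtain p where "p \<in> (top_of_set (frontier \<Omega>)) interior_of \<Sigma>D" using int ne by fastforce
  then obtain T where T: "openin (top_of_set (frontier \<Omega>)) T" "p \<in> T" "T \<subseteq> \<Sigma>D"
    unfolding interior_of_def by blast
  then obtain U where U: "open U" "T = frontier \<Omega> \<inter> U" by (auto simp: openin_open)
  then obtain R where R: "0 < R" "ball p R \<subseteq> U" using T openE by blast
  have p: "p \<in> frontier \<Omega>" using T U by blast
  have sub: "frontier \<Omega> \<inter> ball p R \<subseteq> \<Sigma>D" using U T R by blast
  have "p \<in> closure \<Omega>" using p by (simp add: frontier_def)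
  then obtain x where x: "x \<in> \<Omega>" "x \<in> ball p R"
    using R(1) unfolding closure_approachable by (auto simp: dist_commute)
  obtain y where y: "y \<in> ball p R" "y \<notin> closure \<Omega>" using smooth_domain_exterior[OF \<Omega> p R(1)] by blast
  have C1T: "\<And>f. f \<in> {f. test_fun \<Omega> \<Sigma>N f} \<Longrightarrow> C1 f" using test_fun_C1 by blast
  have van: "f (b, y) = 0" if "f \<in> {f. test_fun \<Omega> \<Sigma>N f}" "b \<in> \<Sigma>D" "0 \<le> y" for f b y
  proof (rule test_fun_vanishes[of \<Omega> \<Sigma>N])
    have "b \<in> frontier \<Omega>" using that \<Sigma> by blast
    then show "b \<in> closure \<Omega>" "b \<notin> \<Omega> \<union> \<Sigma>N"
      using that \<Sigma>(1) op(1) by (auto simp: frontier_def interior_open)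
  qed (use that in auto)
  obtain d where "0 < d" "energy_controlled s \<Omega> {f. test_fun \<Omega> \<Sigma>N f} (ball x d)"
    by (rule energy_controlled_seed[where T = "{f. test_fun \<Omega> \<Sigma>N f}" and S = \<Sigma>D and s = s and \<Omega> = \<Omega> and p = p and R = R and x = x and y = y])
      (assumption | rule C1T van s op(1) sub x y that)+
  then show ?thesis
    using energy_controlled_domain[OF C1T s op smooth_domain_cone[OF \<Omega>] x(1)] by blast
qed

lemma test_fun_minimisation:
  fixes \<Omega> \<Sigma>N :: "'a::euclidean_space set"
  assumes s: "0 < s" "s < 1" and N: "2 * s < real DIM('a)" and \<kappa>: "0 < \<kappa>" and \<Omega>: "smooth_bounded_domain \<Omega>"
    and P: "energy_controlled s \<Omega> {f. test_fun \<Omega> \<Sigma>N f} \<Omega>"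
  shows "trace_minimisation \<Omega> {f. test_fun \<Omega> \<Sigma>N f} (ext_energy \<kappa> s \<Omega>) (crit_exp s DIM('a))"
proof -
  let ?T = "{f. test_fun \<Omega> \<Sigma>N f}"
  define E where "E = ext_energy \<kappa> s \<Omega>"
  define q where "q = crit_exp s DIM('a)"
  have qeq: "q = 2 * real DIM('a) / (real DIM('a) - 2 * s)" by (simp add: q_def crit_exp_def)
  have q2: "2 < q" unfolding qeq using s N by (simp add: field_simps)
  then have q0: "0 < q" by simp
  have dom: "open \<Omega>" "bounded \<Omega>" using \<Omega> by (auto simp: smooth_bounded_domain_def)
  interpret bounded_open \<Omega> by unfold_locales (rule dom)+
  have C1T: "\<And>f. f \<in> ?T \<Longrightarrow> C1 f" using test_fun_C1 by blast
  have lin: "(\<lambda>p. a * f p + b * g p) \<in> ?T" if "f \<in> ?T" "g \<in> ?T" for f g a b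
    using that by (auto intro: test_fun_lincomb)
  have diffT: "(\<lambda>p. f p - g p) \<in> ?T" if "f \<in> ?T" "g \<in> ?T" for f g
    using lin[OF that, of 1 "- 1"] by simp
  have E: "wenergy s \<Omega> f = ennreal (E f / \<kappa>)" "0 \<le> E f" if "f \<in> ?T" for f
    using ext_energy_eq_wenergy[OF _ dom s(2) \<kappa>, of \<Sigma>N f] that by (auto simp: E_def)
  have conv: "E (\<lambda>p. (1 - t) * f p + t * g p) = (1 - t) * E f + t * E g - t * (1 - t) * E (\<lambda>p. f p - g p)"
    if "f \<in> ?T" "g \<in> ?T" for f g t
    unfolding E_def by (rule ext_energy_lincomb[of \<Omega> \<Sigma>N]) (use that dom s in auto)
  have scale: "E (\<lambda>p. c * f p) = c\<^sup>2 * E f" if "f \<in> ?T" for f c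
    unfolding E_def by (rule ext_energy_scale[OF C1T[OF that]])
  have cont: "continuous_on UNIV (\<lambda>x. f (x, 0))" if "f \<in> ?T" for f
    by (rule C1_trace_continuous[OF C1T[OF that]])
  obtain C where C: "0 \<le> C" "\<And>f \<epsilon>. f \<in> ?T \<Longrightarrow> 0 \<le> \<epsilon> \<Longrightarrow> wenergy s \<Omega> f \<le> ennreal \<epsilon> \<Longrightarrow>
     trace_powr q \<Omega> f \<le> ennreal (C * \<epsilon> powr (q / 2))"
  proof (rule trace_sobolev[OF C1T dom smooth_domain_cone[OF \<Omega>] P s(1) N qeq])
    fix C :: real
    assume C: "0 \<le> C" "\<And>f \<epsilon>. f \<in> ?T \<Longrightarrow> 0 \<le> \<epsilon> \<Longrightarrow> wenergy s \<Omega> f \<le> ennreal \<epsilon> \<Longrightarrow>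
     trace_powr q \<Omega> f \<le> ennreal (C * \<epsilon> powr (q / 2))"
    show thesis by (rule that[OF C])
  qed
  have W_le: "pint q \<Omega> (\<lambda>x. f (x, 0)) \<le> C * (M / \<kappa>) powr (q / 2)" if f: "f \<in> ?T" and M: "E f \<le> M" for f M
  proof -
    have M0: "0 \<le> M" using E(2)[OF f] M by simp
    have "wenergy s \<Omega> f \<le> ennreal (M / \<kappa>)" unfolding E(1)[OF f] using M \<kappa> by (intro ennreal_leI divide_right_mono) auto
    from C(2)[OF f _ this] M0 \<kappa> have "ennreal (pint q \<Omega> (\<lambda>x. f (x, 0))) \<le> ennreal (C * (M / \<kappa>) powr (q / 2))"
      using pint_nn[OF cont[OF f] q0] by simp
    then show ?thesis using C(1) by (simp add: ennreal_le_iff)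
  qed
  show ?thesis
    unfolding E_def[symmetric] q_def[symmetric]
  proof unfold_locales
    show "\<exists>C\<ge>0. \<forall>f\<in>?T. pint q \<Omega> (\<lambda>x. f (x, 0)) \<le> C * E f powr (q / 2)"
    proof (intro exI[of _ "C * (1 / \<kappa>) powr (q / 2)"] conjI ballI)
      fix f assume f: "f \<in> ?T"
      have "(E f / \<kappa>) powr (q / 2) = (1 / \<kappa>) powr (q / 2) * E f powr (q / 2)"
        by (simp add: powr_mult[symmetric])
      then show "pint q \<Omega> (\<lambda>x. f (x, 0)) \<le> C * (1 / \<kappa>) powr (q / 2) * E f powr (q / 2)"
        using W_le[OF f order_refl] by (simp add: mult.assoc)
    qed (use C in auto)
  next
    fix \<phi> :: "nat \<Rightarrow> 'a \<times> real \<Rightarrow> real" and M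
    assume \<phi>: "\<And>n. \<phi> n \<in> ?T" and M: "\<And>n. E (\<phi> n) \<le> M"
    have M0: "0 \<le> M" using E(2)[OF \<phi>[of 0]] M[of 0] by simp
    \<comment> \<open>The energy of the midpoint is nonnegative, so that of the difference is at
      most twice the sum of both energies.\<close>
    have Ed: "E (\<lambda>p. \<phi> m p - \<phi> n p) \<le> 4 * M" for m n
      using conv[OF \<phi>[of m] \<phi>[of n], of "1/2"] E(2)[OF lin[OF \<phi>[of m] \<phi>[of n], of "1 - 1/2" "1/2"]] M[of m] M[of n] by simp
    define S where "S = C * (4 * M / \<kappa>) powr (q / 2)"
    have S: "0 \<le> S" using C by (simp add: S_def)
    \<comment> \<open>The L^1 bound keeps the averages in \<open>trace_compactness\<close> bounded,
      so that a subsequence of them can converge.\<close>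
    have L1: "(LINT x:\<Omega>|lborel. \<bar>\<phi> n (x, 0)\<bar>) \<le> measure lborel \<Omega> + C * (M / \<kappa>) powr (q / 2)" for n
    proof -
      have le: "\<bar>u\<bar> \<le> 1 + \<bar>u\<bar> powr q" for u :: real
      proof (cases "\<bar>u\<bar> \<le> 1")
        case False
        then have "\<bar>u\<bar> powr 1 \<le> \<bar>u\<bar> powr q" using q2 by (intro powr_mono) auto
        then show ?thesis using False by simp
      qed (simp add: add_increasing2)
      have "(LINT x:\<Omega>|lborel. \<bar>\<phi> n (x, 0)\<bar>) \<le> (LINT x:\<Omega>|lborel. 1 + \<bar>\<phi> n (x, 0)\<bar> powr q)"
        by (intro LINT_mono le continuous_intros cont \<phi> cont_powr q0)
      also have "\<dots> = measure lborel \<Omega> + pint q \<Omega> (\<lambda>x. \<phi> n (x, 0))"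
        unfolding pint_def
        by (subst set_integral_add, (intro integ continuous_intros cont \<phi> cont_powr q0)+, simp add: LINT_const)
      finally show ?thesis using W_le[OF \<phi> M, of n] by simp
    qed
    show "\<exists>k::nat \<Rightarrow> nat. strict_mono k \<and> (\<forall>\<epsilon>>0. \<exists>n0. \<forall>m\<ge>n0. \<forall>n\<ge>n0.
           pint 2 \<Omega> (\<lambda>x. \<phi> (k m) (x, 0) - \<phi> (k n) (x, 0)) < \<epsilon>)"
    proof (rule trace_compactness[OF dom s(1), of \<phi> "4 * M / \<kappa>" q S])
      show "wenergy s \<Omega> (\<lambda>p. \<phi> m p - \<phi> n p) \<le> ennreal (4 * M / \<kappa>)" for m n
        unfolding E(1)[OF diffT[OF \<phi> \<phi>]] using Ed \<kappa> by (intro ennreal_leI divide_right_mono) auto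
      show "(\<integral>\<^sup>+x\<in>\<Omega>. ennreal (\<bar>\<phi> m (x, 0) - \<phi> n (x, 0)\<bar> powr q) \<partial>lborel) \<le> ennreal S" for m n
        using pint_nn[OF cont[OF diffT[OF \<phi>[of m] \<phi>[of n]]] q0] W_le[OF diffT[OF \<phi>[of m] \<phi>[of n]] Ed]
        by (simp add: S_def ennreal_leI)
      fix k :: "nat \<Rightarrow> nat"
      assume k: "strict_mono k" "\<And>\<epsilon>. 0 < \<epsilon> \<Longrightarrow> \<exists>n0. \<forall>m\<ge>n0. \<forall>n\<ge>n0.
         (\<integral>\<^sup>+x\<in>\<Omega>. ennreal ((\<phi> (k m) (x, 0) - \<phi> (k n) (x, 0))\<^sup>2) \<partial>lborel) \<le> ennreal \<epsilon>"
      have nn: "(\<integral>\<^sup>+x\<in>\<Omega>. ennreal ((\<phi> m (x, 0) - \<phi> n (x, 0))\<^sup>2) \<partial>lborel) = ennreal (pint 2 \<Omega> (\<lambda>x. \<phi> m (x, 0) - \<phi> n (x, 0)))" for m n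
        using pint_nn[OF cont[OF diffT[OF \<phi>[of m] \<phi>[of n]]], of 2] by (simp add: powr_numeral)
      have "\<exists>n0. \<forall>m\<ge>n0. \<forall>n\<ge>n0. pint 2 \<Omega> (\<lambda>x. \<phi> (k m) (x, 0) - \<phi> (k n) (x, 0)) < \<epsilon>" if \<epsilon>: "0 < \<epsilon>" for \<epsilon>
      proof -
        have "0 < \<epsilon> / 2" using \<epsilon> by simp
        from k(2)[OF this] obtain n0 where n0: "\<forall>m\<ge>n0. \<forall>n\<ge>n0. pint 2 \<Omega> (\<lambda>x. \<phi> (k m) (x, 0) - \<phi> (k n) (x, 0)) \<le> \<epsilon> / 2"
          unfolding nn using \<epsilon> by (auto simp: ennreal_le_iff)
        have "pint 2 \<Omega> (\<lambda>x. \<phi> (k m) (x, 0) - \<phi> (k n) (x, 0)) < \<epsilon>" if "n0 \<le> m" "n0 \<le> n" for m n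
          using n0[rule_format, OF that] \<epsilon> by linarith
        then show ?thesis by blast
      qed
      then show ?thesis using k(1) by blast
    qed (use \<phi> C1T diffT M0 \<kappa> q2 S L1 in auto)
  qed (use q2 lin cont E conv scale in auto)
qed

theorem theorem2p11:
  fixes \<Omega> \<Sigma>D \<Sigma>N \<Gamma> :: "(real ^ 'n) set" and s \<kappa> lam :: real
  assumes "1/2 < s" "s < 1" "real CARD('n) > 2 * s"
    and "\<kappa> > 0"
    and "smooth_bounded_domain \<Omega>"
    and "closed \<Sigma>D"
    and "\<Sigma>D \<inter> \<Sigma>N = {}" "\<Sigma>D \<union> \<Sigma>N = frontier \<Omega>"
    and "\<Sigma>D \<subseteq> closure ((top_of_set (frontier \<Omega>)) interior_of \<Sigma>D)"
    and "hausdorff_measure (real CARD('n) - 1) \<Sigma>D > 0"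
    and "\<Gamma> = \<Sigma>D \<inter> closure \<Sigma>N"
    and "smooth_submanifold_codim 2 \<Gamma>"
    and "lam \<ge> 0"
    and "S_lambda \<kappa> s lam \<Omega> \<Sigma>N < S_tilde \<kappa> s \<Omega> \<Sigma>N"
  shows "\<exists>F \<in> admissible \<kappa> s \<Omega> \<Sigma>N. Q_lambda \<kappa> s lam \<Omega> F = S_lambda \<kappa> s lam \<Omega> \<Sigma>N"
proof -
  define q where "q = crit_exp s DIM(real ^ 'n)"
  define E where "E = ext_energy \<kappa> s \<Omega>"
  have q_eq: "crit_exp s CARD('n) = q" by (simp add: q_def)
  let ?T = "{f. test_fun \<Omega> \<Sigma>N f}"
  have "\<Sigma>D \<noteq> {}" using assms(10) by (auto simp: hausdorff_measure_empty)
  then have "energy_controlled s \<Omega> ?T \<Omega>"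
    using assms by (intro test_fun_energy_controlled[where \<Sigma>D = \<Sigma>D]) auto
  then interpret trace_minimisation \<Omega> ?T E q
    unfolding E_def q_def using assms by (intro test_fun_minimisation) auto
  define lW lL lE where "lW F = lim (\<lambda>n. pint q \<Omega> (\<lambda>x. F n (x, 0)))"
    and "lL F = lim (\<lambda>n. pint 2 \<Omega> (\<lambda>x. F n (x, 0)))" and "lE F = lim (\<lambda>n. E (F n))"
    for F :: "nat \<Rightarrow> (real ^ 'n) \<times> real \<Rightarrow> real"
  have Xc: "X_cauchy \<kappa> s \<Omega> \<Sigma>N F \<longleftrightarrow> ecauchy F" for F
    unfolding X_cauchy_def ecauchy_def by (simp add: E_def)
  have lims: "(\<lambda>n. pint q \<Omega> (\<lambda>x. F n (x, 0))) \<longlonglongrightarrow> lW F" "(\<lambda>n. pint 2 \<Omega> (\<lambda>x. F n (x, 0))) \<longlonglongrightarrow> lL F" "(\<lambda>n. E (F n)) \<longlonglongrightarrow> lE F"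
    if "ecauchy F" for F
    using ecauchy_convergent[OF that] by (simp_all add: lW_def lL_def lE_def convergent_LIMSEQ_iff)
  have FT: "F n \<in> ?T" if "ecauchy F" for F n using that by (simp add: ecauchy_def)
  have nonneg: "0 \<le> lW F" "0 \<le> lL F" "0 \<le> lE F" if "ecauchy F" for F
    using lims[OF that] by (auto intro!: LIMSEQ_le_const[where a = 0] pint_nonneg E_nonneg FT[OF that])
  \<comment> \<open>\<open>trace_Lp\<close> is a limit of norms; continuity of the root on
    nonnegative numbers reduces it to the limit of the power integrals.\<close>
  have tr: "trace_Lp p \<Omega> F = l powr (1 / p)" if "(\<lambda>n. pint p \<Omega> (\<lambda>x. F n (x, 0))) \<longlonglongrightarrow> l" "0 < p" for p l F
    unfolding trace_Lp_def Lp_norm_def trace0_def pint_def[symmetric]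
    by (rule limI, rule tendsto_powr2[OF that(1) tendsto_const]) (use that(2) pint_nonneg in auto)
  have trq: "(trace_Lp q \<Omega> F)\<^sup>2 = lW F powr (2 / q)" if "ecauchy F" for F
  proof -
    have "(trace_Lp q \<Omega> F)\<^sup>2 = (lW F powr (1 / q)) powr 2"
      unfolding tr[OF lims(1)[OF that] q0] by (simp add: powr_numeral)
    then show ?thesis by (simp add: powr_powr)
  qed
  have tr2: "(trace_Lp 2 \<Omega> F)\<^sup>2 = lL F" if "ecauchy F" for F
    unfolding tr[OF lims(2)[OF that] zero_less_numeral] using nonneg(2)[OF that] by (simp add: powr_half_sqrt)
  have adm: "F \<in> admissible \<kappa> s \<Omega> \<Sigma>N \<longleftrightarrow> ecauchy F \<and> 0 < lW F" for F
  proof (cases "ecauchy F")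
    case True
    then show ?thesis using tr[OF lims(1)[OF True] q0] nonneg(1)[OF True]
      by (auto simp: admissible_def Xc q_eq)
  qed (simp add: admissible_def Xc)
  have Xn: "X_normsq \<kappa> s \<Omega> F = lE F" for F by (simp add: X_normsq_def lE_def E_def)
  have Q: "Q_lambda \<kappa> s lam \<Omega> F = (lE F - lam * lL F) / lW F powr (2 / q)" if "ecauchy F" for F
    unfolding Q_lambda_def Xn q_def[symmetric] trq[OF that] tr2[OF that] by simp
  define sl st where "sl = S_lambda \<kappa> s lam \<Omega> \<Sigma>N" and "st = S_tilde \<kappa> s \<Omega> \<Sigma>N"
  have sl_st: "sl < st" using assms by (simp add: sl_def st_def)
  \<comment> \<open>For an empty admissible set both quotients would be the same unspecified real \<open>Inf {}\<close>.\<close>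
  have ne: "admissible \<kappa> s \<Omega> \<Sigma>N \<noteq> {}"
  proof
    assume "admissible \<kappa> s \<Omega> \<Sigma>N = {}"
    then show False using sl_st by (simp add: sl_def st_def S_lambda_def S_tilde_def)
  qed
  define R where "R F = lE F / lW F powr (2 / q)" for F
  have st: "st = Inf (R ` admissible \<kappa> s \<Omega> \<Sigma>N)"
    unfolding st_def S_tilde_def
    by (rule arg_cong[where f = Inf], rule image_cong) (auto simp: adm R_def Xn q_eq trq)
  have R0: "0 \<le> R F" if "F \<in> admissible \<kappa> s \<Omega> \<Sigma>N" for F
    using that nonneg(3)[of F] by (simp add: R_def adm)
  have bdR: "bdd_below (R ` admissible \<kappa> s \<Omega> \<Sigma>N)" by (rule bdd_belowI[of _ 0]) (use R0 in auto)
  \<comment> \<open>A real \<open>Inf\<close> is a lower bound only for sets that are bounded below.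
    For the quotients this follows from the control of the L^2 mass by the critical mass.\<close>
  have bdQ: "bdd_below (Q_lambda \<kappa> s lam \<Omega> ` admissible \<kappa> s \<Omega> \<Sigma>N)"
  proof (rule bdd_belowI[of _ "- lam * (1 + measure lborel \<Omega>)"], safe)
    fix F assume "F \<in> admissible \<kappa> s \<Omega> \<Sigma>N"
    then have F: "ecauchy F" "0 < lW F" by (auto simp: adm)
    \<comment> \<open>This r balances the interpolation: \<open>r powr (2 - q) * lW F\<close> and
      the factor of the volume are both \<open>r\<^sup>2\<close>, which is
      \<open>lW F powr (2 / q)\<close>.\<close>
    define r where "r = lW F powr (1 / q)"
    have r: "0 < r" using F by (simp add: r_def)
    have "(\<lambda>n. r powr (2 - q) * pint q \<Omega> (\<lambda>x. F n (x, 0)) + r\<^sup>2 * measure lborel \<Omega>) \<longlonglongrightarrow> r powr (2 - q) * lW F + r\<^sup>2 * measure lborel \<Omega>"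
      by (intro tendsto_intros lims F)
    then have "lL F \<le> r powr (2 - q) * lW F + r\<^sup>2 * measure lborel \<Omega>"
      by (rule tendsto_le_everywhere[OF L_small[OF FT[OF F(1)] r] lims(2)[OF F(1)]])
    also have "lW F = r powr q" using F q0 by (simp add: r_def powr_powr)
    also have "r powr (2 - q) * r powr q = r\<^sup>2" using r by (simp add: powr_add[symmetric] powr_numeral)
    also have "r\<^sup>2 = lW F powr (2 / q)"
    proof -
      have "r\<^sup>2 = r powr 2" using r by (simp add: powr_numeral)
      then show ?thesis by (simp add: r_def powr_powr)
    qed
    finally have "lL F \<le> (1 + measure lborel \<Omega>) * lW F powr (2 / q)" by (simp add: algebra_simps)
    then have "lam * lL F \<le> lam * ((1 + measure lborel \<Omega>) * lW F powr (2 / q))"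
      using assms(13) by (intro mult_left_mono)
    then have "- lam * (1 + measure lborel \<Omega>) * lW F powr (2 / q) \<le> lE F - lam * lL F"
      using nonneg(3)[OF F(1)] by (simp add: mult.assoc)
    then show "- lam * (1 + measure lborel \<Omega>) \<le> Q_lambda \<kappa> s lam \<Omega> F"
      unfolding Q[OF F(1)] using F(2) by (simp add: pos_le_divide_eq)
  qed
  have "\<exists>F. ecauchy F \<and> 0 < lW F \<and> lE F - lam * lL F = sl * lW F powr (2 / q)"
    unfolding lW_def lL_def lE_def
  proof (rule minimum_attained[OF assms(13) sl_st])
    show "0 \<le> st" unfolding st using R0 ne by (intro cInf_greatest) auto
    show "st * pint q \<Omega> (\<lambda>x. f (x, 0)) powr (2 / q) \<le> E f" if f: "f \<in> ?T" for f
    proof (cases "pint q \<Omega> (\<lambda>x. f (x, 0)) = 0")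
      case True
      then show ?thesis using E_nonneg[OF f] by simp
    next
      case False
      then have pos: "0 < pint q \<Omega> (\<lambda>x. f (x, 0))" using pint_nonneg[of q "\<lambda>x. f (x, 0)"] by simp
      \<comment> \<open>A single test function of positive critical mass is an admissible element
        through its constant sequence.\<close>
      have "(\<lambda>n. f) \<in> admissible \<kappa> s \<Omega> \<Sigma>N" using ecauchy_const[OF f] pos by (simp add: adm lW_def)
      then have "st \<le> R (\<lambda>n. f)" unfolding st using bdR by (intro cInf_lower) auto
      then show ?thesis using pos by (simp add: R_def lE_def lW_def pos_le_divide_eq)
    qed
    fix F assume F: "ecauchy F" "0 < lim (\<lambda>n. pint q \<Omega> (\<lambda>x. F n (x, 0)))"
    then have "F \<in> admissible \<kappa> s \<Omega> \<Sigma>N" by (simp add: adm lW_def)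
    then have "sl \<le> Q_lambda \<kappa> s lam \<Omega> F" unfolding sl_def S_lambda_def using bdQ by (intro cInf_lower) auto
    then show "sl * lim (\<lambda>n. pint q \<Omega> (\<lambda>x. F n (x, 0))) powr (2 / q) \<le> lim (\<lambda>n. E (F n)) - lam * lim (\<lambda>n. pint 2 \<Omega> (\<lambda>x. F n (x, 0)))"
      unfolding Q[OF F(1)] using F(2) by (simp add: lW_def lL_def lE_def pos_le_divide_eq)
  next
    fix \<epsilon> :: real assume "0 < \<epsilon>"
    then have "Inf (Q_lambda \<kappa> s lam \<Omega> ` admissible \<kappa> s \<Omega> \<Sigma>N) < sl + \<epsilon>" by (simp add: sl_def S_lambda_def)
    then obtain F where F: "F \<in> admissible \<kappa> s \<Omega> \<Sigma>N" "Q_lambda \<kappa> s lam \<Omega> F < sl + \<epsilon>"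
      using cInf_lessD[of "Q_lambda \<kappa> s lam \<Omega> ` admissible \<kappa> s \<Omega> \<Sigma>N"] ne by blast
    then have F': "ecauchy F" "0 < lW F" by (auto simp: adm)
    have "lE F - lam * lL F < (sl + \<epsilon>) * lW F powr (2 / q)"
      using F(2) F'(2) unfolding Q[OF F'(1)] by (simp add: pos_divide_less_eq)
    then show "\<exists>F. ecauchy F \<and> 0 < lim (\<lambda>n. pint q \<Omega> (\<lambda>x. F n (x, 0))) \<and>
       lim (\<lambda>n. E (F n)) - lam * lim (\<lambda>n. pint 2 \<Omega> (\<lambda>x. F n (x, 0))) < (sl + \<epsilon>) * lim (\<lambda>n. pint q \<Omega> (\<lambda>x. F n (x, 0))) powr (2 / q)"
      using F' unfolding lW_def lL_def lE_def by blast
  qed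
  then obtain F where F: "ecauchy F" "0 < lW F" "lE F - lam * lL F = sl * lW F powr (2 / q)" by blast
  have "Q_lambda \<kappa> s lam \<Omega> F = sl" unfolding Q[OF F(1)] F(3) using F(2) by simp
  then show ?thesis using F by (intro bexI[of _ F]) (auto simp: adm sl_def)
qed

end
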